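(* Let $[k_0,k_1,k_\infty]$ be one of the polyhedral triples listed in the context, let $N$ be the corresponding group order and let $P_0,P_1,P_\infty$ be the associated homogeneous polynomials described in the context. Let $(a,b,c)$ be a real triple such that $\mu_0=1-c$, $\mu_1=c-a-b$, $\mu_\infty=a-b$ satisfy $|\mu_j|=1/k_j$ for $j=0,1,\infty$, with $a,b$ ordered so that one of the sign patterns (i)–(iv) below holds. Let $u(x)=F(a,b,c;x)$, $v(x)=x^{1-c}F(a-c+1,b-c+1,2-c;x)$, and let $\mathrm{asch}:x\mapsto(u(x),v(x))$ be the (multivalued) affine Schwarz map. Write $Q_j=P_j(u,v)$ in cases (i), (ii) and $Q_j=P_j(v,u)$ in cases (iii), (iv). Then the image curve in the $(u,v)$-plane $\mathbb{C}^2$ of $\mathrm{asch}$ has the following equation, and the inverse map of $\mathrm{asch}$ (from the image curve to the $x$-line) is given by the following formula: (i) if $\mu_0>0,\mu_1>0,\mu_\infty>0$: equation $Q_\infty-1=0$; inverse map $x=Q_0^{k_0}$; (ii) if $\mu_0>0,\mu_1<0,\mu_\infty<0$: equation $Q_1^{N/k_\infty}-Q_\infty^{N/k_1-1}=0$; inverse map $x=Q_0^{k_0}Q_\infty^{-k_\infty}$; (iii) if $\mu_0<0,\mu_1>0,\mu_\infty<0$: equation $Q_0^{N/k_\infty}-Q_\infty^{N/k_0-1}=0$; inverse map $x=Q_0^{k_0}Q_\infty^{-k_\infty}$; (iv) if $\mu_0<0,\mu_1<0,\mu_\infty>0$: equation $(Q_0Q_1)^{N/k_\infty}-Q_\infty^{N/k_0+N/k_1-1}=0$;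 inverse map $x=Q_0^{k_0}Q_\infty^{-k_\infty}$.
   Context: $F(a,b,c;x)=\sum_{n\ge0}\frac{(a,n)(b,n)}{(c,n)(1,n)}x^n$, where $(a,n)=a(a+1)\cdots(a+n-1)$ (with $(a,0)=1$). The functions $u,v$ are linearly independent solutions of the hypergeometric equation $x(1-x)w''+\{c-(a+b+1)x\}w'-abw=0$ and are continued analytically along all paths in $X=\mathbb{C}\setminus\{0,1\}$. The image curve of $\mathrm{asch}$ is the algebraic curve in $\mathbb{C}^2$ (closure understood) traced out by all values $(u(x),v(x))$ over all $x\in X$ and all analytic continuations. Polyhedral triples $[k_0,k_1,k_\infty]$ and group order $N$, where $\frac2N=\frac1{k_0}+\frac1{k_1}+\frac1{k_\infty}-1$: Dihedral ($n\ge2$, $N=2n$): D1 $=[2,2,n]$, D2 $=[2,n,2]$, D3 $=[n,2,2]$. Tetrahedral ($N=12$): T1 $=[2,3,3]$, T2 $=[3,2,3]$, T3 $=[3,3,2]$. Octahedral ($N=24$): O1 $=[2,3,4]$, O2 $=[2,4,3]$, O3 $=[3,2,4]$, O4 $=[3,4,2]$, O5 $=[4,2,3]$, O6 $=[4,3,2]$. Icosahedral ($N=60$): I1 $=[2,3,5]$, I2 $=[2,5,3]$, I3 $=[3,2,5]$, I4 $=[3,5,2]$, I5 $=[5,2,3]$, I6 $=[5,3,2]$. The polynomials $P_j$ are homogeneous of degree $N/k_j$. For the triples I2, I3, I4, I5 they are the homogeneous polynomials of degree $N/k_j$ satisfying, for the parameters $(a,b,c)$ with $\mu_0=1/k_0,\mu_1=1/k_1,\mu_\infty=1/k_\infty$,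 the identities $P_0(u(x),v(x))=x^{1/k_0}$, $P_1(u(x),v(x))=(1-x)^{1/k_1}$, $P_\infty(u(x),v(x))=1$ near $x=0$ (same branch of $\log x$ in $v$ and in $x^{1/k_0}$; $(1-x)^{1/k_1}=1$ at $x=0$). For the other triples they are as follows (below $\sqrt{-1}$ is the imaginary unit, $P_j=P_j(u,v)$, and $\binom nm=0$ for $m>n$): D1: $P_0=\sqrt{-1}\sum_{k=0}^{[n/2]}\binom{n}{2k+1}u^{n-2k-1}\left(\frac{v}{\sqrt{-1}\,n}\right)^{2k+1}$, $P_1=\sum_{k=0}^{[n/2]}\binom{n}{2k}u^{n-2k}\left(\frac{v}{\sqrt{-1}\,n}\right)^{2k}$, $P_\infty=u^2+\frac1{n^2}v^2$. D2: $P_0=\sum_{k=0}^{[n/2]}\binom{n}{2k+1}u^{n-2k-1}\left(\frac vn\right)^{2k+1}$, $P_1=u^2-\frac1{n^2}v^2$, $P_\infty=\sum_{k=0}^{[n/2]}\binom{n}{2k}u^{n-2k}\left(\frac vn\right)^{2k}$. D3: $P_0=uv$, $P_1=u^n-\frac14v^n$, $P_\infty=u^n+\frac14v^n$. T1: $P_0=u^5v+\frac1{432}uv^5$, $P_1=u^4-\frac16u^2v^2-\frac1{432}v^4$, $P_\infty=u^4+\frac16u^2v^2-\frac1{432}v^4$. T2: $P_0=u^3v-\frac1{64}v^4$, $P_1=u^6-\frac5{16}u^3v^3-\frac1{512}v^6$, $P_\infty=u^4+\frac18uv^3$. T3: $P_0=u^3v+\frac1{64}v^4$, $P_1=u^4-\frac18uv^3$,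 $P_\infty=u^6+\frac5{16}u^3v^3-\frac1{512}v^6$. O1: $P_0=u^{11}v-\frac{11}{432}u^9v^3+\frac{11}{3456}u^7v^5+\frac{11}{165888}u^5v^7-\frac{11}{47775744}u^3v^9+\frac1{254803968}uv^{11}$, $P_1=u^8-\frac7{36}u^6v^2-\frac7{3456}u^4v^4-\frac7{82944}u^2v^6+\frac1{5308416}v^8$, $P_\infty=u^6+\frac5{48}u^4v^2-\frac5{2304}u^2v^4-\frac1{110592}v^6$. O2: $P_0=u^{11}v+\frac{11}{432}u^9v^3+\frac{11}{3456}u^7v^5-\frac{11}{165888}u^5v^7-\frac{11}{47775744}u^3v^9-\frac1{254803968}uv^{11}$, $P_1=u^6-\frac5{48}u^4v^2-\frac5{2304}u^2v^4+\frac1{110592}v^6$, $P_\infty=u^8+\frac7{36}u^6v^2-\frac7{3456}u^4v^4+\frac7{82944}u^2v^6+\frac1{5308416}v^8$. O3: $P_0=u^7v-\frac7{256}u^4v^4-\frac1{8192}uv^7$, $P_1=u^{12}-\frac{11}{32}u^9v^3-\frac{11}{262144}u^3v^9-\frac1{67108864}v^{12}$, $P_\infty=u^6+\frac5{64}u^3v^3-\frac1{8192}v^6$. O4: $P_0=u^7v+\frac7{256}u^4v^4-\frac1{8192}uv^7$, $P_1=u^6-\frac5{64}u^3v^3-\frac1{8192}v^6$, $P_\infty=u^{12}+\frac{11}{32}u^9v^3+\frac{11}{262144}u^3v^9-\frac1{67108864}v^{12}$. O5: $P_0=u^5v-\frac1{108}uv^5$, $P_1=u^{12}-\frac{11}{36}u^8v^4-\frac{11}{3888}u^4v^8+\frac1{1259712}v^{12}$,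 $P_\infty=u^8+\frac7{54}u^4v^4+\frac1{11664}v^8$. O6: $P_0=u^5v+\frac1{108}uv^5$, $P_1=u^8-\frac7{54}u^4v^4+\frac1{11664}v^8$, $P_\infty=u^{12}+\frac{11}{36}u^8v^4-\frac{11}{3888}u^4v^8-\frac1{1259712}v^{12}$. I1: $P_0=u^{29}v-\frac{29}{675}u^{27}v^3+\frac{1769}{450000}u^{25}v^5+\frac{29}{337500}u^{23}v^7+\frac{667}{540000000}u^{21}v^9-\frac{667}{72900000000}u^{19}v^{11}+\frac{12673}{29160000000000}u^{17}v^{13}-\frac{12673}{524880000000000000}u^{13}v^{17}+\frac{667}{23619600000000000000}u^{11}v^{19}-\frac{667}{3149280000000000000000}u^9v^{21}-\frac{29}{35429400000000000000000}u^7v^{23}-\frac{1769}{850305600000000000000000000}u^5v^{25}+\frac{29}{22958251200000000000000000000}u^3v^{27}-\frac1{612220032000000000000000000000}uv^{29}$, $P_1=u^{20}-\frac{19}{90}u^{18}v^2-\frac{19}{18000}u^{16}v^4-\frac{19}{135000}u^{14}v^6-\frac{247}{162000000}u^{12}v^8+\frac{247}{14580000000}u^{10}v^{10}-\frac{247}{2916000000000}u^8v^{12}-\frac{19}{43740000000000}u^6v^{14}-\frac{19}{104976000000000000}u^4v^{16}-\frac{19}{9447840000000000000}u^2v^{18}+\frac1{1889568000000000000000}v^{20}$, $P_\infty=u^{12}+\frac{11}{150}u^{10}v^2-\frac{11}{6000}u^8v^4-\frac{11}{1350000}u^6v^6-\frac{11}{108000000}u^4v^8+\frac{11}{48600000000}u^2v^{10}+\frac1{5832000000000}v^{12}$.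 I6: $P_0=u^{11}v+\frac{11}{1728}u^6v^6-\frac1{2985984}uv^{11}$, $P_1=u^{20}-\frac{19}{144}u^{15}v^5+\frac{247}{1492992}u^{10}v^{10}+\frac{19}{429981696}u^5v^{15}+\frac1{8916100448256}v^{20}$, $P_\infty=u^{30}+\frac{29}{96}u^{25}v^5-\frac{3335}{995328}u^{20}v^{10}-\frac{3335}{2972033482752}u^{10}v^{20}-\frac{29}{855945643032576}u^5v^{25}+\frac1{26623333280885243904}v^{30}$.
   Formalization: For T3 and for D1 with n odd, the equations in (ii) and (iii) also contain curves outside the image; there the image curve is proved to lie in the printed curve and to equal the zero set obtained by dividing both exponents by their gcd. *)

theory Defs
  imports "HOL-Complex_Analysis.Complex_Analysis"
begin

section \<open>Polyhedral triples\<close>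

datatype polyhedral =
    D1 nat | D2 nat | D3 nat
  | T1 | T2 | T3
  | O1 | O2 | O3 | O4 | O5 | O6
  | I1 | I2 | I3 | I4 | I5 | I6

fun valid_polyhedral :: "polyhedral \<Rightarrow> bool" where
  "valid_polyhedral (D1 n) \<longleftrightarrow> n \<ge> 2"
| "valid_polyhedral (D2 n) \<longleftrightarrow> n \<ge> 2"
| "valid_polyhedral (D3 n) \<longleftrightarrow> n \<ge> 2"
| "valid_polyhedral _ \<longleftrightarrow> True"

fun k0 :: "polyhedral \<Rightarrow> nat" where
  "k0 (D1 n) = 2" | "k0 (D2 n) = 2" | "k0 (D3 n) = n" | "k0 T1 = 2" | "k0 T2 = 3"
  | "k0 T3 = 3" | "k0 O1 = 2" | "k0 O2 = 2" | "k0 O3 = 3" | "k0 O4 = 3" | "k0 O5 = 4"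
  | "k0 O6 = 4" | "k0 I1 = 2" | "k0 I2 = 2" | "k0 I3 = 3" | "k0 I4 = 3" | "k0 I5 = 5"
  | "k0 I6 = 5"

fun k1 :: "polyhedral \<Rightarrow> nat" where
  "k1 (D1 n) = 2" | "k1 (D2 n) = n" | "k1 (D3 n) = 2" | "k1 T1 = 3" | "k1 T2 = 2"
  | "k1 T3 = 3" | "k1 O1 = 3" | "k1 O2 = 4" | "k1 O3 = 2" | "k1 O4 = 4" | "k1 O5 = 2"
  | "k1 O6 = 3" | "k1 I1 = 3" | "k1 I2 = 5" | "k1 I3 = 2" | "k1 I4 = 5" | "k1 I5 = 2"
  | "k1 I6 = 3"

fun kinf :: "polyhedral \<Rightarrow> nat" where
  "kinf (D1 n) = n" | "kinf (D2 n) = 2" | "kinf (D3 n) = 2" | "kinf T1 = 3" | "kinf T2 = 3"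
  | "kinf T3 = 2" | "kinf O1 = 4" | "kinf O2 = 3" | "kinf O3 = 4" | "kinf O4 = 2"
  | "kinf O5 = 3" | "kinf O6 = 2" | "kinf I1 = 5" | "kinf I2 = 3" | "kinf I3 = 5"
  | "kinf I4 = 2" | "kinf I5 = 3" | "kinf I6 = 2"

fun polyhedral_order :: "polyhedral \<Rightarrow> nat" where
  "polyhedral_order (D1 n) = 2 * n"
| "polyhedral_order (D2 n) = 2 * n"
| "polyhedral_order (D3 n) = 2 * n"
| "polyhedral_order T1 = 12" | "polyhedral_order T2 = 12" | "polyhedral_order T3 = 12"
| "polyhedral_order O1 = 24" | "polyhedral_order O2 = 24" | "polyhedral_order O3 = 24"
| "polyhedral_order O4 = 24" | "polyhedral_order O5 = 24" | "polyhedral_order O6 = 24"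
| "polyhedral_order I1 = 60" | "polyhedral_order I2 = 60" | "polyhedral_order I3 = 60"
| "polyhedral_order I4 = 60" | "polyhedral_order I5 = 60" | "polyhedral_order I6 = 60"

lemma polyhedral_order_eq:
  "valid_polyhedral T \<Longrightarrow>
     2 / real (polyhedral_order T) = 1 / real (k0 T) + 1 / real (k1 T) + 1 / real (kinf T) - 1"
  by (cases T) (simp_all add: field_simps)

text \<open>The exponents \<open>N / k\<^sub>j\<close> below are written with \<open>div\<close>; the division is exact.\<close>

lemma polyhedral_dvd_order:
  "k0 T dvd polyhedral_order T" "k1 T dvd polyhedral_order T" "kinf T dvd polyhedral_order T"
  by (cases T; simp)+


section \<open>The affine Schwarz map\<close>

definition hyp_F :: "real \<Rightarrow> real \<Rightarrow> real \<Rightarrow> complex \<Rightarrow> complex" where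
  "hyp_F a b c x = eval_fps (fps_hypergeo [of_real a, of_real b] [of_real c] 1) x"

lemma hyp_F_series:
  "hyp_F a b c x =
     (\<Sum>n. pochhammer (of_real a) n * pochhammer (of_real b) n /
            (pochhammer (of_real c) n * pochhammer 1 n) * x ^ n)"
  by (simp add: hyp_F_def eval_fps_def pochhammer_fact[symmetric])

definition hyp_u :: "real \<Rightarrow> real \<Rightarrow> real \<Rightarrow> complex \<Rightarrow> complex" where
  "hyp_u a b c x = hyp_F a b c x"

text \<open>Here \<open>x\<^sup>1\<^sup>-\<^sup>c\<close> is the principal branch; it is used only on the slit disc below, where it is
  holomorphic.\<close>

definition hyp_v :: "real \<Rightarrow> real \<Rightarrow> real \<Rightarrow> complex \<Rightarrow> complex" where
  "hyp_v a b c x = x powr of_real (1 - c) * hyp_F (a - c + 1) (b - c + 1) (2 - c) x"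

definition slit_disc :: "complex set" where
  "slit_disc = ball 0 1 - \<real>\<^sub>\<le>\<^sub>0"

text \<open>Analytic continuation along a path \<open>\<gamma>\<close>: a family \<open>f t\<close> of functions, each holomorphic near
  \<open>\<gamma> t\<close>, such that the germ of \<open>f s\<close> at \<open>\<gamma> s\<close> is the one of \<open>f t\<close> whenever \<open>s\<close> is close to \<open>t\<close>.\<close>

definition continuation_along ::
    "(real \<Rightarrow> complex) \<Rightarrow> (real \<Rightarrow> complex \<Rightarrow> complex) \<Rightarrow> bool" where
  "continuation_along \<gamma> f \<longleftrightarrow>
     (\<forall>t\<in>{0..1}. \<exists>r>0. \<exists>d>0. f t holomorphic_on ball (\<gamma> t) r \<and>
        (\<forall>s\<in>{0..1}. \<bar>s - t\<bar> < d \<longrightarrow>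
           \<gamma> s \<in> ball (\<gamma> t) r \<and> (\<forall>\<^sub>F z in nhds (\<gamma> s). f s z = f t z)))"

text \<open>The graph of the multivalued map \<open>asch\<close>: all triples \<open>(x, p, q)\<close> such that \<open>(p, q)\<close> is the
  value at \<open>x\<close> of a simultaneous continuation of \<open>(u, v)\<close> along a path in \<open>\<complex> - {0, 1}\<close> that starts
  in the slit disc. The slit disc is simply connected, so the choice of the starting point
  in it is immaterial.\<close>

definition asch :: "real \<Rightarrow> real \<Rightarrow> real \<Rightarrow> (complex \<times> complex \<times> complex) set" where
  "asch a b c = {(x, p, q). \<exists>\<gamma> f g.
     path \<gamma> \<and> path_image \<gamma> \<subseteq> - {0, 1} \<and> pathstart \<gamma> \<in> slit_disc \<and> pathfinish \<gamma> = x \<and>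
     continuation_along \<gamma> f \<and> (\<forall>\<^sub>F z in nhds (pathstart \<gamma>). f 0 z = hyp_u a b c z) \<and>
     continuation_along \<gamma> g \<and> (\<forall>\<^sub>F z in nhds (pathstart \<gamma>). g 0 z = hyp_v a b c z) \<and>
     p = f 1 x \<and> q = g 1 x}"

definition asch_image_curve :: "real \<Rightarrow> real \<Rightarrow> real \<Rightarrow> (complex \<times> complex) set" where
  "asch_image_curve a b c = closure {(p, q). \<exists>x. (x, p, q) \<in> asch a b c}"


section \<open>The invariant polynomials\<close>

definition homogeneous_poly2 :: "nat \<Rightarrow> (complex \<Rightarrow> complex \<Rightarrow> complex) \<Rightarrow> bool" where
  "homogeneous_poly2 d P \<longleftrightarrow> (\<exists>h. \<forall>u v. P u v = (\<Sum>j\<le>d. h j * u ^ (d - j) * v ^ j))"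

text \<open>The quantifier over \<open>a b c\<close> ranges over exactly one triple, which is determined by the three
  exponent differences. Both \<open>v\<close> and \<open>x powr (1 / k\<^sub>0)\<close> use the principal logarithm, and
  \<open>(1 - x) powr (1 / k\<^sub>1)\<close> is \<open>1\<close> at \<open>x = 0\<close>. Since \<open>v / u\<close> is not constant, these conditions
  determine the three polynomials uniquely.\<close>

definition normalised_polys :: "polyhedral \<Rightarrow> (complex \<Rightarrow> complex \<Rightarrow> complex) \<Rightarrow>
    (complex \<Rightarrow> complex \<Rightarrow> complex) \<Rightarrow> (complex \<Rightarrow> complex \<Rightarrow> complex) \<Rightarrow> bool" where
  "normalised_polys T P0 P1 Pinf \<longleftrightarrow>
     homogeneous_poly2 (polyhedral_order T div k0 T) P0 \<and>
     homogeneous_poly2 (polyhedral_order T div k1 T) P1 \<and>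
     homogeneous_poly2 (polyhedral_order T div kinf T) Pinf \<and>
     (\<forall>a b c. 1 - c = 1 / real (k0 T) \<and> c - a - b = 1 / real (k1 T) \<and> a - b = 1 / real (kinf T) \<longrightarrow>
       (\<forall>\<^sub>F x in at 0 within - \<real>\<^sub>\<le>\<^sub>0.
          P0 (hyp_u a b c x) (hyp_v a b c x) = x powr (1 / of_nat (k0 T)) \<and>
          P1 (hyp_u a b c x) (hyp_v a b c x) = (1 - x) powr (1 / of_nat (k1 T)) \<and>
          Pinf (hyp_u a b c x) (hyp_v a b c x) = 1))"

fun polyhedral_polys :: "polyhedral \<Rightarrow> (complex \<Rightarrow> complex \<Rightarrow> complex) \<Rightarrow>
    (complex \<Rightarrow> complex \<Rightarrow> complex) \<Rightarrow> (complex \<Rightarrow> complex \<Rightarrow> complex) \<Rightarrow> bool" where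
  "polyhedral_polys (D1 n) P0 P1 Pinf \<longleftrightarrow>
    P0 = (\<lambda>u v. \<i> * (\<Sum>k=0..n div 2. of_nat (n choose (2*k+1)) * u^(n - 2*k - 1) * (v / (\<i> * of_nat n))^(2*k+1))) \<and>
    P1 = (\<lambda>u v. (\<Sum>k=0..n div 2. of_nat (n choose (2*k)) * u^(n - 2*k) * (v / (\<i> * of_nat n))^(2*k))) \<and>
    Pinf = (\<lambda>u v. u^2 + 1 / (of_nat n)^2 * v^2)"
| "polyhedral_polys (D2 n) P0 P1 Pinf \<longleftrightarrow>
    P0 = (\<lambda>u v. (\<Sum>k=0..n div 2. of_nat (n choose (2*k+1)) * u^(n - 2*k - 1) * (v / of_nat n)^(2*k+1))) \<and>
    P1 = (\<lambda>u v. u^2 - 1 / (of_nat n)^2 * v^2) \<and>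
    Pinf = (\<lambda>u v. (\<Sum>k=0..n div 2. of_nat (n choose (2*k)) * u^(n - 2*k) * (v / of_nat n)^(2*k)))"
| "polyhedral_polys (D3 n) P0 P1 Pinf \<longleftrightarrow>
    P0 = (\<lambda>u v. u * v) \<and>
    P1 = (\<lambda>u v. u^n - 1/4 * v^n) \<and>
    Pinf = (\<lambda>u v. u^n + 1/4 * v^n)"
| "polyhedral_polys T1 P0 P1 Pinf \<longleftrightarrow>
    P0 = (\<lambda>u v. u^5 * v + 1/432 * u * v^5) \<and>
    P1 = (\<lambda>u v. u^4 - 1/6 * u^2 * v^2 - 1/432 * v^4) \<and>
    Pinf = (\<lambda>u v. u^4 + 1/6 * u^2 * v^2 - 1/432 * v^4)"
| "polyhedral_polys T2 P0 P1 Pinf \<longleftrightarrow>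
    P0 = (\<lambda>u v. u^3 * v - 1/64 * v^4) \<and>
    P1 = (\<lambda>u v. u^6 - 5/16 * u^3 * v^3 - 1/512 * v^6) \<and>
    Pinf = (\<lambda>u v. u^4 + 1/8 * u * v^3)"
| "polyhedral_polys T3 P0 P1 Pinf \<longleftrightarrow>
    P0 = (\<lambda>u v. u^3 * v + 1/64 * v^4) \<and>
    P1 = (\<lambda>u v. u^4 - 1/8 * u * v^3) \<and>
    Pinf = (\<lambda>u v. u^6 + 5/16 * u^3 * v^3 - 1/512 * v^6)"
| "polyhedral_polys O1 P0 P1 Pinf \<longleftrightarrow>
    P0 = (\<lambda>u v. u^11 * v - 11/432 * u^9 * v^3 + 11/3456 * u^7 * v^5 + 11/165888 * u^5 * v^7 - 11/47775744
       * u^3 * v^9 + 1/254803968 * u * v^11) \<and>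
    P1 = (\<lambda>u v. u^8 - 7/36 * u^6 * v^2 - 7/3456 * u^4 * v^4 - 7/82944 * u^2 * v^6 + 1/5308416 * v^8) \<and>
    Pinf = (\<lambda>u v. u^6 + 5/48 * u^4 * v^2 - 5/2304 * u^2 * v^4 - 1/110592 * v^6)"
| "polyhedral_polys O2 P0 P1 Pinf \<longleftrightarrow>
    P0 = (\<lambda>u v. u^11 * v + 11/432 * u^9 * v^3 + 11/3456 * u^7 * v^5 - 11/165888 * u^5 * v^7 - 11/47775744
       * u^3 * v^9 - 1/254803968 * u * v^11) \<and>
    P1 = (\<lambda>u v. u^6 - 5/48 * u^4 * v^2 - 5/2304 * u^2 * v^4 + 1/110592 * v^6) \<and>
    Pinf = (\<lambda>u v. u^8 + 7/36 * u^6 * v^2 - 7/3456 * u^4 * v^4 + 7/82944 * u^2 * v^6 + 1/5308416 * v^8)"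
| "polyhedral_polys O3 P0 P1 Pinf \<longleftrightarrow>
    P0 = (\<lambda>u v. u^7 * v - 7/256 * u^4 * v^4 - 1/8192 * u * v^7) \<and>
    P1 = (\<lambda>u v. u^12 - 11/32 * u^9 * v^3 - 11/262144 * u^3 * v^9 - 1/67108864 * v^12) \<and>
    Pinf = (\<lambda>u v. u^6 + 5/64 * u^3 * v^3 - 1/8192 * v^6)"
| "polyhedral_polys O4 P0 P1 Pinf \<longleftrightarrow>
    P0 = (\<lambda>u v. u^7 * v + 7/256 * u^4 * v^4 - 1/8192 * u * v^7) \<and>
    P1 = (\<lambda>u v. u^6 - 5/64 * u^3 * v^3 - 1/8192 * v^6) \<and>
    Pinf = (\<lambda>u v. u^12 + 11/32 * u^9 * v^3 + 11/262144 * u^3 * v^9 - 1/67108864 * v^12)"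
| "polyhedral_polys O5 P0 P1 Pinf \<longleftrightarrow>
    P0 = (\<lambda>u v. u^5 * v - 1/108 * u * v^5) \<and>
    P1 = (\<lambda>u v. u^12 - 11/36 * u^8 * v^4 - 11/3888 * u^4 * v^8 + 1/1259712 * v^12) \<and>
    Pinf = (\<lambda>u v. u^8 + 7/54 * u^4 * v^4 + 1/11664 * v^8)"
| "polyhedral_polys O6 P0 P1 Pinf \<longleftrightarrow>
    P0 = (\<lambda>u v. u^5 * v + 1/108 * u * v^5) \<and>
    P1 = (\<lambda>u v. u^8 - 7/54 * u^4 * v^4 + 1/11664 * v^8) \<and>
    Pinf = (\<lambda>u v. u^12 + 11/36 * u^8 * v^4 - 11/3888 * u^4 * v^8 - 1/1259712 * v^12)"
| "polyhedral_polys I1 P0 P1 Pinf \<longleftrightarrow>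
    P0 = (\<lambda>u v. u^29 * v - 29/675 * u^27 * v^3 + 1769/450000 * u^25 * v^5 + 29/337500 * u^23 * v^7 +
       667/540000000 * u^21 * v^9 - 667/72900000000 * u^19 * v^11 + 12673/29160000000000 * u^17 *
       v^13 - 12673/524880000000000000 * u^13 * v^17 + 667/23619600000000000000 * u^11 * v^19 -
       667/3149280000000000000000 * u^9 * v^21 - 29/35429400000000000000000 * u^7 * v^23 -
       1769/850305600000000000000000000 * u^5 * v^25 + 29/22958251200000000000000000000 * u^3 *
       v^27 - 1/612220032000000000000000000000 * u * v^29) \<and>
    P1 = (\<lambda>u v. u^20 - 19/90 * u^18 * v^2 - 19/18000 * u^16 * v^4 - 19/135000 * u^14 * v^6 - 247/162000000
       * u^12 * v^8 + 247/14580000000 * u^10 * v^10 - 247/2916000000000 * u^8 * v^12 -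
       19/43740000000000 * u^6 * v^14 - 19/104976000000000000 * u^4 * v^16 -
       19/9447840000000000000 * u^2 * v^18 + 1/1889568000000000000000 * v^20) \<and>
    Pinf = (\<lambda>u v. u^12 + 11/150 * u^10 * v^2 - 11/6000 * u^8 * v^4 - 11/1350000 * u^6 * v^6 - 11/108000000 *
       u^4 * v^8 + 11/48600000000 * u^2 * v^10 + 1/5832000000000 * v^12)"
| "polyhedral_polys I2 P0 P1 Pinf \<longleftrightarrow> normalised_polys I2 P0 P1 Pinf"
| "polyhedral_polys I3 P0 P1 Pinf \<longleftrightarrow> normalised_polys I3 P0 P1 Pinf"
| "polyhedral_polys I4 P0 P1 Pinf \<longleftrightarrow> normalised_polys I4 P0 P1 Pinf"
| "polyhedral_polys I5 P0 P1 Pinf \<longleftrightarrow> normalised_polys I5 P0 P1 Pinf"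
| "polyhedral_polys I6 P0 P1 Pinf \<longleftrightarrow>
    P0 = (\<lambda>u v. u^11 * v + 11/1728 * u^6 * v^6 - 1/2985984 * u * v^11) \<and>
    P1 = (\<lambda>u v. u^20 - 19/144 * u^15 * v^5 + 247/1492992 * u^10 * v^10 + 19/429981696 * u^5 * v^15 +
       1/8916100448256 * v^20) \<and>
    Pinf = (\<lambda>u v. u^30 + 29/96 * u^25 * v^5 - 3335/995328 * u^20 * v^10 - 3335/2972033482752 * u^10 * v^20 -
       29/855945643032576 * u^5 * v^25 + 1/26623333280885243904 * v^30)"


section \<open>Triples with a reducible equation\<close>

text \<open>The equation \<open>Q\<^sub>j ^ A - Q\<^sub>\<infinity> ^ B = 0\<close> with \<open>A = N / k\<^sub>\<infinity>\<close>, \<open>B = N / k\<^sub>j - 1\<close> (\<open>j = 1\<close> and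
  \<open>j = 0\<close> for the two sign patterns with \<open>\<mu>\<^sub>\<infinity> < 0\<close>) factors over \<open>\<complex>\<close> when \<open>g = gcd A B > 1\<close>: it is
  the union of the curves \<open>Q\<^sub>j ^ (A / g) = \<zeta> * Q\<^sub>\<infinity> ^ (B / g)\<close> with \<open>\<zeta> ^ g = 1\<close>, whereas the image
  of the connected cover is only the one with \<open>\<zeta> = 1\<close>. This happens exactly for the
  following triples, and for the same ones with \<open>j = 0\<close> and \<open>j = 1\<close>.\<close>

fun reducible_equation :: "polyhedral \<Rightarrow> bool" where
  "reducible_equation (D1 n) \<longleftrightarrow> odd n"
| "reducible_equation T3 \<longleftrightarrow> True"
| "reducible_equation _ \<longleftrightarrow> False"

lemma reducible_equation_iff:
  assumes "valid_polyhedral T"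
  shows "reducible_equation T \<longleftrightarrow>
           \<not> coprime (polyhedral_order T div kinf T) (polyhedral_order T div k1 T - 1)"
    and "reducible_equation T \<longleftrightarrow>
           \<not> coprime (polyhedral_order T div kinf T) (polyhedral_order T div k0 T - 1)"
proof -
  have *: "gcd n (n - Suc 0) = Suc 0" if "n \<ge> 2" for n :: nat
    using coprime_diff_one_right_nat[of n] that by (simp add: coprime_iff_gcd_eq_1)
  have **: "gcd 2 (n - Suc 0) = Suc 0 \<longleftrightarrow> even n" if "n \<ge> 2" for n :: nat
    using coprime_left_2_iff_odd[of "n - Suc 0"] that by (simp add: coprime_iff_gcd_eq_1)
  have num: "gcd 4 3 = (1::nat)" "gcd 4 5 = (1::nat)" "gcd 6 3 = (3::nat)"
    "gcd 6 7 = (1::nat)" "gcd 6 11 = (1::nat)" "gcd 8 5 = (1::nat)" "gcd 8 11 = (1::nat)"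
    "gcd 12 5 = (1::nat)" "gcd 12 7 = (1::nat)" "gcd 12 19 = (1::nat)" "gcd 12 29 = (1::nat)"
    "gcd 20 11 = (1::nat)" "gcd 20 29 = (1::nat)" "gcd 30 11 = (1::nat)" "gcd 30 19 = (1::nat)"
    by (simp_all add: gcd_non_0_nat)
  show "reducible_equation T \<longleftrightarrow>
           \<not> coprime (polyhedral_order T div kinf T) (polyhedral_order T div k1 T - 1)"
    using assms by (cases T) (simp_all add: * ** num coprime_iff_gcd_eq_1)
  show "reducible_equation T \<longleftrightarrow>
           \<not> coprime (polyhedral_order T div kinf T) (polyhedral_order T div k0 T - 1)"
    using assms by (cases T) (simp_all add: * ** num coprime_iff_gcd_eq_1)
qed

end

theory Submission
  imports Defs
begin

text \<open>By Euler's transformation and the exchange of \<open>u\<close> and \<open>v\<close>, which multiply \<open>(u, v)\<close> by powers of \<open>x\<close> and \<open>1 - x\<close>,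
  all sign patterns reduce to the first one. There \<open>P\<^sub>0 = x powr (1/k\<^sub>0)\<close>, \<open>P\<^sub>1 = (1 - x) powr (1/k\<^sub>1)\<close> and \<open>P\<^sub>\<infinity> = 1\<close> hold
  near the origin. For the explicit forms these identities hold because the Jacobian of \<open>P\<^sub>\<infinity>\<close> and \<open>P\<^sub>0\<close> is a multiple
  of \<open>P\<^sub>1 ^ (k\<^sub>1 - 1)\<close> and the Hessian of \<open>P\<^sub>\<infinity>\<close> a multiple of \<open>P\<^sub>0 ^ (k\<^sub>0 - 2) * P\<^sub>1 ^ (k\<^sub>1 - 2)\<close>: the coordinates
  \<open>u\<close>, \<open>v\<close> of the curve \<open>P\<^sub>\<infinity> = 1\<close>, as functions of \<open>x = P\<^sub>0 ^ k\<^sub>0\<close>, then satisfy the hypergeometric equation.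
  Conversely the local identities imply the syzygy, Jacobian and Hessian relations, and these imply that the forms
  have no common zero. Hence \<open>P\<^sub>\<infinity>\<close> has simple zeros, the curve \<open>P\<^sub>\<infinity> = 1\<close> without the zeros of \<open>P\<^sub>0 P\<^sub>1\<close> is connected,
  and \<open>x = P\<^sub>0 ^ k\<^sub>0\<close> is a local isomorphism on it, so that every path in it yields a continuation of \<open>(u, v)\<close>.\<close>

section \<open>The hypergeometric equation\<close>

text \<open>The forms of \<open>I2\<close> to \<open>I5\<close> are given only by their local
  identities, so every general fact about the forms has to come from the differential equation and
  not from coefficients. The substitution x = s^k makes both solutions holomorphic on the unit disc,
  with Wronskian (1 - s^k)^(1/l - 1). In the chart z = u / v the forms take the values V^(-m), s
  V^(-m0) and R V^(-m1) along the curve; differentiating these, the Wronskian becomes the Jacobian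
  relations and the equation for V becomes the Hessian relation. Connectedness of the curve needs
  only one simple zero of the form at infinity: the curve is an m-fold cyclic covering of the
  z-plane minus finitely many points, and a loop around that zero already permutes the m sheets
  cyclically. In the twisted sign patterns division by a form M of degree d turns the value of M
  into M^(1-d) and the value 1 of the form at infinity into M^(-m). Both are powers of one function,
  so the curve is cut out by exponents divided by gcd(m, d - 1), which explains the triples with a
  reducible equation.\<close>

definition hyp_fps :: "real \<Rightarrow> real \<Rightarrow> real \<Rightarrow> complex fps" where
  "hyp_fps a b c = fps_hypergeo [of_real a, of_real b] [of_real c] 1"

text \<open>Exactly the lower parameters for which no denominator of the series vanishes.\<close>

definition regular_param :: "real \<Rightarrow> bool" where
  "regular_param c \<longleftrightarrow> (\<forall>n. c + real n \<noteq> 0)"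

lemma hyp_fps_Suc:
  assumes "regular_param c"
  shows "of_nat (Suc n) * of_real (c + real n) * hyp_fps a b c $ Suc n =
         of_real ((a + real n) * (b + real n)) * hyp_fps a b c $ n"
proof -
  have "complex_of_real c + of_nat n \<noteq> 0"
    using assms unfolding regular_param_def
    by (metis of_real_add of_real_eq_0_iff of_real_of_nat_eq)
  moreover have "C * D * ((1 * A * B) / (C * D) * F) = A * B * F" if "C \<noteq> 0" "D \<noteq> 0" for A B C D F :: complex
    using that by simp
  moreover have "complex_of_nat (Suc n) \<noteq> 0" by (rule of_nat_neq_0)
  ultimately show ?thesis
    unfolding hyp_fps_def fps_hypergeo_rec foldl.simps of_real_mult of_real_add of_real_of_nat_eq by blast
qed

lemma hyp_fps_0 [simp]: "hyp_fps a b c $ 0 = 1"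
  by (simp add: hyp_fps_def)

text \<open>Coefficient n of the equation involves only \<open>W $ n\<close> and
  \<open>W $ Suc n\<close>, and n (n - 1) + (a + b + 1) n + a b = (a + n) (b + n).\<close>

lemma fps_hypergeometric_recursion:
  fixes W :: "complex fps"
  assumes "fps_X * (1 - fps_X) * fps_deriv (fps_deriv W) +
           (fps_const c - fps_const (a + b + 1) * fps_X) * fps_deriv W - fps_const (a * b) * W = 0"
  shows "of_nat (Suc n) * (c + of_nat n) * W $ Suc n = (a + of_nat n) * (b + of_nat n) * W $ n"
proof -
  have "fps_X * fps_deriv (fps_deriv W) - fps_X * (fps_X * fps_deriv (fps_deriv W)) +
      fps_const c * fps_deriv W - fps_X * (fps_const (a + b + 1) * fps_deriv W) -
      fps_const (a * b) * W = 0"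
    using assms by (simp add: algebra_simps)
  hence "(fps_X * fps_deriv (fps_deriv W) - fps_X * (fps_X * fps_deriv (fps_deriv W)) +
      fps_const c * fps_deriv W - fps_X * (fps_const (a + b + 1) * fps_deriv W) -
      fps_const (a * b) * W) $ n = 0"
    by simp
  thus ?thesis
    by (cases n; cases "n - 1") (auto simp: algebra_simps)
qed

lemma fps_hypergeometric_unique:
  fixes W :: "complex fps"
  assumes "regular_param c"
    and "fps_X * (1 - fps_X) * fps_deriv (fps_deriv W) +
           (fps_const (of_real c) - fps_const (of_real (a + b + 1)) * fps_X) * fps_deriv W -
           fps_const (of_real (a * b)) * W = 0"
  shows "W $ n = W $ 0 * hyp_fps a b c $ n"
proof (induction n)
  case (Suc n)
  have rec: "of_nat (Suc n) * (of_real c + of_nat n) * W $ Suc n =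
      (of_real a + of_nat n) * (of_real b + of_nat n) * W $ n"
    by (rule fps_hypergeometric_recursion) (use assms(2) in simp)
  have nz: "complex_of_real c + of_nat n \<noteq> 0"
    using assms(1) unfolding regular_param_def
    by (metis of_real_add of_real_eq_0_iff of_real_of_nat_eq)
  have "of_nat (Suc n) * (of_real c + of_nat n) * W $ Suc n =
      of_nat (Suc n) * (of_real c + of_nat n) * (W $ 0 * hyp_fps a b c $ Suc n)"
  proof -
    have "of_nat (Suc n) * (of_real c + of_nat n) * hyp_fps a b c $ Suc n =
        (of_real a + of_nat n) * (of_real b + of_nat n) * hyp_fps a b c $ n"
      using hyp_fps_Suc[OF assms(1), of n a b] by simp
    thus ?thesis unfolding rec Suc.IH by (metis mult.assoc mult.left_commute)
  qed
  moreover have "of_nat (Suc n) * (of_real c + of_nat n) \<noteq> (0::complex)"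
    using nz by (simp del: of_nat_Suc)
  ultimately show ?case by (metis mult_left_cancel)
qed simp

lemma hyp_fps_ode:
  assumes "regular_param c"
  shows "fps_X * (1 - fps_X) * fps_deriv (fps_deriv (hyp_fps a b c)) +
           (fps_const (of_real c) - fps_const (of_real (a + b + 1)) * fps_X) * fps_deriv (hyp_fps a b c) -
           fps_const (of_real (a * b)) * hyp_fps a b c = 0"
proof (rule fps_ext)
  fix n
  define W where "W = hyp_fps a b c"
  have rec: "of_nat (Suc n) * of_real (c + real n) * W $ Suc n =
         of_real ((a + real n) * (b + real n)) * W $ n" for n
    unfolding W_def by (rule hyp_fps_Suc[OF assms])
  have "(fps_X * fps_deriv (fps_deriv W) - fps_X * (fps_X * fps_deriv (fps_deriv W)) +
      fps_const (of_real c) * fps_deriv W - fps_X * (fps_const (of_real (a + b + 1)) * fps_deriv W) -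
      fps_const (of_real (a * b)) * W) $ n = 0"
    using rec[of n] by (cases n; cases "n - 1") (auto simp: algebra_simps)
  thus "(fps_X * (1 - fps_X) * fps_deriv (fps_deriv W) +
           (fps_const (of_real c) - fps_const (of_real (a + b + 1)) * fps_X) * fps_deriv W -
           fps_const (of_real (a * b)) * W) $ n = 0 $ n"
    by (simp add: algebra_simps)
qed

text \<open>If one coefficient vanishes, the recursion makes the series a polynomial; otherwise the
  ratio of consecutive coefficients tends to 1.\<close>

lemma hyp_fps_conv_radius:
  assumes "regular_param c"
  shows "fps_conv_radius (hyp_fps a b c) \<ge> 1"
proof (cases "\<exists>n. hyp_fps a b c $ n = 0")
  case True
  then obtain n where n: "hyp_fps a b c $ n = 0" by blast
  have z: "hyp_fps a b c $ k = 0" if "k \<ge> n" for k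
    using that
  proof (induction k rule: dec_induct)
    case (step k)
    have "complex_of_real (c + real k) \<noteq> 0"
      using assms unfolding regular_param_def by (metis of_real_eq_0_iff)
    thus ?case using hyp_fps_Suc[OF assms, of k a b] step.IH by (simp del: of_nat_Suc of_real_add of_real_mult)
  qed (use n in simp)
  have "conv_radius (\<lambda>k. hyp_fps a b c $ k) = conv_radius (\<lambda>k. 0 :: complex)"
    by (rule conv_radius_cong') (use z eventually_at_top_linorder in blast)
  thus ?thesis unfolding fps_conv_radius_def by simp
next
  case False
  hence nz: "hyp_fps a b c $ n \<noteq> 0" for n by blast
  have cn: "complex_of_real (c + real n) \<noteq> 0" for n
    using assms unfolding regular_param_def by (metis of_real_eq_0_iff)
  have rat: "hyp_fps a b c $ Suc n / hyp_fps a b c $ n =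
      of_real ((a + real n) * (b + real n) / (real (Suc n) * (c + real n)))" for n
    using hyp_fps_Suc[OF assms, of n a b] nz[of n] cn[of n]
    by (simp add: divide_simps del: of_nat_Suc of_real_add) (simp add: mult_ac)
  have "norm (hyp_fps a b c $ n) / norm (hyp_fps a b c $ Suc n) =
     \<bar>(real (Suc n) * (c + real n)) / ((a + real n) * (b + real n))\<bar>" for n
  proof -
    have "norm (hyp_fps a b c $ Suc n / hyp_fps a b c $ n) =
        \<bar>(a + real n) * (b + real n) / (real (Suc n) * (c + real n))\<bar>"
      unfolding rat by (simp only: norm_of_real)
    thus ?thesis
      unfolding norm_divide abs_divide by (metis inverse_divide)
  qed
  moreover have "(\<lambda>n. \<bar>(real (Suc n) * (c + real n)) / ((a + real n) * (b + real n))\<bar>) \<longlonglongrightarrow> \<bar>1\<bar>"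
    by (rule tendsto_rabs) (real_asymp)
  ultimately have "conv_radius (\<lambda>k. hyp_fps a b c $ k) = 1"
    by (intro conv_radius_ratio_limit_nonzero[of _ 1]) (use nz in simp_all)
  thus ?thesis unfolding fps_conv_radius_def by simp
qed

section \<open>Holomorphy, the equation on the disc and uniqueness of the holomorphic
  solution\<close>

lemma hyp_F_has_fps_expansion:
  assumes "regular_param c"
  shows "hyp_F a b c has_fps_expansion hyp_fps a b c"
proof -
  have "hyp_F a b c = eval_fps (hyp_fps a b c)" by (rule ext) (simp add: hyp_F_def hyp_fps_def)
  moreover have "fps_conv_radius (hyp_fps a b c) > 0"
    using hyp_fps_conv_radius[OF assms, of a b] by (rule less_le_trans[rotated]) simp
  ultimately show ?thesis by (simp add: eval_fps_has_fps_expansion)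
qed

lemma hyp_F_holomorphic [holomorphic_intros]:
  assumes "regular_param c"
  shows "hyp_F a b c holomorphic_on ball 0 1"
proof -
  have "hyp_F a b c = eval_fps (hyp_fps a b c)" by (rule ext) (simp add: hyp_F_def hyp_fps_def)
  moreover have "eval_fps (hyp_fps a b c) holomorphic_on ball 0 1"
  proof (rule holomorphic_on_eval_fps)
    show "ball (0::complex) 1 \<subseteq> eball 0 (fps_conv_radius (hyp_fps a b c))"
    proof
      fix x :: complex assume "x \<in> ball 0 1"
      hence "ereal (norm x) < 1" by simp
      also note hyp_fps_conv_radius[OF assms, of a b]
      finally show "x \<in> eball 0 (fps_conv_radius (hyp_fps a b c))" by (simp add: eball_def dist_norm)
    qed
  qed
  ultimately show ?thesis by simp
qed

lemma hyp_F_0: "hyp_F a b c 0 = 1"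
  by (simp add: hyp_F_def eval_fps_at_0)

lemma hyp_F_commute: "hyp_F a b c = hyp_F b a c"
  by (rule ext) (simp add: hyp_F_series mult.commute)

text \<open>The identity theorem in the form used throughout; the domain may be any connected open
  set.\<close>

lemma holomorphic_zero_on_ball:
  fixes f :: "complex \<Rightarrow> complex"
  assumes "f holomorphic_on S" "open S" "connected S" "z0 \<in> S" "\<forall>\<^sub>F z in nhds z0. f z = 0" "z \<in> S"
  shows "f z = 0"
proof -
  obtain A where A: "open A" "z0 \<in> A" "\<forall>z\<in>A. f z = 0"
    using assms(5) unfolding eventually_nhds by blast
  show ?thesis
    by (rule analytic_continuation_open[of "S \<inter> A" S f "\<lambda>_. 0"])
       (use A assms in auto)
qed

text \<open>The formal equation holds near 0 and spreads over the disc by the identity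
  theorem.\<close>

lemma hyp_F_ode:
  assumes c: "regular_param c" and x: "x \<in> ball 0 1"
  shows "x * (1 - x) * deriv (deriv (hyp_F a b c)) x +
    (of_real c - of_real (a + b + 1) * x) * deriv (hyp_F a b c) x - of_real (a * b) * hyp_F a b c x = 0"
proof (rule holomorphic_zero_on_ball[OF _ _ _ _ _ x])
  show "(\<lambda>x. x * (1 - x) * deriv (deriv (hyp_F a b c)) x +
    (of_real c - of_real (a + b + 1) * x) * deriv (hyp_F a b c) x - of_real (a * b) * hyp_F a b c x)
     holomorphic_on ball 0 1"
    by (intro holomorphic_intros c) auto
  have "(\<lambda>x. x * (1 - x) * deriv (deriv (hyp_F a b c)) x +
    (of_real c - of_real (a + b + 1) * x) * deriv (hyp_F a b c) x - of_real (a * b) * hyp_F a b c x)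
    has_fps_expansion fps_X * (1 - fps_X) * fps_deriv (fps_deriv (hyp_fps a b c)) +
           (fps_const (of_real c) - fps_const (of_real (a + b + 1)) * fps_X) * fps_deriv (hyp_fps a b c) -
           fps_const (of_real (a * b)) * hyp_fps a b c"
    by (intro fps_expansion_intros hyp_F_has_fps_expansion c)
  hence "(\<lambda>x. x * (1 - x) * deriv (deriv (hyp_F a b c)) x +
    (of_real c - of_real (a + b + 1) * x) * deriv (hyp_F a b c) x - of_real (a * b) * hyp_F a b c x)
    has_fps_expansion 0"
    unfolding hyp_fps_ode[OF c] .
  thus "\<forall>\<^sub>F x in nhds 0. x * (1 - x) * deriv (deriv (hyp_F a b c)) x +
    (of_real c - of_real (a + b + 1) * x) * deriv (hyp_F a b c) x - of_real (a * b) * hyp_F a b c x = 0"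
    unfolding has_fps_expansion_def by (auto elim!: eventually_mono)
qed auto

text \<open>At the singular point 0 holomorphy replaces the second initial condition: the recursion
  determines every Taylor coefficient from the value at 0.\<close>

lemma hyp_F_unique:
  assumes c: "regular_param c" and w: "w holomorphic_on ball 0 1" and w0: "w 0 = 1"
    and ode: "\<And>x. x \<in> ball 0 1 \<Longrightarrow> x * (1 - x) * deriv (deriv w) x +
    (of_real c - of_real (a + b + 1) * x) * deriv w x - of_real (a * b) * w x = 0"
    and x: "x \<in> ball 0 1"
  shows "w x = hyp_F a b c x"
proof -
  define W where "W = fps_expansion w 0"
  have W: "w has_fps_expansion W"
    unfolding W_def using w by (intro has_fps_expansion_fps_expansion[of "ball 0 1"]) auto
  let ?L = "\<lambda>x. x * (1 - x) * deriv (deriv w) x +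
    (of_real c - of_real (a + b + 1) * x) * deriv w x - of_real (a * b) * w x"
  have "?L has_fps_expansion fps_X * (1 - fps_X) * fps_deriv (fps_deriv W) +
           (fps_const (of_real c) - fps_const (of_real (a + b + 1)) * fps_X) * fps_deriv W -
           fps_const (of_real (a * b)) * W"
    by (intro fps_expansion_intros W)
  moreover have "?L has_fps_expansion 0"
  proof -
    have "\<forall>\<^sub>F x in nhds 0. x \<in> ball 0 (1::real)" by (rule eventually_nhds_in_open) auto
    hence "\<forall>\<^sub>F x in nhds 0. ?L x = 0" by eventually_elim (use ode in auto)
    thus ?thesis by (simp add: has_fps_expansion_0_iff)
  qed
  ultimately have "fps_X * (1 - fps_X) * fps_deriv (fps_deriv W) +
           (fps_const (of_real c) - fps_const (of_real (a + b + 1)) * fps_X) * fps_deriv W -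
           fps_const (of_real (a * b)) * W = 0"
    using fps_expansion_unique_complex by blast
  moreover have "W $ 0 = 1" using W w0 by (metis has_fps_expansion_imp_0_eq_fps_nth_0)
  ultimately have "W $ n = hyp_fps a b c $ n" for n
    using fps_hypergeometric_unique[OF c, of W a b n] by (metis mult_1)
  hence "W = hyp_fps a b c" by (rule fps_ext)
  hence "(\<lambda>x. w x - hyp_F a b c x) has_fps_expansion 0"
    using has_fps_expansion_diff[OF W hyp_F_has_fps_expansion[OF c, of a b]] by simp
  hence ev: "\<forall>\<^sub>F x in nhds 0. w x - hyp_F a b c x = 0"
    by (simp add: has_fps_expansion_0_iff)
  have "w x - hyp_F a b c x = 0"
    by (rule holomorphic_zero_on_ball[OF _ _ _ _ ev x]) (intro holomorphic_intros w c, auto)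
  thus ?thesis by simp
qed

text \<open>The right-hand side is holomorphic on the disc with value 1 at 0, and a computation
  shows that it solves the equation of the left-hand side.\<close>

lemma hyp_F_euler:
  assumes c: "regular_param c" and x: "x \<in> ball 0 1"
  shows "hyp_F a b c x = (1 - x) powr of_real (c - a - b) * hyp_F (c - a) (c - b) c x"
proof -
  define e :: complex where "e = of_real (c - a - b)"
  define G where "G = hyp_F (c - a) (c - b) c"
  define w where "w = (\<lambda>x. (1 - x) powr e * G x)"
  have G: "G holomorphic_on ball 0 1" unfolding G_def by (intro holomorphic_intros c)
  have nr: "1 - x \<notin> \<real>\<^sub>\<le>\<^sub>0" if "x \<in> ball 0 1" for x :: complex
  proof
    assume "1 - x \<in> \<real>\<^sub>\<le>\<^sub>0"
    hence "Re (1 - x) \<le> 0" by (simp add: complex_nonpos_Reals_iff)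
    moreover have "\<bar>Re x\<bar> \<le> norm x" by (rule abs_Re_le_cmod)
    ultimately show False using that by simp
  qed
  have nz: "1 - x \<noteq> 0" if "x \<in> ball 0 1" for x :: complex using nr[OF that] by auto
  have Gd: "(G has_field_derivative deriv G x) (at x)" if "x \<in> ball 0 1" for x
    using holomorphic_derivI[OF G _ that] by simp
  have Gdd: "(deriv G has_field_derivative deriv (deriv G) x) (at x)" if "x \<in> ball 0 1" for x
    by (rule holomorphic_derivI[of _ "ball 0 1"]) (use that G in \<open>auto intro!: holomorphic_intros\<close>)
  have hw: "w holomorphic_on ball 0 1"
    unfolding w_def by (intro holomorphic_intros G) (use nr in auto)
  \<comment> \<open>The power of 1 - x is kept as a common factor of w, w' and w'', so that it can
    be divided out of the equation at the end.\<close>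
  define w1 where "w1 = (\<lambda>x. (1 - x) powr e * (deriv G x - e / (1 - x) * G x))"
  have d1: "(w has_field_derivative w1 x) (at x)" if "x \<in> ball 0 1" for x
    unfolding w_def w1_def using nr[OF that] nz[OF that]
    by (auto intro!: derivative_eq_intros Gd that simp: powr_diff field_simps)
  have dw: "deriv w x = w1 x" if "x \<in> ball 0 1" for x using DERIV_imp_deriv[OF d1[OF that]] .
  have d2: "(w1 has_field_derivative (1 - x) powr e * (deriv (deriv G) x - 2 * e / (1 - x) * deriv G x
      + e * (e - 1) / (1 - x)^2 * G x)) (at x)" if "x \<in> ball 0 1" for x
  proof -
    define y where "y = 1 - x"
    have y: "y \<noteq> 0" using nz[OF that] by (simp add: y_def)
    show ?thesis
      unfolding w1_def using nr[OF that] nz[OF that]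
      apply (auto intro!: derivative_eq_intros Gd Gdd that simp: powr_diff)
      unfolding y_def[symmetric] using y by (simp add: field_simps power2_eq_square)
  qed
  have ddw: "deriv (deriv w) x = (1 - x) powr e * (deriv (deriv G) x - 2 * e / (1 - x) * deriv G x
      + e * (e - 1) / (1 - x)^2 * G x)" if "x \<in> ball 0 1" for x
  proof -
    have "\<forall>\<^sub>F y in nhds x. y \<in> ball 0 1" using that by (intro eventually_nhds_in_open) auto
    hence "deriv (deriv w) x = deriv w1 x"
      by (intro deriv_cong_ev refl) (auto elim!: eventually_mono simp: dw)
    thus ?thesis using DERIV_imp_deriv[OF d2[OF that]] by simp
  qed
  have "w x = hyp_F a b c x"
  proof (rule hyp_F_unique[OF c hw _ _ x])
    show "w 0 = 1" by (simp add: w_def G_def hyp_F_0)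
    fix x :: complex assume x: "x \<in> ball 0 1"
    define A where "A = complex_of_real a"
    define B where "B = complex_of_real b"
    define C where "C = complex_of_real c"
    define g0 where "g0 = G x"
    define g1 where "g1 = deriv G x"
    define g2 where "g2 = deriv (deriv G) x"
    define y where "y = 1 - x"
    have y: "y \<noteq> 0" "x = 1 - y" using nz[OF x] by (auto simp: y_def)
    have e: "e = C - A - B" by (simp add: e_def A_def B_def C_def)
    have "x * (1 - x) * g2 + (C - ((C - A) + (C - B) + 1) * x) * g1 - (C - A) * (C - B) * g0 = 0"
      using hyp_F_ode[OF c x, of "c - a" "c - b"] by (simp add: G_def A_def B_def C_def g0_def g1_def g2_def)
    \<comment> \<open>The equation of \<open>G\<close> eliminates its second derivative; what
      remains is a rational identity in y = 1 - x.\<close>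
    hence g2: "x * y * g2 = (C - A) * (C - B) * g0 - (C - ((C - A) + (C - B) + 1) * x) * g1"
      unfolding y_def by (simp add: algebra_simps)
    have main: "x * y * (g2 - 2 * e / y * g1 + e * (e - 1) / y^2 * g0) +
      (C - (A + B + 1) * x) * (g1 - e / y * g0) - A * B * g0 = 0"
    proof -
      have "x * y * (g2 - 2 * e / y * g1 + e * (e - 1) / y^2 * g0) =
         x * y * g2 - 2 * x * e * g1 + x * (e * (e - 1) / y * g0)"
        using y(1) by (simp add: field_simps power2_eq_square)
      hence "x * y * (g2 - 2 * e / y * g1 + e * (e - 1) / y^2 * g0) +
      (C - (A + B + 1) * x) * (g1 - e / y * g0) - A * B * g0 =
         (C - A) * (C - B) * g0 - (C - ((C - A) + (C - B) + 1) * x) * g1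
          - 2 * x * e * g1 + x * (e * (e - 1) / y * g0) + (C - (A + B + 1) * x) * (g1 - e / y * g0) - A * B * g0"
        using g2 by simp
      also have "\<dots> = 0"
        unfolding e y(2) using y(1) by (simp add: field_simps)
      finally show ?thesis .
    qed
    have D: "deriv (deriv w) x = (1 - x) powr e * (g2 - 2 * e / y * g1 + e * (e - 1) / y^2 * g0)"
      "deriv w x = (1 - x) powr e * (g1 - e / y * g0)" "w x = (1 - x) powr e * g0"
      unfolding ddw[OF x] dw[OF x] w1_def g0_def g1_def g2_def y_def by (simp_all add: w_def)
    have scale: "x * y * (E * X) + K * (E * Y) - Z * (E * H) = 0" if "x * y * X + K * Y - Z * H = 0"
      for E X K Y Z H :: complex
    proof -
      have "x * y * (E * X) + K * (E * Y) - Z * (E * H) = E * (x * y * X + K * Y - Z * H)"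
        by (simp add: algebra_simps)
      thus ?thesis using that by simp
    qed
    show "x * (1 - x) * deriv (deriv w) x +
        (of_real c - of_real (a + b + 1) * x) * deriv w x - of_real (a * b) * w x = 0"
      using scale[OF main, of "(1 - x) powr e"] unfolding D
      by (simp only: y_def A_def B_def C_def of_real_add of_real_mult of_real_1)
  qed
  thus ?thesis by (simp add: w_def e_def G_def)
qed

section \<open>Uniformization at the origin\<close>

lemma DERIV_power_complex:
  "((\<lambda>s::complex. s ^ n) has_field_derivative of_nat n * s ^ (n - 1)) (at s)"
  by (auto intro!: derivative_eq_intros)

locale schwarz_params =
  fixes a b c :: real and k l r :: nat
  assumes k2: "k \<ge> 2" and l2: "l \<ge> 2" and r2: "r \<ge> 2"
    and exp0: "1 - c = 1 / real k" and exp1: "c - a - b = 1 / real l" and expinf: "a - b = 1 / real r"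
begin

text \<open>Coefficients of the equation after x = s^k: it becomes (1 - s^k) Y'' -
  \<open>ecoef\<close> s^(k-1) Y' = \<open>Lcoef\<close> s^(k-2) Y, which is regular at s =
  0.\<close>

definition ecoef :: complex where "ecoef = of_real (real k * (1 - 1 / real l))"
definition Lcoef :: complex where "Lcoef = of_real ((real k)\<^sup>2 * a * b)"

text \<open>The two solutions in the variable s with x = s^k. As 1 - c = 1/k, the factor x^(1-c) of
  the second one becomes s, so both are single-valued.\<close>

definition U :: "complex \<Rightarrow> complex" where "U s = hyp_F a b c (s ^ k)"
definition V :: "complex \<Rightarrow> complex" where "V s = s * hyp_F (a - c + 1) (b - c + 1) (2 - c) (s ^ k)"

text \<open>\<open>U1\<close>, \<open>U2\<close>, \<open>V1\<close>, \<open>V2\<close> are closed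
  formulas for the first two derivatives; k \<ge> 2 gives the exponent k - 2 its proper
  meaning.\<close>

definition U1 :: "complex \<Rightarrow> complex" where
  "U1 s = of_nat k * s ^ (k - 1) * deriv (hyp_F a b c) (s ^ k)"
definition U2 :: "complex \<Rightarrow> complex" where
  "U2 s = of_nat k * s ^ (k - 2) * (of_nat (k - 1) * deriv (hyp_F a b c) (s ^ k) +
     of_nat k * s ^ k * deriv (deriv (hyp_F a b c)) (s ^ k))"
definition V1 :: "complex \<Rightarrow> complex" where
  "V1 s = hyp_F (a - c + 1) (b - c + 1) (2 - c) (s ^ k) +
     of_nat k * s ^ k * deriv (hyp_F (a - c + 1) (b - c + 1) (2 - c)) (s ^ k)"
definition V2 :: "complex \<Rightarrow> complex" where
  "V2 s = of_nat k * s ^ (k - 1) * (of_nat (k + 1) * deriv (hyp_F (a - c + 1) (b - c + 1) (2 - c)) (s ^ k) +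
     of_nat k * s ^ k * deriv (deriv (hyp_F (a - c + 1) (b - c + 1) (2 - c))) (s ^ k))"

text \<open>The branch of (1 - x)^(1/l) with value 1 at x = 0; on the disc 1 - s^k has positive real
  part, so the principal power is holomorphic.\<close>

definition R :: "complex \<Rightarrow> complex" where "R s = (1 - s ^ k) powr (1 / of_nat l)"

section \<open>The equation and the Wronskian in the variable s\<close>

lemma kpos: "k > 0" and lpos: "l > 0" and rpos: "r > 0"
  using k2 l2 r2 by auto

lemma c_eq: "c = 1 - 1 / real k" using exp0 by simp

lemma regular_c: "regular_param c"
proof -
  have "c > 0" unfolding c_eq using k2 by (simp add: field_simps)
  thus ?thesis by (auto simp: regular_param_def add_pos_nonneg intro!: less_imp_neq[symmetric])
qed

lemma regular_2c: "regular_param (2 - c)"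
proof -
  have "2 - c > 0" unfolding c_eq using k2 by (simp add: field_simps)
  thus ?thesis by (auto simp: regular_param_def add_pos_nonneg intro!: less_imp_neq[symmetric])
qed

lemma power_k_in_ball: "s \<in> ball 0 1 \<Longrightarrow> s ^ k \<in> ball (0::complex) 1"
  using kpos by (auto simp: norm_power intro: power_less_one_iff[THEN iffD2])

lemma chain_power:
  assumes "G holomorphic_on ball 0 1" "s \<in> ball 0 1"
  shows "((\<lambda>s. G (s ^ k)) has_field_derivative deriv G (s ^ k) * (of_nat k * s ^ (k - 1))) (at s)"
proof -
  have "(G has_field_derivative deriv G (s ^ k)) (at (s ^ k))"
    using holomorphic_derivI[OF assms(1) _ power_k_in_ball[OF assms(2)]] by simp
  moreover have "((\<lambda>s. s ^ k) has_field_derivative of_nat k * s ^ (k - 1)) (at s)"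
    using DERIV_power_complex[of k s] by simp
  ultimately show ?thesis by (rule DERIV_chain2)
qed

lemma hol_F: "hyp_F a b c holomorphic_on ball 0 1" "deriv (hyp_F a b c) holomorphic_on ball 0 1"
  by (intro holomorphic_intros regular_c; simp)+

lemma hol_G: "hyp_F (a - c + 1) (b - c + 1) (2 - c) holomorphic_on ball 0 1"
   "deriv (hyp_F (a - c + 1) (b - c + 1) (2 - c)) holomorphic_on ball 0 1"
  by (intro holomorphic_intros regular_2c; simp)+

lemma U_deriv:
  assumes "s \<in> ball 0 1"
  shows "(U has_field_derivative U1 s) (at s)"
  unfolding U_def[abs_def] U1_def using chain_power[OF hol_F(1) assms] by (simp add: mult_ac)

lemma U1_deriv:
  assumes "s \<in> ball 0 1"
  shows "(U1 has_field_derivative U2 s) (at s)"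
proof -
  have p: "s ^ (k - 1) = s * s ^ (k - 2)" "s ^ k = s * (s * s ^ (k - 2))"
    using k2 by (metis Suc_diff_Suc Suc_1 Suc_le_lessD power_Suc, metis Suc_1 add_2_eq_Suc le_add_diff_inverse power_Suc)
  have "((\<lambda>s. of_nat k * s ^ (k - 1)) has_field_derivative of_nat k * (of_nat (k - 1) * s ^ (k - 2))) (at s)"
    using DERIV_cmult[OF DERIV_power_complex[of "k - 1" s], of "of_nat k"] by (simp add: numeral_2_eq_2)
  from DERIV_mult[OF this chain_power[OF hol_F(2) assms]] show ?thesis
    unfolding U1_def[abs_def] U2_def
    by (rule DERIV_cong) (simp only: p ring_distribs mult_ac)
qed

lemma V_deriv:
  assumes "s \<in> ball 0 1"
  shows "(V has_field_derivative V1 s) (at s)"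
proof -
  have p: "s * s ^ (k - 1) = s ^ k" using kpos by (metis power_eq_if not_gr_zero)
  have "V1 s = 1 * hyp_F (a - c + 1) (b - c + 1) (2 - c) (s ^ k) +
     deriv (hyp_F (a - c + 1) (b - c + 1) (2 - c)) (s ^ k) * (of_nat k * s ^ (k - 1)) * s"
    unfolding V1_def p[symmetric] by (simp add: mult_ac)
  thus ?thesis using DERIV_mult[OF DERIV_ident chain_power[OF hol_G(1) assms]]
    unfolding V_def[abs_def] by simp
qed

lemma V1_deriv:
  assumes "s \<in> ball 0 1"
  shows "(V1 has_field_derivative V2 s) (at s)"
proof -
  define G where "G = hyp_F (a - c + 1) (b - c + 1) (2 - c)"
  have p: "s ^ k = s * s ^ (k - 1)" using kpos by (metis power_eq_if not_gr_zero)
  have "((\<lambda>s. of_nat k * s ^ k) has_field_derivative of_nat k * (of_nat k * s ^ (k - 1))) (at s)"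
    using DERIV_cmult[OF DERIV_power_complex[of k s], of "of_nat k"] by simp
  from DERIV_add[OF chain_power[OF hol_G(1) assms] DERIV_mult[OF this chain_power[OF hol_G(2) assms]]] show ?thesis
    unfolding V1_def[abs_def] V2_def G_def[symmetric]
    by (rule DERIV_cong) (simp add: p ring_distribs mult_ac)
qed

lemma R_arg:
  assumes "s \<in> ball (0::complex) 1" shows "1 - s ^ k \<notin> \<real>\<^sub>\<le>\<^sub>0"
proof
  assume "1 - s ^ k \<in> \<real>\<^sub>\<le>\<^sub>0"
  hence "Re (1 - s ^ k) \<le> 0" by (simp add: complex_nonpos_Reals_iff)
  moreover have "\<bar>Re (s ^ k)\<bar> \<le> norm (s ^ k)" by (rule abs_Re_le_cmod)
  moreover have "norm (s ^ k) < 1" using power_k_in_ball[OF assms] by simp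
  ultimately show False by simp
qed

lemma R_nz: "s \<in> ball 0 1 \<Longrightarrow> R s \<noteq> 0"
  using R_arg[of s] by (auto simp: R_def)

lemma R_power: assumes "s \<in> ball 0 1" shows "R s ^ l = 1 - s ^ k"
proof -
  have "1 - s ^ k \<noteq> 0" using R_arg[OF assms] by auto
  thus ?thesis unfolding R_def using lpos by (simp add: powr_power)
qed

lemma R_deriv:
  assumes "s \<in> ball 0 1"
  shows "(R has_field_derivative - (of_nat k / of_nat l * s ^ (k - 1)) / R s ^ (l - 1)) (at s)"
proof -
  have nz: "1 - s ^ k \<noteq> 0" using R_arg[OF assms] by auto
  have *: "(1 - s ^ k) powr (1 / of_nat l - 1) = 1 / R s ^ (l - 1)"
  proof -
    have "(1 - s ^ k) powr (1 / of_nat l - 1) = R s / R s ^ l"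
      using nz by (simp add: powr_diff R_power[OF assms] flip: R_def)
    also have "R s ^ l = R s * R s ^ (l - 1)" using lpos by (metis power_eq_if not_gr_zero)
    finally show ?thesis using R_nz[OF assms] by simp
  qed
  have "(R has_field_derivative (1 - s ^ k) powr (1 / of_nat l - 1) * (1 / of_nat l) * - (of_nat k * s ^ (k - 1))) (at s)"
    unfolding R_def[abs_def] using R_arg[OF assms]
    by (auto intro!: derivative_eq_intros simp: powr_diff)
  thus ?thesis unfolding * by (simp add: mult_ac)
qed

text \<open>The hypergeometric equation multiplied by k^2 s^(k-2); the relation k c = k - 1 absorbs
  the first-order term that arises from differentiating s^(k-1).\<close>

lemma U_ode:
  assumes s: "s \<in> ball 0 1"
  shows "(1 - s ^ k) * U2 s - ecoef * s ^ (k - 1) * U1 s = Lcoef * s ^ (k - 2) * U s"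
proof -
  obtain j where j: "k = Suc (Suc j)" using k2 by (metis Suc_le_D numeral_2_eq_2 Suc_le_mono)
  define x where "x = s ^ k"
  define f0 f1 f2 where "f0 = hyp_F a b c x" and "f1 = deriv (hyp_F a b c) x" and "f2 = deriv (deriv (hyp_F a b c)) x"
  define A B C K where "A = complex_of_real a" and "B = complex_of_real b" and "C = complex_of_real c"
    and "K = complex_of_nat k"
  have "x * (1 - x) * f2 + (C - (A + B + 1) * x) * f1 - A * B * f0 = 0"
    using hyp_F_ode[OF regular_c power_k_in_ball[OF s], of a b]
    by (simp add: f0_def f1_def f2_def A_def B_def C_def x_def)
  hence ode: "K\<^sup>2 * (A * B * f0) = K\<^sup>2 * (x * (1 - x) * f2 + (C - (A + B + 1) * x) * f1)" by simp
  have KC: "K * C = K - 1"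
    using kpos by (simp add: K_def C_def c_eq field_simps)
  have "real k * (1 - 1 / real l) = real k * (a + b + 1 - c)"
    using exp1 by (simp add: algebra_simps)
  hence e: "ecoef = K * (A + B + 1 - C)"
    unfolding ecoef_def by (simp only: K_def A_def B_def C_def of_real_mult of_real_add of_real_diff of_real_1 of_real_of_nat_eq)
  have k1: "of_nat (k - 1) = K * C" unfolding KC by (simp add: K_def j)
  have "(1 - s ^ k) * U2 s - ecoef * s ^ (k - 1) * U1 s =
      s ^ (k - 2) * (K * (1 - x) * (K * C * f1 + K * x * f2) - ecoef * K * x * f1)"
  proof -
    have "ecoef * s ^ (k - 1) * U1 s = (s ^ (k - 1) * s ^ (k - 1)) * (ecoef * K * f1)"
      unfolding U1_def x_def[symmetric] f1_def[symmetric] K_def[symmetric] by (simp only: mult_ac)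
    also have "s ^ (k - 1) * s ^ (k - 1) = s ^ (k - 2) * x" by (simp add: j x_def)
    finally have eq: "ecoef * s ^ (k - 1) * U1 s = s ^ (k - 2) * (ecoef * K * x * f1)"
      by (simp only: mult_ac)
    show ?thesis unfolding eq unfolding U2_def x_def[symmetric] f1_def[symmetric] f2_def[symmetric] k1 K_def[symmetric]
      by (simp add: algebra_simps)
  qed
  also have "K * (1 - x) * (K * C * f1 + K * x * f2) - ecoef * K * x * f1 = K\<^sup>2 * (A * B * f0)"
    unfolding ode e by (simp add: algebra_simps power2_eq_square)
  finally show ?thesis
    by (simp add: Lcoef_def U_def x_def f0_def A_def B_def K_def mult_ac)
qed

text \<open>The series in \<open>V\<close> has shifted parameters, but the factor s compensates for
  the shift: k^2 (a-c+1) (b-c+1) - \<open>ecoef\<close> = k^2 a b.\<close>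

lemma V_ode:
  assumes s: "s \<in> ball 0 1"
  shows "(1 - s ^ k) * V2 s - ecoef * s ^ (k - 1) * V1 s = Lcoef * s ^ (k - 2) * V s"
proof -
  obtain j where j: "k = Suc (Suc j)" using k2 by (metis Suc_le_D numeral_2_eq_2 Suc_le_mono)
  define x where "x = s ^ k"
  define G where "G = hyp_F (a - c + 1) (b - c + 1) (2 - c)"
  define f0 f1 f2 where "f0 = G x" and "f1 = deriv G x" and "f2 = deriv (deriv G) x"
  define A B C K where "A = complex_of_real a" and "B = complex_of_real b" and "C = complex_of_real c"
    and "K = complex_of_nat k"
  have K0: "K \<noteq> 0" using kpos by (simp add: K_def)
  have "x * (1 - x) * f2 + ((2 - C) - ((A - C + 1) + (B - C + 1) + 1) * x) * f1 - (A - C + 1) * (B - C + 1) * f0 = 0"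
    using hyp_F_ode[OF regular_2c power_k_in_ball[OF s], of "a - c + 1" "b - c + 1"]
    by (simp add: f0_def f1_def f2_def A_def B_def C_def x_def G_def)
  hence ode: "K\<^sup>2 * ((A - C + 1) * (B - C + 1) * f0) =
      K\<^sup>2 * (x * (1 - x) * f2 + ((2 - C) - ((A - C + 1) + (B - C + 1) + 1) * x) * f1)" by simp
  have KC: "K * C = K - 1"
    using kpos by (simp add: K_def C_def c_eq field_simps)
  have C: "C = (K - 1) / K" using KC K0 by (simp add: field_simps)
  have "real k * (1 - 1 / real l) = real k * (a + b + 1 - c)"
    using exp1 by (simp add: algebra_simps)
  hence e: "ecoef = K * (A + B + 1 - C)"
    unfolding ecoef_def by (simp only: K_def A_def B_def C_def of_real_mult of_real_add of_real_diff of_real_1 of_real_of_nat_eq)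
  have k1: "of_nat (k + 1) = K * (2 - C)" unfolding right_diff_distrib KC by (simp add: K_def j)
  have V: "V s = s * f0" by (simp add: V_def f0_def G_def x_def)
  have V1: "V1 s = f0 + K * x * f1" by (simp add: V1_def f0_def f1_def G_def x_def K_def)
  have V2: "V2 s = K * s ^ (k - 1) * (K * (2 - C) * f1 + K * x * f2)"
    unfolding V2_def k1 by (simp add: f2_def f1_def G_def x_def K_def)
  have "(1 - s ^ k) * V2 s - ecoef * s ^ (k - 1) * V1 s =
      s ^ (k - 1) * (K * (1 - x) * (K * (2 - C) * f1 + K * x * f2) - ecoef * (f0 + K * x * f1))"
    unfolding V1 V2 x_def[symmetric] by (simp add: algebra_simps)
  also have "K * (1 - x) * (K * (2 - C) * f1 + K * x * f2) - ecoef * (f0 + K * x * f1) =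
     K\<^sup>2 * ((A - C + 1) * (B - C + 1) * f0) - ecoef * f0"
    unfolding ode e by (simp add: algebra_simps power2_eq_square)
  also have "\<dots> = K\<^sup>2 * A * B * f0"
    unfolding e C using K0 by (simp add: field_simps power2_eq_square)
  also have "s ^ (k - 1) * (K\<^sup>2 * A * B * f0) = Lcoef * s ^ (k - 2) * V s"
  proof -
    have "Lcoef = K\<^sup>2 * A * B" by (simp add: Lcoef_def K_def A_def B_def)
    moreover have "s ^ (k - 1) = s ^ (k - 2) * s" by (simp add: j)
    ultimately show ?thesis by (simp only: V mult_ac)
  qed
  finally show ?thesis .
qed

lemma U_0: "U 0 = 1" and V_0: "V 0 = 0" and U1_0: "U1 0 = 0" and V1_0: "V1 0 = 1" and R_0: "R 0 = 1"
  using k2 by (auto simp: U_def V_def U1_def V1_def R_def hyp_F_0 power_0_left)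

text \<open>Abel's identity: the logarithmic derivative of the Wronskian is \<open>ecoef\<close>
  s^(k-1) / (1 - s^k), the negative of that of R^(l-1), and the product has value 1 at 0.\<close>

lemma wronskian:
  assumes s: "s \<in> ball 0 1"
  shows "(U s * V1 s - U1 s * V s) * R s ^ (l - 1) = 1"
proof -
  obtain i where l: "l = Suc (Suc i)" using l2 by (metis Suc_le_D numeral_2_eq_2 Suc_le_mono)
  define W where "W = (\<lambda>s. U s * V1 s - U1 s * V s)"
  have der: "((\<lambda>s. W s * R s ^ (l - 1)) has_field_derivative 0) (at s)" if s: "s \<in> ball 0 1" for s
  proof -
    define W' where "W' = U s * V2 s - U2 s * V s"
    define R' where "R' = - (of_nat k / of_nat l * s ^ (k - 1)) / R s ^ (l - 1)"
    have d: "((\<lambda>s. W s * R s ^ (l - 1)) has_field_derivative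
        W' * R s ^ (l - 1) + W s * (of_nat (l - 1) * R s ^ (l - 2) * R')) (at s)"
    proof -
      have "(W has_field_derivative W') (at s)"
        using DERIV_diff[OF DERIV_mult[OF U_deriv[OF s] V1_deriv[OF s]] DERIV_mult[OF U1_deriv[OF s] V_deriv[OF s]]]
        unfolding W_def W'_def by (rule DERIV_cong) (simp add: mult_ac)
      from DERIV_mult[OF this DERIV_power[OF R_deriv[OF s], of "l - 1"]] show ?thesis
        by (rule DERIV_cong) (simp add: R'_def l mult_ac)
    qed
    have RR: "R' * R s ^ (l - 1) = - (of_nat k / of_nat l * s ^ (k - 1))"
      unfolding R'_def using R_nz[OF s] by simp
    have "(1 - s ^ k) * W' = U s * ((1 - s ^ k) * V2 s) - V s * ((1 - s ^ k) * U2 s)"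
      unfolding W'_def by (simp add: algebra_simps)
    also have "\<dots> = U s * (ecoef * s ^ (k - 1) * V1 s + Lcoef * s ^ (k - 2) * V s) -
        V s * (ecoef * s ^ (k - 1) * U1 s + Lcoef * s ^ (k - 2) * U s)"
      unfolding U_ode[OF s, symmetric] V_ode[OF s, symmetric] by simp
    also have "\<dots> = ecoef * s ^ (k - 1) * W s" by (simp add: W_def algebra_simps)
    finally have W': "R s ^ l * W' = ecoef * s ^ (k - 1) * W s" unfolding R_power[OF s] .
    have e: "ecoef = of_nat (l - 1) * (of_nat k / of_nat l)"
      unfolding ecoef_def by (simp add: l field_simps)
    have "R s ^ l * (W' * R s ^ (l - 1) + W s * (of_nat (l - 1) * R s ^ (l - 2) * R')) =
       R s ^ (l - 1) * (R s ^ l * W') + W s * of_nat (l - 1) * R s ^ (l - 1) * (R' * R s ^ (l - 1))"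
      by (simp add: algebra_simps l)
    also have "\<dots> = 0" unfolding W' RR e by (simp add: algebra_simps)
    finally have "W' * R s ^ (l - 1) + W s * (of_nat (l - 1) * R s ^ (l - 2) * R') = 0"
      using R_nz[OF s] by simp
    thus ?thesis using d by simp
  qed
  have "\<exists>C. \<forall>x\<in>ball 0 1. W x * R x ^ (l - 1) = C"
    by (rule has_field_derivative_zero_constant) (use has_field_derivative_at_within[OF der] in auto)
  then obtain C where C: "\<forall>x\<in>ball 0 1. W x * R x ^ (l - 1) = C" by blast
  have "C = 1" using C[rule_format, of 0] by (simp add: W_def U_0 V_0 U1_0 V1_0 R_0)
  thus ?thesis using C s by (simp add: W_def)
qed

end

section \<open>The explicit forms and the Schwarz map\<close>

lemma isCont_imp_tendsto_nhds: "isCont f a \<Longrightarrow> (f \<longlongrightarrow> f a) (nhds a)"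
  by (simp add: isCont_def tendsto_at_iff_tendsto_nhds)

lemma unity_roots_isolated:
  assumes "n > 0"
  obtains e :: real where "e > 0" "\<And>w::complex. w ^ n = 1 \<Longrightarrow> dist 1 w < e \<Longrightarrow> w = 1"
proof -
  have "finite {w::complex. w ^ n = 1}" using assms by (intro finite_roots_unity) auto
  from finite_set_avoid[OF this, of 1] obtain d where "d > 0" "\<forall>x\<in>{w::complex. w ^ n = 1}. x \<noteq> 1 \<longrightarrow> d \<le> dist 1 x"
    by blast
  thus ?thesis using that[of d] by force
qed

text \<open>The quotient is an n-th root of unity that tends to 1, and roots of unity are isolated.
  This is how a branch of a root is singled out.\<close>

lemma eventually_equal_powers:
  fixes f g :: "'a \<Rightarrow> complex"
  assumes n: "n > 0" and f: "(f \<longlongrightarrow> L) F" and g: "(g \<longlongrightarrow> L) F" and L: "L \<noteq> 0"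
    and eq: "\<forall>\<^sub>F x in F. f x ^ n = g x ^ n"
  shows "\<forall>\<^sub>F x in F. f x = g x"
proof -
  obtain e :: real where e: "e > 0" "\<And>w::complex. w ^ n = 1 \<Longrightarrow> dist 1 w < e \<Longrightarrow> w = 1"
    using unity_roots_isolated[OF n] by blast
  have "((\<lambda>x. f x / g x) \<longlongrightarrow> L / L) F" by (intro tendsto_divide f g L)
  hence "\<forall>\<^sub>F x in F. dist (f x / g x) 1 < e" using L e(1) by (simp add: tendsto_iff)
  moreover have "\<forall>\<^sub>F x in F. g x \<noteq> 0" using tendsto_imp_eventually_ne[OF g L] .
  ultimately show ?thesis using eq
  proof eventually_elim
    case (elim x)
    hence "(f x / g x) ^ n = 1" by (simp add: power_divide)
    hence "f x / g x = 1" using e(2)[of "f x / g x"] elim by (simp add: dist_commute)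
    thus ?case using elim by simp
  qed
qed

text \<open>Each Taylor coefficient of w is determined by lower ones of E and conversely, so both
  series vanish. The second-order equations compared below are brought into this form, which avoids
  differentiating a change of variable twice.\<close>

lemma linear_system_unique:
  fixes w E :: "complex \<Rightarrow> complex"
  assumes rho: "\<rho> > 0" and hol: "\<alpha> holomorphic_on ball 0 \<rho>" "\<beta> holomorphic_on ball 0 \<rho>"
    and w: "\<And>z. z \<in> ball 0 \<rho> \<Longrightarrow> (w has_field_derivative \<alpha> z * E z) (at z)"
    and E: "\<And>z. z \<in> ball 0 \<rho> \<Longrightarrow> (E has_field_derivative \<beta> z * w z) (at z)"
    and init: "w 0 = 0" "E 0 = 0"
  shows "\<forall>\<^sub>F z in nhds 0. w z = 0"
proof -
  have hw: "w holomorphic_on ball 0 \<rho>" "E holomorphic_on ball 0 \<rho>"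
    using w E by (meson holomorphic_on_open open_ball)+
  have ex: "f has_fps_expansion fps_expansion f 0" if "f holomorphic_on ball 0 \<rho>" for f
    by (rule has_fps_expansion_fps_expansion[OF open_ball _ that]) (use rho in auto)
  define W F A B where "W = fps_expansion w 0" and "F = fps_expansion E 0"
    and "A = fps_expansion \<alpha> 0" and "B = fps_expansion \<beta> 0"
  note defs = W_def F_def A_def B_def
  have near: "\<forall>\<^sub>F z in nhds 0. z \<in> ball 0 \<rho>" by (rule eventually_nhds_in_open) (use rho in auto)
  have "(\<lambda>z. deriv w z - \<alpha> z * E z) has_fps_expansion fps_deriv W - A * F"
    unfolding defs by (intro fps_expansion_intros ex hw hol)
  moreover have "\<forall>\<^sub>F z in nhds 0. deriv w z - \<alpha> z * E z = 0"
    using near by eventually_elim (simp add: DERIV_imp_deriv[OF w])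
  ultimately have "fps_deriv W - A * F = 0"
    unfolding has_fps_expansion_0_iff[symmetric] by (rule fps_expansion_unique_complex)
  hence W: "fps_deriv W = A * F" by simp
  have "(\<lambda>z. deriv E z - \<beta> z * w z) has_fps_expansion fps_deriv F - B * W"
    unfolding defs by (intro fps_expansion_intros ex hw hol)
  moreover have "\<forall>\<^sub>F z in nhds 0. deriv E z - \<beta> z * w z = 0"
    using near by eventually_elim (simp add: DERIV_imp_deriv[OF E])
  ultimately have "fps_deriv F - B * W = 0"
    unfolding has_fps_expansion_0_iff[symmetric] by (rule fps_expansion_unique_complex)
  hence F: "fps_deriv F = B * W" by simp
  have W0: "W $ 0 = 0" "F $ 0 = 0"
    using init ex[OF hw(1)] ex[OF hw(2)] unfolding defs by (simp_all add: fps_expansion_def)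
  have "W $ n = 0 \<and> F $ n = 0" for n
  proof (induction n rule: less_induct)
    case (less n)
    show ?case
    proof (cases n)
      case (Suc j)
      have "fps_deriv W $ j = 0"
        unfolding W fps_mult_nth using less Suc by (intro sum.neutral) auto
      moreover have "fps_deriv F $ j = 0"
        unfolding F fps_mult_nth using less Suc by (intro sum.neutral) auto
      ultimately show ?thesis unfolding Suc by (simp del: of_nat_Suc)
    qed (use W0 in simp)
  qed
  hence "W = 0" by (intro fps_ext) simp
  thus ?thesis using ex[OF hw(1)] unfolding W_def[symmetric] by (simp add: has_fps_expansion_0_iff)
qed

lemma homogeneous_poly2_scale:
  assumes "homogeneous_poly2 d P" shows "P (t * u) (t * v) = t ^ d * P u v"
proof -
  obtain h where h: "\<And>u v. P u v = (\<Sum>j\<le>d. h j * u ^ (d - j) * v ^ j)"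
    using assms unfolding homogeneous_poly2_def by blast
  have "h j * (t * u) ^ (d - j) * (t * v) ^ j = t ^ d * (h j * u ^ (d - j) * v ^ j)" if "j \<le> d" for j
  proof -
    have "t ^ d = t ^ (d - j) * t ^ j" using that by (simp flip: power_add)
    thus ?thesis by (simp add: power_mult_distrib mult_ac)
  qed
  thus ?thesis unfolding h sum_distrib_left by (intro sum.cong) auto
qed

lemma homogeneous_poly2_holomorphic:
  assumes "homogeneous_poly2 d P" "f holomorphic_on S" "g holomorphic_on S"
  shows "(\<lambda>z. P (f z) (g z)) holomorphic_on S"
proof -
  obtain h where h: "\<And>u v. P u v = (\<Sum>j\<le>d. h j * u ^ (d - j) * v ^ j)"
    using assms unfolding homogeneous_poly2_def by blast
  show ?thesis unfolding h by (intro holomorphic_intros assms)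
qed

lemma homogeneous_poly2_continuous:
  assumes "homogeneous_poly2 d P" "continuous_on S f" "continuous_on S g"
  shows "continuous_on S (\<lambda>z. P (f z) (g z))"
proof -
  obtain h where h: "\<And>u v. P u v = (\<Sum>j\<le>d. h j * u ^ (d - j) * v ^ j)"
    using assms unfolding homogeneous_poly2_def by blast
  show ?thesis unfolding h by (intro continuous_intros assms)
qed

lemma homogeneous_poly2_tendsto:
  assumes "homogeneous_poly2 d P" "(f \<longlongrightarrow> u) F" "(g \<longlongrightarrow> v) F"
  shows "((\<lambda>z. P (f z) (g z)) \<longlongrightarrow> P u v) F"
proof -
  obtain h where h: "\<And>u v. P u v = (\<Sum>j\<le>d. h j * u ^ (d - j) * v ^ j)"
    using assms unfolding homogeneous_poly2_def by blast
  show ?thesis unfolding h by (intro tendsto_intros assms)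
qed

text \<open>The numbers \<open>m0\<close>, \<open>m1\<close>, \<open>m\<close> are the degrees of
  the three forms. The equation \<open>msum\<close> restates 2/N = 1/k + 1/l + 1/r - 1; for a
  polyhedron it is Euler's formula.\<close>

locale schwarz_setup = schwarz_params +
  fixes N m0 m1 m :: nat
  assumes N0: "N = k * m0" and N1: "N = l * m1" and Ninf: "N = r * m" and msum: "m0 + m1 + m = N + 2"
begin

lemma m0_ge: "m0 \<ge> 2" and m1_ge: "m1 \<ge> 2" and m_ge: "m \<ge> 2"
proof -
  have "2 * m0 \<le> N" "2 * m1 \<le> N" "2 * m \<le> N"
    using N0 N1 Ninf k2 l2 r2 by (metis mult_le_mono1)+
  thus "m0 \<ge> 2" "m1 \<ge> 2" "m \<ge> 2" using msum by auto
qed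

lemma Npos: "N > 0" using Ninf rpos m_ge by auto

text \<open>The Hessian of a form of degree m has degree 2 (m - 2). This lemma and the next two
  match the degrees in the Hessian relation and in the two Jacobian relations.\<close>

lemma expo_hess: "m0 * (k - 2) + m1 * (l - 2) = 2 * (m - 2)"
proof -
  have "m0 * (k - 2) + 2 * m0 = N" "m1 * (l - 2) + 2 * m1 = N"
    using k2 l2 unfolding N0 N1 by (metis add_mult_distrib2 le_add_diff_inverse2 mult.commute,
      metis N0 N1 add_mult_distrib2 le_add_diff_inverse2 mult.commute)
  thus ?thesis using msum m_ge by linarith
qed

lemma expo_jac0: "m1 * (l - 1) + 2 = m0 + m"
proof -
  have "m1 * (l - 1) + m1 = N" using lpos unfolding N1 by (metis Suc_diff_1 mult.commute mult_Suc_right add.commute)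
  thus ?thesis using msum by linarith
qed

lemma expo_jac1: "m0 * (k - 1) + 2 = m1 + m"
proof -
  have "m0 * (k - 1) + m0 = N" using kpos unfolding N0 by (metis Suc_diff_1 mult.commute mult_Suc_right add.commute)
  thus ?thesis using msum by linarith
qed

text \<open>Solving the exponent conditions gives a = (m - 1)/N and b = -1/N, and k/N =
  1/m0.\<close>

lemma Lcoef_eq: "Lcoef = - of_nat (m - 1) / (of_nat m0)\<^sup>2"
proof -
  have n: "real N > 0" using Npos by simp
  have "real k * real m0 = real N" "real l * real m1 = real N" "real r * real m = real N"
    by (metis N0 of_nat_mult, metis N1 of_nat_mult, metis Ninf of_nat_mult)
  hence inv: "1 / real k = real m0 / real N" "1 / real l = real m1 / real N" "1 / real r = real m / real N"
    using n kpos lpos rpos by (auto simp: field_simps)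
  have ms: "real m1 = real N + 2 - real m0 - real m" using msum by linarith
  have amb: "a - b = real m / real N" using expinf inv by simp
  have apb: "a + b = 1 - real m0 / real N - real m1 / real N" using exp0 exp1 inv by simp
  have apb': "a + b = (real m - 2) / real N" unfolding apb ms using n by (simp add: field_simps)
  have a: "a = (real m - 1) / real N" and b: "b = - 1 / real N"
    using amb apb' n by (auto simp: field_simps)
  have "(real k)\<^sup>2 * a * b = - (real m - 1) * (real k / real N)\<^sup>2"
    unfolding a b using n by (simp add: divide_simps power2_eq_square) (simp add: algebra_simps)
  also have "real k / real N = 1 / real m0"
    using inv(1) n kpos m0_ge by (simp add: field_simps)
  also have "- (real m - 1) * (1 / real m0)\<^sup>2 = - real (m - 1) / (real m0)\<^sup>2"
    using m_ge by (simp add: field_simps)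
  finally have "Lcoef = of_real (- real (m - 1) / (real m0)\<^sup>2)" unfolding Lcoef_def by simp
  thus ?thesis by simp
qed

lemma U_holo: "U holomorphic_on ball 0 1" and V_holo: "V holomorphic_on ball 0 1"
  and R_holo: "R holomorphic_on ball 0 1"
  by (meson U_deriv holomorphic_on_open open_ball, meson V_deriv holomorphic_on_open open_ball,
      meson R_deriv holomorphic_on_open open_ball)

text \<open>With p = Pinf(1, z)^(-1/m) the point (p, z p) runs through the curve Pinf = 1. As
  functions of \<sigma> = P0(p, z p) its coordinates satisfy the equation of \<open>U\<close> and
  \<open>V\<close> with the same initial values, hence p = U(\<sigma>) and z p = V(\<sigma>). The
  hypotheses \<open>jac0\<close>, \<open>jac1\<close>, \<open>hess\<close> are the Jacobian and
  Hessian relations on the line u = 1, Euler's relation having removed the derivatives in u.\<close>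

lemma germ_identities:
  assumes hom: "homogeneous_poly2 m0 P0" "homogeneous_poly2 m1 P1" "homogeneous_poly2 m Pinf"
    and d0: "\<And>z. (P0 1 has_field_derivative f0' z) (at z)"
    and d1: "\<And>z. (P1 1 has_field_derivative f1' z) (at z)"
    and d: "\<And>z. (Pinf 1 has_field_derivative f' z) (at z)"
    and dd: "\<And>z. (f' has_field_derivative f'' z) (at z)"
    and init: "P0 1 0 = 0" "P1 1 0 = 1" "Pinf 1 0 = 1" "f' 0 = 0"
    and jac0: "\<And>z. of_nat m * Pinf 1 z * f0' z - of_nat m0 * f' z * P0 1 z = of_nat m * P1 1 z ^ (l - 1)"
    and jac1: "\<And>z. of_nat m * Pinf 1 z * f1' z - of_nat m1 * f' z * P1 1 z =
      - (of_nat m * of_nat k / of_nat l) * P0 1 z ^ (k - 1)"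
    and hess: "\<And>z. of_nat m * Pinf 1 z * f'' z - of_nat (m - 1) * f' z ^ 2 =
      of_nat (m - 1) * (of_nat m / of_nat m0)\<^sup>2 * P0 1 z ^ (k - 2) * P1 1 z ^ (l - 2)"
    and s: "s \<in> ball 0 1"
  shows "P0 (U s) (V s) = s" "P1 (U s) (V s) = R s" "Pinf (U s) (V s) = 1"
proof -
  define f f0 f1 where "f = Pinf 1" and "f0 = P0 1" and "f1 = P1 1"
  note d0 = d0[folded f0_def] and d1 = d1[folded f1_def] and d = d[folded f_def]
  note jac0 = jac0[folded f_def f0_def f1_def] and jac1 = jac1[folded f_def f0_def f1_def]
    and hess = hess[folded f_def f0_def f1_def] and init = init[folded f_def f0_def f1_def]
  define mm :: complex where "mm = of_nat m"
  have mm: "mm \<noteq> 0" using m_ge by (simp add: mm_def)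
  define p where "p = (\<lambda>z. exp (- Ln (f z) / mm))"
  define \<sigma> where "\<sigma> = (\<lambda>z. f0 z * p z ^ m0)"
  define \<tau> where "\<tau> = (\<lambda>z. f1 z * p z ^ m1)"
  have cont: "isCont f z" "isCont f0 z" for z using d d0 by (auto intro: DERIV_isCont)
  have p0: "p 0 = 1" by (simp add: p_def init)
  have sig0: "\<sigma> 0 = 0" by (simp add: \<sigma>_def init)
  have conts: "isCont \<sigma> 0"
    unfolding \<sigma>_def p_def using cont[of 0] mm by (auto intro!: continuous_intros simp: init)
  have "\<forall>\<^sub>F z in nhds 0. f z \<in> - \<real>\<^sub>\<le>\<^sub>0"
    by (rule topological_tendstoD[OF isCont_imp_tendsto_nhds[OF cont(1)]]) (auto simp: init)
  moreover have "\<forall>\<^sub>F z in nhds 0. \<sigma> z \<in> ball 0 1"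
    by (rule topological_tendstoD[OF isCont_imp_tendsto_nhds[OF conts]]) (auto simp: sig0)
  ultimately have "\<forall>\<^sub>F z in nhds 0. f z \<in> - \<real>\<^sub>\<le>\<^sub>0 \<and> \<sigma> z \<in> ball 0 1" by eventually_elim auto
  then obtain \<rho> where rho: "\<rho> > 0" and good: "\<And>z. z \<in> ball 0 \<rho> \<Longrightarrow> f z \<notin> \<real>\<^sub>\<le>\<^sub>0 \<and> \<sigma> z \<in> ball 0 1"
    unfolding eventually_nhds_metric by (auto simp: dist_commute)
  have pnz: "p z \<noteq> 0" for z by (simp add: p_def)
  have fp: "f z * p z ^ m = 1" if "z \<in> ball 0 \<rho>" for z
  proof -
    have "f z \<noteq> 0" using good[OF that] by auto
    moreover have "p z ^ m = exp (- Ln (f z))"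
      unfolding p_def exp_of_nat_mult[symmetric] using mm by (simp add: mm_def)
    ultimately show ?thesis by (simp add: exp_minus)
  qed
  have dp: "(p has_field_derivative - (f' z / mm) * p z ^ m * p z) (at z)" if "z \<in> ball 0 \<rho>" for z
  proof -
    have nz: "f z \<noteq> 0" using good[OF that] by auto
    have "(p has_field_derivative - (f' z / f z / mm) * p z) (at z)"
      unfolding p_def using good[OF that] mm
      by (auto intro!: derivative_eq_intros d simp: divide_inverse mult_ac)
    moreover have "p z ^ m = 1 / f z" using fp[OF that] nz by (simp add: field_simps)
    ultimately show ?thesis by (simp add: mult_ac)
  qed
  \<comment> \<open>The bracket is the dehomogenised Jacobian of Pinf and g; the factor f in front
    of g' is supplied by f p^m = 1.\<close>
  have dgp: "((\<lambda>z. g z * p z ^ n) has_field_derivative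
      p z ^ (n + m) / mm * (mm * f z * g' - of_nat n * f' z * g z)) (at z)"
    if z: "z \<in> ball 0 \<rho>" and g: "(g has_field_derivative g') (at z)" for g g' n z
  proof -
    have "((\<lambda>z. g z * p z ^ n) has_field_derivative
      g' * p z ^ n + of_nat n * (p z ^ (n - 1) * (- (f' z / mm) * p z ^ m * p z)) * g z) (at z)"
      using DERIV_mult[OF g DERIV_power[OF dp[OF z], of n]] by (simp add: mult_ac)
    moreover have "of_nat n * (p z ^ (n - 1) * (- (f' z / mm) * p z ^ m * p z)) =
        - of_nat n * p z ^ (n + m) * (f' z / mm)"
    proof (cases n)
      case (Suc j)
      have "p z ^ (n - 1) * p z ^ m * p z = p z ^ (n + m)" by (simp add: Suc power_add mult_ac)
      hence "p z ^ (n - 1) * (- (f' z / mm) * p z ^ m * p z) = - (f' z / mm) * p z ^ (n + m)"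
        by (metis mult.assoc mult.left_commute)
      thus ?thesis by (simp only: mult_minus_left mult_minus_right mult_ac)
    qed simp
    moreover have "g' * p z ^ n = p z ^ (n + m) * f z * g'"
      using fp[OF z] by (simp add: power_add mult_ac)
    ultimately have "((\<lambda>z. g z * p z ^ n) has_field_derivative
      p z ^ (n + m) * f z * g' + - of_nat n * p z ^ (n + m) * (f' z / mm) * g z) (at z)"
      by (simp only:)
    thus ?thesis by (rule DERIV_cong) (use mm in \<open>simp add: field_simps\<close>)
  qed
  \<comment> \<open>For a function Y of \<sigma> the companion variable is E = m \<tau>^(l-1)
    dY/d\<sigma>, and \<open>Ep\<close> is its value for Y = p. The equation then reads Y' =
    \<alpha> E, E' = \<beta> Y in the variable z, with \<Lambda> = m^2 \<open>Lcoef\<close>.\<close>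
  define Ep where "Ep = (\<lambda>z. - f' z * p z ^ (m - 1))"
  define \<Lambda> where "\<Lambda> = - of_nat (m - 1) * (mm / of_nat m0)\<^sup>2"
  define \<alpha> where "\<alpha> = (\<lambda>z. p z ^ 2 / mm)"
  define \<beta> where "\<beta> = (\<lambda>z. p z ^ 2 / mm * (\<Lambda> * \<sigma> z ^ (k - 2) * \<tau> z ^ (l - 2)))"
  have dp1: "(p has_field_derivative \<alpha> z * Ep z) (at z)" if z: "z \<in> ball 0 \<rho>" for z
  proof -
    have "- (f' z / mm) * p z ^ m * p z = \<alpha> z * Ep z"
      unfolding \<alpha>_def Ep_def using m_ge by (cases m) (auto simp: power2_eq_square)
    thus ?thesis using dp[OF z] by simp
  qed
  have dEp: "(Ep has_field_derivative \<beta> z * p z) (at z)" if z: "z \<in> ball 0 \<rho>" for z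
  proof -
    have g: "((\<lambda>z. - f' z) has_field_derivative - f'' z) (at z)" by (intro derivative_intros dd)
    have "mm * f z * - f'' z - of_nat (m - 1) * f' z * - f' z =
        - (mm * f z * f'' z - of_nat (m - 1) * f' z ^ 2)" by (simp add: power2_eq_square)
    also have "\<dots> = - (of_nat (m - 1) * (mm / of_nat m0)\<^sup>2 * f0 z ^ (k - 2) * f1 z ^ (l - 2))"
      using hess[of z] by (simp only: mm_def)
    finally have *: "mm * f z * - f'' z - of_nat (m - 1) * f' z * - f' z = \<Lambda> * f0 z ^ (k - 2) * f1 z ^ (l - 2)"
      by (simp add: \<Lambda>_def)
    \<comment> \<open>The power p^(2m-1) is distributed over \<sigma>^(k-2), \<tau>^(l-2) and the
      factor p^2 p of the claim; the degree count of the Hessian makes this exact.\<close>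
    have ex: "m - 1 + m = 2 * (m - 2) + 2 + 1" using m_ge by simp
    have pe: "p z ^ (m - 1 + m) = p z ^ (m0 * (k - 2)) * p z ^ (m1 * (l - 2)) * p z ^ 2 * p z"
      unfolding ex power_add expo_hess[symmetric] by simp
    show ?thesis
      using dgp[OF z g, of "m - 1"] unfolding Ep_def * pe
      by (rule DERIV_cong) (simp add: \<beta>_def \<sigma>_def \<tau>_def power_mult_distrib power_mult[symmetric] mult_ac)
  qed
  have dsig: "(\<sigma> has_field_derivative p z ^ 2 * \<tau> z ^ (l - 1)) (at z)" if z: "z \<in> ball 0 \<rho>" for z
  proof -
    have "p z ^ (m0 + m) = p z ^ (m1 * (l - 1)) * p z ^ 2"
      unfolding expo_jac0[symmetric] power_add ..
    thus ?thesis using dgp[OF z d0, of m0] unfolding \<sigma>_def jac0[folded mm_def]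
      by (elim DERIV_cong) (use mm in \<open>simp add: \<tau>_def power_mult_distrib power_mult[symmetric] mult_ac\<close>)
  qed
  have dtau: "(\<tau> has_field_derivative - (of_nat k / of_nat l) * p z ^ 2 * \<sigma> z ^ (k - 1)) (at z)"
    if z: "z \<in> ball 0 \<rho>" for z
  proof -
    have "p z ^ (m1 + m) = p z ^ (m0 * (k - 1)) * p z ^ 2"
      unfolding expo_jac1[symmetric] power_add ..
    thus ?thesis using dgp[OF z d1, of m1] unfolding \<tau>_def jac1[folded mm_def]
      by (elim DERIV_cong) (use mm in \<open>simp add: \<sigma>_def power_mult_distrib power_mult[symmetric] mult_ac\<close>)
  qed
  \<comment> \<open>By the two Jacobian relations the derivatives of the two powers cancel, which
    gives the syzygy along the curve.\<close>
  have st: "\<sigma> z ^ k + \<tau> z ^ l = 1" if z: "z \<in> ball 0 \<rho>" for z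
  proof -
    have "((\<lambda>z. \<sigma> z ^ k + \<tau> z ^ l) has_field_derivative 0) (at z)" if z: "z \<in> ball 0 \<rho>" for z
      using DERIV_add[OF DERIV_power[OF dsig[OF z], of k] DERIV_power[OF dtau[OF z], of l]]
      by (rule DERIV_cong) (use lpos in \<open>simp add: mult_ac\<close>)
    hence "\<exists>C. \<forall>z\<in>ball 0 \<rho>. \<sigma> z ^ k + \<tau> z ^ l = C"
      using has_field_derivative_zero_constant[of "ball 0 \<rho>" "\<lambda>z. \<sigma> z ^ k + \<tau> z ^ l", OF convex_ball]
        has_field_derivative_at_within by blast
    then obtain C where C: "\<forall>z\<in>ball 0 \<rho>. \<sigma> z ^ k + \<tau> z ^ l = C" by blast
    have "C = 1" using C[rule_format, of 0] rho kpos by (simp add: \<sigma>_def \<tau>_def init p0 power_0_left)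
    thus ?thesis using C z by simp
  qed
  have hol: "p holomorphic_on ball 0 \<rho>" "\<sigma> holomorphic_on ball 0 \<rho>" "\<tau> holomorphic_on ball 0 \<rho>"
    by (meson dp holomorphic_on_open open_ball, meson dsig holomorphic_on_open open_ball,
        meson dtau holomorphic_on_open open_ball)
  have hab: "\<alpha> holomorphic_on ball 0 \<rho>" "\<beta> holomorphic_on ball 0 \<rho>"
    unfolding \<alpha>_def \<beta>_def by (intro holomorphic_intros hol mm)+
  have mL: "mm * mm * Lcoef = \<Lambda>"
    unfolding Lcoef_eq \<Lambda>_def by (simp add: power2_eq_square)
  have comp: "((\<lambda>z. Y (\<sigma> z)) has_field_derivative \<alpha> z * (mm * \<tau> z ^ (l - 1) * Y1 (\<sigma> z))) (at z)"
       "((\<lambda>z. mm * \<tau> z ^ (l - 1) * Y1 (\<sigma> z)) has_field_derivative \<beta> z * Y (\<sigma> z)) (at z)"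
    if z: "z \<in> ball 0 \<rho>" and Y: "\<And>s. s \<in> ball 0 1 \<Longrightarrow> (Y has_field_derivative Y1 s) (at s)"
      "\<And>s. s \<in> ball 0 1 \<Longrightarrow> (Y1 has_field_derivative Y2 s) (at s)"
      "\<And>s. s \<in> ball 0 1 \<Longrightarrow> (1 - s ^ k) * Y2 s - ecoef * s ^ (k - 1) * Y1 s = Lcoef * s ^ (k - 2) * Y s"
    for Y Y1 Y2 z
  proof -
    have sz: "\<sigma> z \<in> ball 0 1" using good[OF z] by blast
    show "((\<lambda>z. Y (\<sigma> z)) has_field_derivative \<alpha> z * (mm * \<tau> z ^ (l - 1) * Y1 (\<sigma> z))) (at z)"
      using DERIV_chain2[OF Y(1)[OF sz] dsig[OF z]]
      by (rule DERIV_cong) (use mm in \<open>simp add: \<alpha>_def mult_ac\<close>)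
    define T where "T = \<tau> z ^ (l - 2)"
    have T: "\<tau> z ^ (l - 1) = \<tau> z * T" "\<tau> z ^ l = \<tau> z * \<tau> z * T"
      unfolding T_def using l2 by (simp_all flip: power_Suc add: mult.assoc Suc_diff_Suc numeral_2_eq_2)
    have e: "ecoef = of_nat (l - 1) * (of_nat k / of_nat l)"
      unfolding ecoef_def using lpos by (simp add: of_nat_diff field_simps)
    have tl: "1 - \<sigma> z ^ k = \<tau> z ^ l" using st[OF z] by (simp add: algebra_simps)
    have "((\<lambda>z. mm * \<tau> z ^ (l - 1) * Y1 (\<sigma> z)) has_field_derivative
       mm * (of_nat (l - 1) * (T * (- (of_nat k / of_nat l) * p z ^ 2 * \<sigma> z ^ (k - 1)))) * Y1 (\<sigma> z) +
       Y2 (\<sigma> z) * (p z ^ 2 * \<tau> z ^ (l - 1)) * (mm * \<tau> z ^ (l - 1))) (at z)"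
      using DERIV_mult[OF DERIV_cmult[OF DERIV_power[OF dtau[OF z], of "l - 1"]] DERIV_chain2[OF Y(2)[OF sz] dsig[OF z]]]
      by (rule DERIV_cong) (simp add: T_def numeral_2_eq_2 mult_ac)
    thus "((\<lambda>z. mm * \<tau> z ^ (l - 1) * Y1 (\<sigma> z)) has_field_derivative \<beta> z * Y (\<sigma> z)) (at z)"
    proof (rule DERIV_cong)
      have "mm * (of_nat (l - 1) * (T * (- (of_nat k / of_nat l) * p z ^ 2 * \<sigma> z ^ (k - 1)))) * Y1 (\<sigma> z) +
       Y2 (\<sigma> z) * (p z ^ 2 * \<tau> z ^ (l - 1)) * (mm * \<tau> z ^ (l - 1)) =
        mm * p z ^ 2 * T * (\<tau> z ^ l * Y2 (\<sigma> z) - ecoef * \<sigma> z ^ (k - 1) * Y1 (\<sigma> z))"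
        unfolding e T by (simp add: algebra_simps)
      also have "\<dots> = mm * p z ^ 2 * T * (Lcoef * \<sigma> z ^ (k - 2) * Y (\<sigma> z))"
        using Y(3)[OF sz] unfolding tl by simp
      also have "\<dots> = \<beta> z * Y (\<sigma> z)"
        unfolding \<beta>_def mL[symmetric] T_def using mm by (simp add: mult_ac)
      finally show "mm * (of_nat (l - 1) * (T * (- (of_nat k / of_nat l) * p z ^ 2 * \<sigma> z ^ (k - 1)))) * Y1 (\<sigma> z) +
       Y2 (\<sigma> z) * (p z ^ 2 * \<tau> z ^ (l - 1)) * (mm * \<tau> z ^ (l - 1)) = \<beta> z * Y (\<sigma> z)" .
    qed
  qed
  have \<sigma>0: "\<sigma> 0 = 0" and \<tau>0: "\<tau> 0 = 1" by (simp_all add: \<sigma>_def \<tau>_def init p0)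
  have evU: "\<forall>\<^sub>F z in nhds 0. U (\<sigma> z) - p z = 0"
  proof (rule linear_system_unique[OF rho hab, where E = "\<lambda>z. mm * \<tau> z ^ (l - 1) * U1 (\<sigma> z) - Ep z"])
    fix z :: complex assume z: "z \<in> ball 0 \<rho>"
    note c = comp[where z = z and Y = U and ?Y1.0 = U1 and ?Y2.0 = U2, OF z U_deriv U1_deriv U_ode]
    show "((\<lambda>z. U (\<sigma> z) - p z) has_field_derivative \<alpha> z * (mm * \<tau> z ^ (l - 1) * U1 (\<sigma> z) - Ep z)) (at z)"
      using DERIV_diff[OF c(1) dp1[OF z]] by (simp add: algebra_simps)
    show "((\<lambda>z. mm * \<tau> z ^ (l - 1) * U1 (\<sigma> z) - Ep z) has_field_derivative \<beta> z * (U (\<sigma> z) - p z)) (at z)"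
      using DERIV_diff[OF c(2) dEp[OF z]] by (simp add: algebra_simps)
  qed (simp_all add: \<sigma>0 \<tau>0 p0 U_0 U1_0 Ep_def init)
  define q where "q = (\<lambda>z. z * p z)"
  \<comment> \<open>The companion variable of z p: its derivative is p + z p', and p = \<alpha> m /
    p.\<close>
  define Eq where "Eq = (\<lambda>z. mm / p z + z * Ep z)"
  have evV: "\<forall>\<^sub>F z in nhds 0. V (\<sigma> z) - q z = 0"
  proof (rule linear_system_unique[OF rho hab, where E = "\<lambda>z. mm * \<tau> z ^ (l - 1) * V1 (\<sigma> z) - Eq z"])
    fix z :: complex assume z: "z \<in> ball 0 \<rho>"
    note c = comp[where z = z and Y = V and ?Y1.0 = V1 and ?Y2.0 = V2, OF z V_deriv V1_deriv V_ode]
    have dq: "(q has_field_derivative \<alpha> z * Eq z) (at z)"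
      unfolding q_def using DERIV_mult[OF DERIV_ident dp1[OF z]]
      by (rule DERIV_cong) (use mm pnz[of z] in \<open>simp add: \<alpha>_def Eq_def field_simps power2_eq_square\<close>)
    have dEq: "(Eq has_field_derivative \<beta> z * q z) (at z)"
      unfolding Eq_def using DERIV_add[OF DERIV_divide[OF DERIV_const[of mm] dp1[OF z] pnz] DERIV_mult[OF DERIV_ident dEp[OF z]]]
      by (rule DERIV_cong) (use mm pnz[of z] in \<open>simp add: \<alpha>_def q_def field_simps power2_eq_square\<close>)
    show "((\<lambda>z. V (\<sigma> z) - q z) has_field_derivative \<alpha> z * (mm * \<tau> z ^ (l - 1) * V1 (\<sigma> z) - Eq z)) (at z)"
      using DERIV_diff[OF c(1) dq] by (simp add: algebra_simps)
    show "((\<lambda>z. mm * \<tau> z ^ (l - 1) * V1 (\<sigma> z) - Eq z) has_field_derivative \<beta> z * (V (\<sigma> z) - q z)) (at z)"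
      using DERIV_diff[OF c(2) dEq] by (simp add: algebra_simps)
  qed (simp_all add: \<sigma>0 \<tau>0 p0 V_0 V1_0 Eq_def q_def)
  have homs: "P (p z) (q z) = p z ^ d * P 1 z" if "homogeneous_poly2 d P" for P d z
    using homogeneous_poly2_scale[OF that, of "p z" 1 z] by (simp add: q_def mult.commute)
  have ct: "(\<tau> \<longlongrightarrow> 1) (nhds 0)" "((\<lambda>z. R (\<sigma> z)) \<longlongrightarrow> 1) (nhds 0)"
  proof -
    have "isCont \<tau> 0" using dtau[of 0] rho by (auto intro: DERIV_isCont)
    thus "(\<tau> \<longlongrightarrow> 1) (nhds 0)" using isCont_imp_tendsto_nhds[of 0 \<tau>] \<tau>0 by simp
    have "isCont R 0" by (rule DERIV_isCont[OF R_deriv]) simp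
    hence "isCont (\<lambda>z. R (\<sigma> z)) 0" by (intro isCont_o2[OF conts]) (simp add: \<sigma>0)
    thus "((\<lambda>z. R (\<sigma> z)) \<longlongrightarrow> 1) (nhds 0)" using isCont_imp_tendsto_nhds[of 0 "\<lambda>z. R (\<sigma> z)"] \<sigma>0 R_0 by simp
  qed
  have near: "\<forall>\<^sub>F z in nhds 0. z \<in> ball 0 \<rho>" by (rule eventually_nhds_in_open) (use rho in auto)
  have "\<forall>\<^sub>F z in nhds 0. \<tau> z ^ l = R (\<sigma> z) ^ l"
    using near
  proof eventually_elim
    case (elim z)
    thus ?case using st[OF elim] R_power[of "\<sigma> z"] good[OF elim] by (metis add_diff_cancel_left')
  qed
  \<comment> \<open>The l-th powers agree, and the common limit 1 at z = 0 selects the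
    branch.\<close>
  hence evR: "\<forall>\<^sub>F z in nhds 0. \<tau> z = R (\<sigma> z)"
    by (intro eventually_equal_powers[OF lpos ct]) auto
  have "\<forall>\<^sub>F z in nhds 0. P0 (U (\<sigma> z)) (V (\<sigma> z)) = \<sigma> z \<and> P1 (U (\<sigma> z)) (V (\<sigma> z)) = R (\<sigma> z) \<and>
     Pinf (U (\<sigma> z)) (V (\<sigma> z)) = 1"
    using evU evV evR near
  proof eventually_elim
    case (elim z)
    have "U (\<sigma> z) = p z" "V (\<sigma> z) = q z" using elim by auto
    thus ?case using elim fp[of z]
      by (simp add: homs[OF hom(1)] homs[OF hom(2)] homs[OF hom(3)] \<sigma>_def \<tau>_def f0_def f1_def f_def mult.commute)
  qed
  then obtain S where S: "open S" "0 \<in> S" "\<And>z. z \<in> S \<Longrightarrow> P0 (U (\<sigma> z)) (V (\<sigma> z)) = \<sigma> z \<and> P1 (U (\<sigma> z)) (V (\<sigma> z)) = R (\<sigma> z) \<and>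
     Pinf (U (\<sigma> z)) (V (\<sigma> z)) = 1"
    unfolding eventually_nhds by blast
  \<comment> \<open>Since \<sigma> is locally invertible at 0, the identities at \<sigma>(z) hold
    for all s near 0, and the identity theorem extends them to the disc.\<close>
  have d0: "deriv \<sigma> 0 \<noteq> 0"
    using DERIV_imp_deriv[OF dsig[of 0]] rho by (simp add: p0 \<tau>0)
  have "open (S \<inter> ball 0 \<rho>)" using S by auto
  obtain t where t: "t > 0" "ball 0 t \<subseteq> S \<inter> ball 0 \<rho>" "open (\<sigma> ` ball 0 t)"
  proof (rule has_complex_derivative_locally_invertible[of \<sigma> "S \<inter> ball 0 \<rho>" 0])
    show "\<sigma> holomorphic_on S \<inter> ball 0 \<rho>" using hol(2) by (rule holomorphic_on_subset) auto
  qed (use S rho d0 that in auto)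
  have ev: "\<forall>\<^sub>F s in nhds 0. s \<in> \<sigma> ` ball 0 t"
    using t \<sigma>0 by (intro eventually_nhds_in_open) (auto simp: image_iff intro!: bexI[of _ 0])
  have ids: "\<forall>\<^sub>F s in nhds 0. P0 (U s) (V s) - s = 0" "\<forall>\<^sub>F s in nhds 0. P1 (U s) (V s) - R s = 0"
    "\<forall>\<^sub>F s in nhds 0. Pinf (U s) (V s) - 1 = 0"
    using ev by (eventually_elim; use S t in force)+
  have "P0 (U s) (V s) - s = 0"
    by (rule holomorphic_zero_on_ball[OF _ _ _ _ ids(1) s]) (intro holomorphic_intros homogeneous_poly2_holomorphic[OF hom(1)] U_holo V_holo, auto)
  moreover have "P1 (U s) (V s) - R s = 0"
    by (rule holomorphic_zero_on_ball[OF _ _ _ _ ids(2) s]) (intro holomorphic_intros homogeneous_poly2_holomorphic[OF hom(2)] U_holo V_holo R_holo, auto)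
  moreover have "Pinf (U s) (V s) - 1 = 0"
    by (rule holomorphic_zero_on_ball[OF _ _ _ _ ids(3) s]) (intro holomorphic_intros homogeneous_poly2_holomorphic[OF hom(3)] U_holo V_holo, auto)
  ultimately show "P0 (U s) (V s) = s" "P1 (U s) (V s) = R s" "Pinf (U s) (V s) = 1" by auto
qed

end

section \<open>Syzygy, Jacobian and Hessian of the forms\<close>

text \<open>A comparison of orders at z: the right-hand side vanishes there exactly to order j, the
  left-hand side at least to order i.\<close>

lemma linear_power_le:
  fixes A B :: "complex poly"
  assumes "[:-z, 1:] ^ i * A = [:-z, 1:] ^ j * B" "poly B z \<noteq> 0"
  shows "i \<le> j"
proof (rule ccontr)
  assume "\<not> i \<le> j"
  hence i: "i = j + Suc (i - j - 1)" by simp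
  have "[:-z, 1:] ^ j * ([:-z, 1:] ^ Suc (i - j - 1) * A) = [:-z, 1:] ^ j * B"
    using assms(1) by (subst (asm) i) (simp only: power_add mult.assoc)
  hence "[:-z, 1:] ^ Suc (i - j - 1) * A = B" by simp
  hence "poly ([:-z, 1:] ^ Suc (i - j - 1) * A) z = poly B z" by simp
  hence "poly B z = 0" by simp
  thus False using assms(2) by contradiction
qed

lemma linear_power_eq:
  fixes A B :: "complex poly"
  assumes "[:-z, 1:] ^ i * A = [:-z, 1:] ^ j * B" "poly B z \<noteq> 0" "poly A z \<noteq> 0"
  shows "i = j" "A = B"
proof -
  show "i = j" using linear_power_le[OF assms(1,2)] linear_power_le[OF assms(1)[symmetric] assms(3)] by simp
  thus "A = B" using assms(1) by simp
qed

text \<open>A term of strictly lowest order cannot be cancelled.\<close>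

lemma linear_power_not_sum:
  fixes A B C :: "complex poly"
  assumes "[:-z, 1:] ^ x * A + [:-z, 1:] ^ y * B = [:-z, 1:] ^ w * C" "poly A z \<noteq> 0" "x < y" "x < w"
  shows False
proof -
  define X where "X = [:-z, 1:]"
  have y: "X ^ y = X ^ Suc x * X ^ (y - Suc x)" and w: "X ^ w = X ^ Suc x * X ^ (w - Suc x)"
    using assms(3,4) by (simp_all flip: power_add power_Suc)
  have "X ^ x * A = X ^ w * C - X ^ y * B"
    using assms(1) unfolding X_def by (simp add: algebra_simps)
  also have "\<dots> = X ^ Suc x * (X ^ (w - Suc x) * C - X ^ (y - Suc x) * B)"
    unfolding y w by (simp add: algebra_simps)
  finally have "X ^ Suc x * (X ^ (w - Suc x) * C - X ^ (y - Suc x) * B) = X ^ x * A" ..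
  hence "Suc x \<le> x" using linear_power_le assms(2) unfolding X_def by blast
  thus False by simp
qed

lemma smult_of_nat: "smult (of_nat n) p = of_nat n * p"
  by (simp add: of_nat_poly)

text \<open>The four relations compare the orders \<open>a\<^sub>0\<close>, \<open>a\<^sub>1\<close>, \<open>a\<close> of the three polynomials at a common root. They force
  \<open>v = k a\<^sub>0 = l a\<^sub>1 < r a\<close> and \<open>a + a\<^sub>0 + a\<^sub>1 = 1 + v\<close>, unless all orders are maximal; the leading coefficients at
  the root then give \<open>v (N - v) = 0\<close>, which is impossible.\<close>

lemma no_common_root:
  fixes G0 G1 G :: "complex poly" and k l r m0 m1 m N :: nat
  assumes ge: "k \<ge> 2" "l \<ge> 2" "r \<ge> 2" "m \<ge> 2"
    and N0: "N = k * m0" and N1: "N = l * m1" and Ninf: "N = r * m" and msum: "m0 + m1 + m = N + 2"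
    and deg: "degree G0 \<le> m0" "degree G1 \<le> m1" "degree G \<le> m"
    and nz: "G0 \<noteq> 0" "G1 \<noteq> 0" "G \<noteq> 0"
    and syz: "G0 ^ k + G1 ^ l = G ^ r"
    and jac0: "of_nat m0 * pderiv G * G0 - of_nat m * G * pderiv G0 = of_nat m * G1 ^ (l - 1)"
    and jac1: "of_nat l * (of_nat m1 * pderiv G * G1 - of_nat m * G * pderiv G1) = - of_nat (m * k) * G0 ^ (k - 1)"
    and hess: "of_nat m0 ^ 2 * (of_nat m * G * pderiv (pderiv G) - of_nat (m - 1) * (pderiv G)\<^sup>2) =
      of_nat (m - 1) * of_nat m ^ 2 * G0 ^ (k - 2) * G1 ^ (l - 2)"
    and root: "poly G z = 0" "poly G0 z = 0"
  shows False
proof -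
  define X where "X = [:-z, 1:]"
  have X0: "poly X z = 0" and X_nz: "X \<noteq> 0" and dX: "pderiv X = 1" by (auto simp: X_def pderiv_pCons)
  have Npos: "N > 0" "m0 > 0" "m1 > 0"
  proof -
    show "N > 0" using Ninf ge by auto
    thus "m0 > 0" "m1 > 0" using N0 N1 by (metis gr0I mult_0_right less_nat_zero_code)+
  qed
  have "poly G1 z ^ l = poly (G ^ r) z - poly (G0 ^ k) z" unfolding syz[symmetric] by simp
  hence root1: "poly G1 z = 0" using root ge by (simp add: power_0_left)
  define a0 a1 a where "a0 = order z G0" and "a1 = order z G1" and "a = order z G"
  have apos: "a0 > 0" "a1 > 0" "a > 0"
    using root root1 nz by (auto simp: a0_def a1_def a_def order_root)
  obtain g0 where g0: "G0 = X ^ a0 * g0" and "\<not> X dvd g0" using order_decomp[OF nz(1), of z] unfolding a0_def X_def by blast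
  hence c0: "poly g0 z \<noteq> 0" by (simp add: X_def poly_eq_0_iff_dvd)
  obtain g1 where g1: "G1 = X ^ a1 * g1" and "\<not> X dvd g1" using order_decomp[OF nz(2), of z] unfolding a1_def X_def by blast
  hence c1: "poly g1 z \<noteq> 0" by (simp add: X_def poly_eq_0_iff_dvd)
  obtain g where g: "G = X ^ a * g" and "\<not> X dvd g" using order_decomp[OF nz(3), of z] unfolding a_def X_def by blast
  hence c: "poly g z \<noteq> 0" by (simp add: X_def poly_eq_0_iff_dvd)
  have ord_le: "a0 \<le> m0" "a1 \<le> m1" "a \<le> m"
    using order_degree[OF nz(1), of z] order_degree[OF nz(2), of z] order_degree[OF nz(3), of z] deg
    by (auto simp: a0_def a1_def a_def)
  \<comment> \<open>\<open>T n f\<close> is what remains of X (X^n f)' after removing X^n. The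
    operator X d/dX preserves orders, and at z it multiplies the leading coefficient by n.\<close>
  define T where "T = (\<lambda>n f. of_nat n * f + X * pderiv f)"
  have theta: "X * pderiv (X ^ n * f) = X ^ n * T n f" if n: "n > 0" for n and f :: "complex poly"
  proof -
    obtain j where j: "n = Suc j" using n by (cases n) auto
    show ?thesis unfolding T_def j
      by (simp add: pderiv_mult pderiv_power_Suc dX smult_of_nat del: of_nat_Suc power_Suc)
        (simp add: algebra_simps del: of_nat_Suc)
  qed
  have T_z: "poly (T n f) z = of_nat n * poly f z" for n f by (simp add: T_def X0)
  define B0 where "B0 = of_nat m0 * T a g * g0 - of_nat m * g * T a0 g0"
  define B1 where "B1 = of_nat l * (of_nat m1 * T a g * g1 - of_nat m * g * T a1 g1)"
  \<comment> \<open>The factor X turns the derivatives into \<open>T\<close>, and the factor G1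
    turns the exponent l - 1 into l. The next two relations are treated in the same way.\<close>
  have J0: "X ^ (a + a0 + a1) * (B0 * g1) = X ^ (1 + l * a1) * (of_nat m * g1 ^ l)"
  proof -
    have "X * (of_nat m0 * pderiv G * G0 - of_nat m * G * pderiv G0) * G1 = X * (of_nat m * G1 ^ (l - 1)) * G1"
      unfolding jac0 ..
    moreover have "X * (of_nat m0 * pderiv G * G0 - of_nat m * G * pderiv G0) * G1 =
        (of_nat m0 * (X * pderiv G) * G0 - of_nat m * G * (X * pderiv G0)) * G1"
      by (simp add: algebra_simps)
    moreover have "\<dots> = X ^ (a + a0 + a1) * (B0 * g1)"
      unfolding g g0 g1 theta[OF apos(3)] theta[OF apos(1)] B0_def by (simp add: algebra_simps power_add)
    moreover have "G1 ^ (l - 1) * G1 = G1 ^ l" using ge(2) by (cases l) (auto simp: mult.commute)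
    hence "X * (of_nat m * G1 ^ (l - 1)) * G1 = X * (of_nat m * G1 ^ l)" by (simp add: mult.assoc)
    moreover have "\<dots> = X ^ (1 + l * a1) * (of_nat m * g1 ^ l)"
      unfolding g1 by (simp add: power_mult_distrib power_mult[symmetric] mult_ac)
    ultimately show ?thesis by metis
  qed
  have J1: "X ^ (a + a0 + a1) * (B1 * g0) = X ^ (1 + k * a0) * (- of_nat (m * k) * g0 ^ k)"
  proof -
    have "X * (of_nat l * (of_nat m1 * pderiv G * G1 - of_nat m * G * pderiv G1)) * G0 =
        X * (- of_nat (m * k) * G0 ^ (k - 1)) * G0"
      unfolding jac1 ..
    moreover have "X * (of_nat l * (of_nat m1 * pderiv G * G1 - of_nat m * G * pderiv G1)) * G0 =
        of_nat l * (of_nat m1 * (X * pderiv G) * G1 - of_nat m * G * (X * pderiv G1)) * G0"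
      by (simp add: algebra_simps)
    moreover have "\<dots> = X ^ (a + a0 + a1) * (B1 * g0)"
      unfolding g g0 g1 theta[OF apos(3)] theta[OF apos(2)] B1_def by (simp add: algebra_simps power_add)
    moreover have "G0 ^ (k - 1) * G0 = G0 ^ k" using ge(1) by (cases k) (auto simp: mult.commute)
    hence "X * (- of_nat (m * k) * G0 ^ (k - 1)) * G0 = X * (- of_nat (m * k) * G0 ^ k)" by (simp add: mult.assoc)
    moreover have "\<dots> = X ^ (1 + k * a0) * (- of_nat (m * k) * g0 ^ k)"
      unfolding g0 by (simp add: power_mult_distrib power_mult[symmetric] mult_ac)
    ultimately show ?thesis by metis
  qed
  define H where "H = of_nat m0 ^ 2 * (of_nat m * g * (T a (T a g) - T a g) - of_nat (m - 1) * (T a g)\<^sup>2)"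
  have Hs: "X ^ (2 * a + 2 * a0 + 2 * a1) * (H * (g0\<^sup>2 * g1\<^sup>2)) =
      X ^ (2 + k * a0 + l * a1) * (of_nat (m - 1) * of_nat m ^ 2 * g0 ^ k * g1 ^ l)"
  proof -
    have th2: "X\<^sup>2 * pderiv (pderiv G) = X ^ a * (T a (T a g) - T a g)"
    proof -
      have "X * pderiv (X * pderiv G) = X * pderiv G + X\<^sup>2 * pderiv (pderiv G)"
        by (simp add: pderiv_mult dX algebra_simps power2_eq_square)
      thus ?thesis unfolding g theta[OF apos(3)] by (simp add: algebra_simps)
    qed
    have "X\<^sup>2 * (of_nat m0 ^ 2 * (of_nat m * G * pderiv (pderiv G) - of_nat (m - 1) * (pderiv G)\<^sup>2)) * (G0\<^sup>2 * G1\<^sup>2) =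
        of_nat m0 ^ 2 * (of_nat m * G * (X\<^sup>2 * pderiv (pderiv G)) - of_nat (m - 1) * (X * pderiv G)\<^sup>2) * (G0\<^sup>2 * G1\<^sup>2)"
      by (simp add: algebra_simps power_mult_distrib)
    also have "\<dots> = X ^ (2 * a + 2 * a0 + 2 * a1) * (H * (g0\<^sup>2 * g1\<^sup>2))"
    proof -
      have x: "X ^ (2 * a + 2 * a0 + 2 * a1) = X ^ a * X ^ a * (X ^ a0)\<^sup>2 * (X ^ a1)\<^sup>2"
        by (simp add: power_add power2_eq_square mult_2)
      have "of_nat m * G * (X ^ a * (T a (T a g) - T a g)) - of_nat (m - 1) * (X ^ a * T a g)\<^sup>2 =
        X ^ a * X ^ a * (of_nat m * g * (T a (T a g) - T a g) - of_nat (m - 1) * (T a g)\<^sup>2)"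
        unfolding g by (simp add: algebra_simps power2_eq_square)
      moreover have "X * pderiv G = X ^ a * T a g" unfolding g theta[OF apos(3)] ..
      ultimately have "of_nat m0 ^ 2 * (of_nat m * G * (X\<^sup>2 * pderiv (pderiv G)) - of_nat (m - 1) * (X * pderiv G)\<^sup>2) * (G0\<^sup>2 * G1\<^sup>2)
        = of_nat m0 ^ 2 * (X ^ a * X ^ a * (of_nat m * g * (T a (T a g) - T a g) - of_nat (m - 1) * (T a g)\<^sup>2)) *
          ((X ^ a0)\<^sup>2 * g0\<^sup>2 * ((X ^ a1)\<^sup>2 * g1\<^sup>2))"
        unfolding th2 by (simp only: g0 g1 power_mult_distrib)
      thus ?thesis unfolding H_def x by (simp only: mult_ac)
    qed
    finally have "X\<^sup>2 * (of_nat (m - 1) * of_nat m ^ 2 * G0 ^ (k - 2) * G1 ^ (l - 2)) * (G0\<^sup>2 * G1\<^sup>2) =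
      X ^ (2 * a + 2 * a0 + 2 * a1) * (H * (g0\<^sup>2 * g1\<^sup>2))" unfolding hess .
    moreover have "G0 ^ k = G0 ^ (k - 2) * G0\<^sup>2" "G1 ^ l = G1 ^ (l - 2) * G1\<^sup>2"
      using ge by (metis le_add_diff_inverse2 power_add)+
    hence "X\<^sup>2 * (of_nat (m - 1) * of_nat m ^ 2 * G0 ^ (k - 2) * G1 ^ (l - 2)) * (G0\<^sup>2 * G1\<^sup>2) =
      X\<^sup>2 * (of_nat (m - 1) * of_nat m ^ 2 * G0 ^ k * G1 ^ l)" by (simp only: mult_ac)
    moreover have "\<dots> = X ^ (2 + k * a0 + l * a1) * (of_nat (m - 1) * of_nat m ^ 2 * g0 ^ k * g1 ^ l)"
      unfolding g0 g1 power_mult_distrib power_mult[symmetric] power_add by (simp only: mult_ac)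
    ultimately show ?thesis by metis
  qed
  have Syz: "X ^ (k * a0) * g0 ^ k + X ^ (l * a1) * g1 ^ l = X ^ (r * a) * g ^ r"
    using syz unfolding g g0 g1 power_mult_distrib power_mult[symmetric] by (simp add: mult.commute)
  have B0z: "poly B0 z = (of_nat (m0 * a) - of_nat (m * a0)) * poly g z * poly g0 z"
    unfolding B0_def by (simp add: T_z algebra_simps)
  have B1z: "poly B1 z = of_nat l * (of_nat (m1 * a) - of_nat (m * a1)) * poly g z * poly g1 z"
    unfolding B1_def by (simp add: T_z algebra_simps)
  have Hz: "poly H z = of_nat m0 ^ 2 * (of_nat a * (of_nat a - of_nat m)) * (poly g z)\<^sup>2"
  proof -
    have *: "of_nat (m - 1) = of_nat m - (1::complex)" using ge by (simp add: of_nat_diff)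
    show ?thesis unfolding H_def
      by (simp add: T_z del: One_nat_def) (simp only: *, simp add: algebra_simps power2_eq_square)
  qed
  \<comment> \<open>Hence the leading coefficient of the Jacobian of G and G0 vanishes exactly if
    G0^k and G^r have equal order at z.\<close>
  have cross0: "m0 * a = m * a0 \<longleftrightarrow> k * a0 = r * a"
  proof -
    have "k * r * (m0 * a) = N * (r * a)" unfolding N0 by (simp add: mult_ac)
    moreover have "k * r * (m * a0) = N * (k * a0)" unfolding Ninf by (simp add: mult_ac)
    moreover have "k * r > 0" using ge by simp
    ultimately show ?thesis using Npos by (metis mult_left_cancel nat_less_le)
  qed
  have cross1: "m1 * a = m * a1 \<longleftrightarrow> l * a1 = r * a"
  proof -
    have "l * r * (m1 * a) = N * (r * a)" unfolding N1 by (simp add: mult_ac)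
    moreover have "l * r * (m * a1) = N * (l * a1)" unfolding Ninf by (simp add: mult_ac)
    moreover have "l * r > 0" using ge by simp
    ultimately show ?thesis using Npos by (metis mult_left_cancel nat_less_le)
  qed
  have mz: "(of_nat m :: complex) \<noteq> 0" "(of_nat (m - 1) :: complex) \<noteq> 0" "(of_nat k :: complex) \<noteq> 0"
    "(of_nat l :: complex) \<noteq> 0" "(of_nat m0 :: complex) \<noteq> 0"
    using ge Npos by auto
  have E2: "a + a0 + a1 = 1 + l * a1" "B0 * g1 = of_nat m * g1 ^ l" if "k * a0 \<noteq> r * a"
  proof -
    have "of_nat (m0 * a) - of_nat (m * a0) \<noteq> (0::complex)" using that cross0 by (metis right_minus_eq of_nat_eq_iff)
    hence *: "poly (B0 * g1) z \<noteq> 0" using c c0 c1 by (simp only: poly_mult B0z mult_eq_0_iff simp_thms)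
    have "poly (of_nat m * g1 ^ l) z \<noteq> 0" using mz c1 by simp
    from linear_power_eq[OF J0[unfolded X_def] this *]
    show "a + a0 + a1 = 1 + l * a1" "B0 * g1 = of_nat m * g1 ^ l" .
  qed
  have E3: "a + a0 + a1 = 1 + k * a0" if "l * a1 \<noteq> r * a"
  proof -
    have "of_nat (m1 * a) - of_nat (m * a1) \<noteq> (0::complex)" using that cross1 by (metis right_minus_eq of_nat_eq_iff)
    hence *: "poly (B1 * g0) z \<noteq> 0" using c c0 c1 mz by (simp only: poly_mult B1z mult_eq_0_iff simp_thms)
    have "poly (- of_nat (m * k) * g0 ^ k) z \<noteq> 0" using mz c0 by simp
    from linear_power_eq(1)[OF J1[unfolded X_def] this *] show ?thesis .
  qed
  \<comment> \<open>The leading coefficient is lost here, so the left-hand side of \<open>J0\<close>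
    gains at least one order.\<close>
  have E4: "a + a0 + a1 \<le> l * a1" if "k * a0 = r * a"
  proof -
    have "poly (B0 * g1) z = 0" using that cross0 by (simp add: B0z)
    then obtain B' where B': "B0 * g1 = X * B'" unfolding poly_eq_0_iff_dvd X_def by blast
    have "X ^ Suc (a + a0 + a1) * B' = X ^ (1 + l * a1) * (of_nat m * g1 ^ l)"
      using J0 unfolding B' by (simp add: mult_ac)
    moreover have "poly (of_nat m * g1 ^ l) z \<noteq> 0" using mz c1 by simp
    ultimately have "Suc (a + a0 + a1) \<le> 1 + l * a1" unfolding X_def by (rule linear_power_le)
    thus ?thesis by simp
  qed
  have Na: "N * a0 = k * a0 * m0" "N * a1 = l * a1 * m1" "N * a = r * a * m"
    by (simp add: N0 mult_ac, simp add: N1 mult_ac, simp add: Ninf mult_ac)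
  \<comment> \<open>The main case: G0^k and G1^l have a common order v different from that of G^r,
    so their leading terms must cancel in the syzygy.\<close>
  have eq_case: False if v: "k * a0 = l * a1" "k * a0 \<noteq> r * a" and sum: "a + a0 + a1 = 1 + k * a0"
    and E: "a = m \<or> B0 * g1 = of_nat m * g1 ^ l \<and> H * (g0\<^sup>2 * g1\<^sup>2) = of_nat (m - 1) * of_nat m ^ 2 * g0 ^ k * g1 ^ l"
  proof -
    define v where "v = k * a0"
    have v': "v > 0" "int N * int a0 = int v * int m0" "int N * int a1 = int v * int m1"
      using apos ge Na(1,2) v(1) by (auto simp: v_def simp flip: of_nat_mult)
    \<comment> \<open>Were G^r of strictly lowest order in the syzygy, nothing could cancel
      it.\<close>
    have vn: "v < r * a"
    proof (rule ccontr)
      assume "\<not> v < r * a"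
      hence "r * a < v" using v by (simp add: v_def)
      moreover have "X ^ (r * a) * g ^ r + X ^ v * (- (g1 ^ l)) = X ^ v * g0 ^ k"
        using Syz v(1) unfolding v_def by (simp add: algebra_simps)
      moreover have "poly (g ^ r) z \<noteq> 0" using c by simp
      ultimately show False using linear_power_not_sum unfolding X_def by blast
    qed
    \<comment> \<open>Multiplication by N replaces N a0 and N a1 by v m0 and v m1; the degree sum
      then gives N a = N + v (m - 2). Integers allow the subtractions.\<close>
    have "int a = 1 + int v - int a0 - int a1" using sum unfolding v_def by linarith
    hence "int N * int a = int N * (1 + int v) - int v * int m0 - int v * int m1"
      using v'(2,3) by (simp only: right_diff_distrib)
    also have "int m1 = int N + 2 - int m0 - int m" using msum by linarith
    finally have Na': "int N * int a = int N + int v * (int m - 2)"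
      by (simp add: algebra_simps)
    show False
    proof (cases "a = m")
      case True
      have "v < N" using vn True Ninf by simp
      hence "int v * (int m - 2) \<le> int N * (int m - 2)" using ge by (intro mult_right_mono) auto
      hence "int N * int a \<le> int N + int N * (int m - 2)" unfolding Na' by simp
      thus False using True Npos by (simp add: algebra_simps)
    next
      case False
      hence e: "B0 * g1 = of_nat m * g1 ^ l" "H * (g0\<^sup>2 * g1\<^sup>2) = of_nat (m - 1) * of_nat m ^ 2 * g0 ^ k * g1 ^ l"
        using E by auto
      have "X ^ v * (g0 ^ k + g1 ^ l) = X ^ v * (X ^ (r * a - v) * g ^ r)"
        using Syz v(1) vn unfolding v_def by (simp add: algebra_simps flip: power_add)
      hence "g0 ^ k + g1 ^ l = X ^ (r * a - v) * g ^ r" using X_nz by simp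
      hence "poly (g0 ^ k + g1 ^ l) z = 0" using vn X0 by (simp add: power_0_left)
      hence s: "poly g0 z ^ k = - (poly g1 z ^ l)" by (simp add: eq_neg_iff_add_eq_0)
      define \<gamma> \<gamma>0 \<gamma>1 where "\<gamma> = poly g z" and "\<gamma>0 = poly g0 z" and "\<gamma>1 = poly g1 z"
      define d :: complex where "d = of_nat (m0 * a) - of_nat (m * a0)"
      have j: "d * \<gamma> * \<gamma>0 * \<gamma>1 = of_nat m * \<gamma>1 ^ l"
        using arg_cong[OF e(1), of "\<lambda>p. poly p z"] by (simp add: B0z d_def \<gamma>_def \<gamma>0_def \<gamma>1_def)
      have h: "of_nat m0 ^ 2 * (of_nat a * (of_nat a - of_nat m)) * \<gamma>\<^sup>2 * (\<gamma>0\<^sup>2 * \<gamma>1\<^sup>2) =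
          of_nat (m - 1) * of_nat m ^ 2 * \<gamma>0 ^ k * \<gamma>1 ^ l"
        using arg_cong[OF e(2), of "\<lambda>p. poly p z"] by (simp add: Hz \<gamma>_def \<gamma>0_def \<gamma>1_def)
      \<comment> \<open>Because \<gamma>0^k = - \<gamma>1^l, the right-hand side of \<open>h\<close>
        is a negative multiple of a square, and \<open>j\<close> evaluates that square.\<close>
      have "of_nat m0 ^ 2 * (of_nat a * (of_nat a - of_nat m)) * (\<gamma> * \<gamma>0 * \<gamma>1)\<^sup>2 =
         - of_nat (m - 1) * (of_nat m * \<gamma>1 ^ l)\<^sup>2"
        using h s[folded \<gamma>0_def \<gamma>1_def] by (simp add: power_mult_distrib mult_ac power2_eq_square)
      also have "\<dots> = - of_nat (m - 1) * d\<^sup>2 * (\<gamma> * \<gamma>0 * \<gamma>1)\<^sup>2"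
        unfolding j[symmetric] by (simp add: power_mult_distrib mult_ac)
      finally have "of_nat m0 ^ 2 * (of_nat a * (of_nat a - of_nat m)) = - of_nat (m - 1) * d\<^sup>2"
      proof -
        assume *: "of_nat m0 ^ 2 * (of_nat a * (of_nat a - of_nat m)) * (\<gamma> * \<gamma>0 * \<gamma>1)\<^sup>2 =
          - of_nat (m - 1) * d\<^sup>2 * (\<gamma> * \<gamma>0 * \<gamma>1)\<^sup>2"
        have "(\<gamma> * \<gamma>0 * \<gamma>1)\<^sup>2 \<noteq> 0" using c c0 c1 by (simp add: \<gamma>_def \<gamma>0_def \<gamma>1_def)
        with * show ?thesis by (metis mult_right_cancel)
      qed
      hence "complex_of_int (int m0 ^ 2 * (int a * (int a - int m))) =
          complex_of_int (- (int m - 1) * (int m0 * int a - int m * int a0)\<^sup>2)"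
        using ge by (simp add: d_def of_nat_diff)
      hence q: "int m0 ^ 2 * (int a * (int a - int m)) = - (int m - 1) * (int m0 * int a - int m * int a0)\<^sup>2"
        by (simp only: of_int_eq_iff)
      have "int N * (int m0 * int a - int m * int a0) = int m0 * (int N * int a) - int m * (int N * int a0)"
        by (simp add: algebra_simps)
      also have "\<dots> = int m0 * (int N - 2 * int v)"
        unfolding v' Na' by (simp add: algebra_simps)
      finally have w: "int N * (int m0 * int a - int m * int a0) = int m0 * (int N - 2 * int v)" .
      have "int m0 ^ 2 * ((int N * int a) * (int N * int a - int N * int m)) =
          int N ^ 2 * (int m0 ^ 2 * (int a * (int a - int m)))" by (simp add: algebra_simps power2_eq_square)
      also have "\<dots> = - (int m - 1) * (int N * (int m0 * int a - int m * int a0))\<^sup>2"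
        unfolding q by (simp add: power_mult_distrib)
      also have "\<dots> = int m0 ^ 2 * (- (int m - 1) * (int N - 2 * int v)\<^sup>2)"
        unfolding w by (simp add: power_mult_distrib)
      finally have "(int N * int a) * (int N * int a - int N * int m) = - (int m - 1) * (int N - 2 * int v)\<^sup>2"
        using Npos by simp
      \<comment> \<open>After substituting N a, the two sides differ by m^2 v (N - v) up to
        sign.\<close>
      hence "int m ^ 2 * int v * (int N - int v) = 0"
        unfolding Na' by (simp add: algebra_simps power2_eq_square) auto
      hence vN: "v = N" using v' ge by auto
      \<comment> \<open>The value v = N forces a = m - 1 and hence r a < N, against v < r a.\<close>
      have "int N * int a = int N * (int m - 1)" unfolding Na' vN by (simp add: algebra_simps)
      hence "a = m - 1" using Npos ge by simp
      hence "r * a < r * m" using ge by simp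
      thus False using vn vN Ninf by simp
    qed
  qed
  show False
  proof (cases "a = m")
    case True
    have n: "r * a = N" "k * a0 \<le> N" "l * a1 \<le> N"
      using mult_le_mono2[OF ord_le(1), of k] mult_le_mono2[OF ord_le(2), of l]
      unfolding N0[symmetric] N1[symmetric] by (simp_all add: True Ninf)
    show False
    proof (cases "k * a0 = N")
      case k: True
      \<comment> \<open>G and G0 are now constant multiples of the full powers X^m and X^m0. Their
        Jacobian vanishes identically, whereas G1 is not zero.\<close>
      have a0: "a0 = m0" using k N0 ge by simp
      have "degree g = 0" "degree g0 = 0"
      proof -
        have "degree G = a + degree g" "degree G0 = a0 + degree g0"
          unfolding g g0 using nz g g0 by (subst degree_mult_eq; simp add: X_def degree_linear_power)+
        thus "degree g = 0" "degree g0 = 0" using deg True a0 by auto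
      qed
      hence "pderiv g = 0" "pderiv g0 = 0" by (simp_all add: pderiv_eq_0_iff)
      hence "B0 = 0" unfolding B0_def T_def True a0 by (simp add: algebra_simps)
      hence "X ^ (1 + l * a1) * (of_nat m * g1 ^ l) = 0" using J0 by simp
      thus False using X_nz mz c1 by auto
    next
      case k: False
      hence kN: "k * a0 < N" using n by simp
      have "k * a0 = l * a1"
      proof (rule ccontr)
        assume "k * a0 \<noteq> l * a1"
        then consider "k * a0 < l * a1" | "l * a1 < k * a0" by linarith
        thus False
        proof cases
          case 1
          thus False using linear_power_not_sum[OF Syz[unfolded X_def]] c0 kN n by simp
        next
          case 2
          have "X ^ (l * a1) * g1 ^ l + X ^ (k * a0) * g0 ^ k = X ^ (r * a) * g ^ r" using Syz by (simp add: add.commute)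
          thus False using linear_power_not_sum[of z "l * a1" "g1 ^ l" "k * a0" "g0 ^ k" "r * a"] c1 kN n 2
            unfolding X_def by simp
        qed
      qed
      thus False using eq_case E2 kN n True by simp
    qed
  next
    case False
    have "of_nat a - of_nat m \<noteq> (0::complex)" using False by simp
    hence *: "poly (H * (g0\<^sup>2 * g1\<^sup>2)) z \<noteq> 0" using c c0 c1 mz apos by (simp add: Hz)
    have **: "poly (of_nat (m - 1) * of_nat m ^ 2 * g0 ^ k * g1 ^ l) z \<noteq> 0" using mz c0 c1 by simp
    note E1 = linear_power_eq[OF Hs[unfolded X_def] ** *]
    show False
    proof (cases "k * a0 = r * a")
      case k: True
      show False
      proof (cases "l * a1 = r * a")
        case True
        thus False using E1(1) E4[OF k] k by simp
      next
        case False
        thus False using E1(1) E3[OF False] k by simp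
      qed
    next
      case k: False
      have "k * a0 = l * a1" using E1(1) E2(1)[OF k] by simp
      thus False using eq_case E2[OF k] k E1(2) by simp
    qed
  qed
qed

text \<open>The affine chart z = u / v. A zero of the form on the line v = 0 appears as a degree
  below d.\<close>

definition chart :: "nat \<Rightarrow> (complex \<Rightarrow> complex \<Rightarrow> complex) \<Rightarrow> complex poly \<Rightarrow> bool" where
  "chart d P G \<longleftrightarrow> degree G \<le> d \<and> (\<forall>z. poly G z = P z 1) \<and> coeff G d = P 1 0"

lemma chart_exists:
  assumes "homogeneous_poly2 d P" shows "\<exists>G. chart d P G"
proof -
  obtain h where h: "\<And>u v. P u v = (\<Sum>j\<le>d. h j * u ^ (d - j) * v ^ j)"
    using assms unfolding homogeneous_poly2_def by blast
  define G where "G = (\<Sum>j\<le>d. monom (h j) (d - j))"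
  have "degree G \<le> d"
    unfolding G_def by (intro degree_sum_le) (auto intro: order.trans[OF degree_monom_le])
  moreover have "poly G z = P z 1" for z
    unfolding G_def h by (simp add: poly_sum poly_monom)
  moreover have "coeff G d = h 0"
  proof -
    have "coeff G d = (\<Sum>j\<le>d. if j = 0 then h 0 else 0)"
      unfolding G_def coeff_sum by (intro sum.cong) auto
    thus ?thesis by simp
  qed
  moreover have "P 1 0 = h 0"
  proof -
    have "P 1 0 = (\<Sum>j\<le>d. if j = 0 then h 0 else 0)"
      unfolding h by (intro sum.cong) auto
    thus ?thesis by simp
  qed
  ultimately show ?thesis unfolding chart_def by metis
qed

lemma chart_eval:
  assumes "homogeneous_poly2 d P" "chart d P G" "v \<noteq> 0"
  shows "P u v = v ^ d * poly G (u / v)"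
  using homogeneous_poly2_scale[OF assms(1), of v "u / v" 1] assms(2,3) by (simp add: chart_def)

text \<open>The forms enter only through their degrees and the local identities in s, which covers
  the explicit forms and those of \<open>I2\<close> to \<open>I5\<close> alike.\<close>

locale normalised = schwarz_setup +
  fixes P0 P1 Pinf :: "complex \<Rightarrow> complex \<Rightarrow> complex"
  assumes hom0: "homogeneous_poly2 m0 P0" and hom1: "homogeneous_poly2 m1 P1" and hom: "homogeneous_poly2 m Pinf"
    and id0: "\<And>s. s \<in> ball 0 1 \<Longrightarrow> P0 (U s) (V s) = s"
    and id1: "\<And>s. s \<in> ball 0 1 \<Longrightarrow> P1 (U s) (V s) = R s"
    and id: "\<And>s. s \<in> ball 0 1 \<Longrightarrow> Pinf (U s) (V s) = 1"
begin

section \<open>The forms in the chart z = u / v\<close>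

definition G0 where "G0 = (SOME G. chart m0 P0 G)"
definition G1 where "G1 = (SOME G. chart m1 P1 G)"
definition G where "G = (SOME G. chart m Pinf G)"

lemma chart_G0: "chart m0 P0 G0" and chart_G1: "chart m1 P1 G1" and chart_G: "chart m Pinf G"
  unfolding G0_def G1_def G_def
  using someI_ex[OF chart_exists[OF hom0]] someI_ex[OF chart_exists[OF hom1]] someI_ex[OF chart_exists[OF hom]] .

lemmas eval0 = chart_eval[OF hom0 chart_G0] and eval1 = chart_eval[OF hom1 chart_G1]
  and eval = chart_eval[OF hom chart_G]

lemma P_at_0: "P0 1 0 = 0" "P1 1 0 = 1" "Pinf 1 0 = 1"
  using id0[of 0] id1[of 0] id[of 0] by (simp_all add: U_0 V_0 R_0)

text \<open>Pinf(1, 0) = 1, so all zeros of Pinf lie in the finite part of the chart.\<close>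

lemma G_monic: "degree G = m" "lead_coeff G = 1" "G \<noteq> 0"
proof -
  have "coeff G m = 1" "degree G \<le> m" using chart_G P_at_0 by (auto simp: chart_def)
  thus "degree G = m" "lead_coeff G = 1" "G \<noteq> 0"
    by (metis le_antisym le_degree zero_neq_one, metis le_antisym le_degree zero_neq_one, metis coeff_0 zero_neq_one)
qed

text \<open>The part of the disc seen by the chart z = u / v; the point s = 0 corresponds to z =
  infinity.\<close>

definition \<Omega> where "\<Omega> = {s \<in> ball 0 1. V s \<noteq> 0}"

lemma open_Omega: "open \<Omega>"
proof -
  have "continuous_on (ball 0 1) V" by (intro holomorphic_on_imp_continuous_on V_holo)
  hence "open (ball 0 1 \<inter> V -` (- {0}))" by (rule continuous_open_preimage) auto
  moreover have "\<Omega> = ball 0 1 \<inter> V -` (- {0})" by (auto simp: \<Omega>_def)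
  ultimately show ?thesis by simp
qed

lemma eventually_Omega: "\<forall>\<^sub>F s in at 0. s \<in> \<Omega>"
proof -
  have "(V has_field_derivative 1) (at 0)" using V_deriv[of 0] by (simp add: V1_0)
  hence "(\<lambda>s. V s / s) \<midarrow>0\<rightarrow> 1" by (simp add: DERIV_def V_0)
  hence "\<forall>\<^sub>F s in at 0. V s / s \<noteq> 0" by (rule tendsto_imp_eventually_ne) simp
  hence "\<forall>\<^sub>F s in at 0. V s \<noteq> 0" by eventually_elim auto
  moreover have "\<forall>\<^sub>F s in at 0. s \<in> ball (0::complex) 1"
    by (intro eventually_at_in_open') auto
  ultimately show ?thesis by eventually_elim (auto simp: \<Omega>_def)
qed

lemma ratio_at_infinity: "filterlim (\<lambda>s. U s / V s) at_infinity (at 0)"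
proof (rule filterlim_divide_at_infinity)
  have "isCont U 0" by (rule DERIV_isCont[OF U_deriv]) simp
  thus "(U \<longlongrightarrow> 1) (at 0)" using U_0 by (simp add: isCont_def)
  have "isCont V 0" by (rule DERIV_isCont[OF V_deriv]) simp
  hence "(V \<longlongrightarrow> 0) (at 0)" using V_0 by (simp add: isCont_def)
  moreover have "\<forall>\<^sub>F s in at 0. V s \<noteq> 0" using eventually_Omega by eventually_elim (auto simp: \<Omega>_def)
  ultimately show "filterlim V (at 0) (at 0)" by (simp add: filterlim_at)
qed simp

text \<open>The ratio \<open>U / V\<close> tends to infinity, so it takes infinitely many values.\<close>

lemma poly_eq_on_ratio:
  assumes "\<And>s. s \<in> \<Omega> \<Longrightarrow> poly A (U s / V s) = poly B (U s / V s)"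
  shows "A = B"
proof (rule ccontr)
  assume "A \<noteq> B"
  hence "finite {z. poly (A - B) z = 0}" by (intro poly_roots_finite) simp
  then obtain b where "\<forall>z\<in>{z. poly (A - B) z = 0}. norm z \<le> b"
    using finite_imp_bounded bounded_iff[of "{z. poly (A - B) z = 0}"] by blast
  hence b: "norm z \<le> b" if "poly (A - B) z = 0" for z using that by blast
  have "\<forall>\<^sub>F s in at 0. b + 1 \<le> norm (U s / V s)"
    using filterlim_at_infinity_imp_norm_at_top[OF ratio_at_infinity] unfolding filterlim_at_top by blast
  hence "\<forall>\<^sub>F s in at 0. s \<in> \<Omega> \<and> b + 1 \<le> norm (U s / V s)"
    using eventually_Omega by (rule eventually_conj[rotated])
  then obtain s where s: "s \<in> \<Omega>" "b + 1 \<le> norm (U s / V s)"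
    using eventually_happens'[OF at_neq_bot] by blast
  thus False using assms[OF s(1)] b[of "U s / V s"] by simp
qed

definition Z where "Z s = U s / V s"
definition Wr where "Wr s = U s * V1 s - U1 s * V s"

context
  fixes s assumes s: "s \<in> \<Omega>"
begin

lemma Omega_mem: "s \<in> ball 0 1" "V s \<noteq> 0" using s by (auto simp: \<Omega>_def)

lemma Wr_R: "Wr s * R s ^ (l - 1) = 1" unfolding Wr_def by (rule wronskian[OF Omega_mem(1)])

lemma DERIV_inverse_V: "((\<lambda>s. inverse (V s)) has_field_derivative - (V1 s * (inverse (V s))\<^sup>2)) (at s)"
  using DERIV_inverse'[OF V_deriv[OF Omega_mem(1)] Omega_mem(2)] by (simp add: power2_eq_square mult_ac)

lemma DERIV_Z: "(Z has_field_derivative - (Wr s * (inverse (V s))\<^sup>2)) (at s)"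
  unfolding Z_def[abs_def] using DERIV_divide[OF U_deriv[OF Omega_mem(1)] V_deriv[OF Omega_mem(1)] Omega_mem(2)]
  by (rule DERIV_cong) (use Omega_mem(2) in \<open>simp add: Wr_def field_simps power2_eq_square\<close>)

lemma pderiv_chart:
  assumes A: "\<And>s. s \<in> \<Omega> \<Longrightarrow> poly A (Z s) = f s" and f: "(f has_field_derivative f') (at s)"
  shows "poly (pderiv A) (Z s) * (Wr s * (inverse (V s))\<^sup>2) = - f'"
proof -
  have "((\<lambda>s. poly A (Z s)) has_field_derivative poly (pderiv A) (Z s) * - (Wr s * (inverse (V s))\<^sup>2)) (at s)"
    by (rule DERIV_chain2[OF poly_DERIV DERIV_Z])
  moreover have "((\<lambda>s. poly A (Z s)) has_field_derivative f') (at s)"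
    using has_field_derivative_transform_within_open[OF f open_Omega s] A by simp
  ultimately show ?thesis using DERIV_unique by fastforce
qed

end

text \<open>Homogeneity with scaling factor 1 / V: for instance Pinf(U, V) = 1 gives Pinf(U / V, 1)
  = V^(-m).\<close>

lemma chart_values:
  assumes "s \<in> \<Omega>"
  shows "poly G (Z s) = inverse (V s) ^ m" "poly G0 (Z s) = s * inverse (V s) ^ m0"
    "poly G1 (Z s) = R s * inverse (V s) ^ m1"
  using assms id[of s] id0[of s] id1[of s] unfolding eval eval0 eval1 Z_def \<Omega>_def
  by (auto simp: eval eval0 eval1 field_simps)

text \<open>Differentiation of G(Z) = V^(-m) with Z' = - Wr / V^2; by Abel's identity the factor 1 /
  Wr is R^(l-1).\<close>

lemma pderiv_G:
  assumes s: "s \<in> \<Omega>"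
  shows "poly (pderiv G) (Z s) = of_nat m * (V1 s * R s ^ (l - 1)) * inverse (V s) ^ (m - 1)"
proof -
  define I where "I = inverse (V s)"
  have I: "I \<noteq> 0" using s by (auto simp: \<Omega>_def I_def)
  have "((\<lambda>s. inverse (V s) ^ m) has_field_derivative of_nat m * (I ^ (m - 1) * - (V1 s * I\<^sup>2))) (at s)"
    using DERIV_power[OF DERIV_inverse_V[OF s], of m] unfolding I_def by (simp add: mult_ac)
  from pderiv_chart[OF s chart_values(1) this] have
    "poly (pderiv G) (Z s) * Wr s = of_nat m * V1 s * I ^ (m - 1)"
    using I unfolding I_def[symmetric] by (simp add: mult_ac)
  hence "poly (pderiv G) (Z s) * (Wr s * R s ^ (l - 1)) = of_nat m * (V1 s * R s ^ (l - 1)) * I ^ (m - 1)"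
    by (simp add: mult_ac)
  thus ?thesis unfolding Wr_R[OF s] I_def by simp
qed

section \<open>The relations between the forms, derived from the local identities\<close>

lemma chart_syzygy: "G0 ^ k + G1 ^ l = G ^ r"
proof (rule poly_eq_on_ratio)
  fix s assume s: "s \<in> \<Omega>"
  have "poly (G0 ^ k + G1 ^ l) (Z s) = s ^ k * inverse (V s) ^ N + R s ^ l * inverse (V s) ^ N"
    using N0 N1 by (simp add: chart_values[OF s] power_mult_distrib power_mult[symmetric] mult.commute)
  also have "\<dots> = poly (G ^ r) (Z s)"
    using s R_power[of s] Ninf
    by (simp add: chart_values[OF s] power_mult[symmetric] \<Omega>_def mult.commute[of m] flip: distrib_right)
  finally show "poly (G0 ^ k + G1 ^ l) (U s / V s) = poly (G ^ r) (U s / V s)" unfolding Z_def .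
qed

text \<open>At z = U / V the terms with V' cancel, and the reciprocal Wronskian R^(l-1) is
  left.\<close>

lemma chart_jac0: "of_nat m0 * pderiv G * G0 - of_nat m * G * pderiv G0 = of_nat m * G1 ^ (l - 1)"
proof (rule poly_eq_on_ratio, fold Z_def)
  fix s assume s: "s \<in> \<Omega>"
  define I where "I = inverse (V s)"
  define g0' where "g0' = poly (pderiv G0) (Z s)"
  define E where "E = R s ^ (l - 1)"
  have I: "I \<noteq> 0" using s by (auto simp: \<Omega>_def I_def)
  obtain j where m: "m = Suc j" using m_ge by (cases m) auto
  obtain j0 where m0: "m0 = Suc j0" using m0_ge by (cases m0) auto
  have "((\<lambda>s. s * inverse (V s) ^ m0) has_field_derivative I ^ m0 + s * (of_nat m0 * (I ^ (m0 - 1) * - (V1 s * I\<^sup>2)))) (at s)"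
    using DERIV_mult[OF DERIV_ident DERIV_power[OF DERIV_inverse_V[OF s], of m0]] unfolding I_def by (simp add: mult_ac)
  from pderiv_chart[OF s chart_values(2) this]
  have g0': "g0' * (Wr s * I\<^sup>2) = - (I ^ m0) + of_nat m0 * s * V1 s * I ^ m0 * I"
    unfolding g0'_def I_def[symmetric] by (simp add: m0 power2_eq_square algebra_simps)
  have W: "Wr s * E = 1" using Wr_R[OF s] by (simp add: E_def)
  have "I\<^sup>2 * (of_nat m0 * (of_nat m * (V1 s * E) * I ^ (m - 1)) * (s * I ^ m0) - of_nat m * I ^ m * g0') =
     E * (of_nat m0 * of_nat m * V1 s * I ^ (m - 1) * s * I ^ m0 * I\<^sup>2) - of_nat m * I ^ m * E * (g0' * (Wr s * I\<^sup>2))"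
    using W by (simp add: algebra_simps)
  also have "\<dots> = of_nat m * E * I ^ (m + m0)"
    unfolding g0' by (simp add: m power2_eq_square power_add algebra_simps)
  also have "\<dots> = I\<^sup>2 * (of_nat m * (R s * I ^ m1) ^ (l - 1))"
  proof -
    have "I ^ (m + m0) = I ^ (m1 * (l - 1)) * I\<^sup>2" using expo_jac0 by (simp flip: power_add add: add.commute)
    thus ?thesis by (simp add: E_def power_mult_distrib power_mult[symmetric] mult_ac)
  qed
  finally show "poly (of_nat m0 * pderiv G * G0 - of_nat m * G * pderiv G0) (Z s) = poly (of_nat m * G1 ^ (l - 1)) (Z s)"
    using I by (simp add: pderiv_G[OF s] chart_values[OF s] I_def[symmetric] E_def[symmetric] g0'_def[symmetric] del: One_nat_def)
qed

text \<open>The same cancellation of V'; what is left is the derivative of R times R^(l-1), a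
  multiple of s^(k-1).\<close>

lemma chart_jac1: "of_nat l * (of_nat m1 * pderiv G * G1 - of_nat m * G * pderiv G1) = - of_nat (m * k) * G0 ^ (k - 1)"
proof (rule poly_eq_on_ratio, fold Z_def)
  fix s assume s: "s \<in> \<Omega>"
  define I where "I = inverse (V s)"
  define g1' where "g1' = poly (pderiv G1) (Z s)"
  define E where "E = R s ^ (l - 1)"
  define R' where "R' = - (of_nat k / of_nat l * s ^ (k - 1)) / R s ^ (l - 1)"
  have sb: "s \<in> ball 0 1" using s by (auto simp: \<Omega>_def)
  have I: "I \<noteq> 0" using s by (auto simp: \<Omega>_def I_def)
  obtain j where m: "m = Suc j" using m_ge by (cases m) auto
  obtain j1 where m1: "m1 = Suc j1" using m1_ge by (cases m1) auto
  have "((\<lambda>s. R s * inverse (V s) ^ m1) has_field_derivative R' * I ^ m1 + R s * (of_nat m1 * (I ^ (m1 - 1) * - (V1 s * I\<^sup>2)))) (at s)"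
    using DERIV_mult[OF R_deriv[OF sb] DERIV_power[OF DERIV_inverse_V[OF s], of m1]] unfolding I_def R'_def by (simp add: mult_ac)
  from pderiv_chart[OF s chart_values(3) this]
  have g1': "g1' * (Wr s * I\<^sup>2) = - (R' * I ^ m1) + of_nat m1 * R s * V1 s * I ^ m1 * I"
    unfolding g1'_def I_def[symmetric] by (simp add: m1 power2_eq_square algebra_simps)
  have W: "Wr s * E = 1" using Wr_R[OF s] by (simp add: E_def)
  have RE: "R' * E = - (of_nat k / of_nat l * s ^ (k - 1))"
    unfolding R'_def E_def using R_nz[OF sb] by simp
  have "I\<^sup>2 * (of_nat m1 * (of_nat m * (V1 s * E) * I ^ (m - 1)) * (R s * I ^ m1) - of_nat m * I ^ m * g1') =
     E * (of_nat m1 * of_nat m * V1 s * I ^ (m - 1) * R s * I ^ m1 * I\<^sup>2) - of_nat m * I ^ m * E * (g1' * (Wr s * I\<^sup>2))"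
    using W by (simp add: algebra_simps)
  also have "\<dots> = of_nat m * (R' * E) * I ^ (m + m1)"
    unfolding g1' by (simp add: m power2_eq_square power_add algebra_simps)
  also have "\<dots> = I\<^sup>2 * (- (of_nat m * of_nat k / of_nat l) * (s * I ^ m0) ^ (k - 1))"
  proof -
    have "I ^ (m + m1) = I ^ (m0 * (k - 1)) * I\<^sup>2" using expo_jac1 by (simp flip: power_add add: add.commute)
    thus ?thesis unfolding RE by (simp add: power_mult_distrib power_mult[symmetric] mult_ac)
  qed
  finally have "of_nat m1 * (of_nat m * (V1 s * E) * I ^ (m - 1)) * (R s * I ^ m1) - of_nat m * I ^ m * g1' =
     - (of_nat m * of_nat k / of_nat l) * (s * I ^ m0) ^ (k - 1)"
    by (rule mult_left_cancel[THEN iffD1, rotated]) (use I in simp)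
  hence "of_nat l * (of_nat m1 * (of_nat m * (V1 s * E) * I ^ (m - 1)) * (R s * I ^ m1) - of_nat m * I ^ m * g1') =
     - (of_nat m * of_nat k) * (s * I ^ m0) ^ (k - 1)"
    using lpos by simp
  thus "poly (of_nat l * (of_nat m1 * pderiv G * G1 - of_nat m * G * pderiv G1)) (Z s) =
      poly (- of_nat (m * k) * G0 ^ (k - 1)) (Z s)"
    by (simp add: pderiv_G[OF s] chart_values[OF s] I_def[symmetric] E_def[symmetric] g1'_def[symmetric] del: One_nat_def)
qed

text \<open>Up to a power of V the derivative of G is m V' R^(l-1), so differentiating it once more
  brings in the equation of V.\<close>

lemma chart_hess: "of_nat m0 ^ 2 * (of_nat m * G * pderiv (pderiv G) - of_nat (m - 1) * (pderiv G)\<^sup>2) =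
      of_nat (m - 1) * of_nat m ^ 2 * G0 ^ (k - 2) * G1 ^ (l - 2)"
proof (rule poly_eq_on_ratio, fold Z_def)
  fix s assume s: "s \<in> \<Omega>"
  define I where "I = inverse (V s)"
  define g2 where "g2 = poly (pderiv (pderiv G)) (Z s)"
  define j where "j = I ^ (m - 2)"
  define y where "y = V1 s * R s ^ (l - 1)"
  define q where "q = R s ^ (l - 2)"
  define M where "M = complex_of_nat m"
  define M1 where "M1 = complex_of_nat (m - 1)"
  define R' where "R' = - (of_nat k / of_nat l * s ^ (k - 1)) / R s ^ (l - 1)"
  have sb: "s \<in> ball 0 1" using s by (auto simp: \<Omega>_def)
  have I: "I \<noteq> 0" "V s * I = 1" using s by (auto simp: \<Omega>_def I_def)
  have jm: "I ^ (m - 1) = j * I" "I ^ m = j * I * I" "I ^ (m - 1 - 1) = j"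
    unfolding j_def using m_ge by (metis Suc_diff_Suc Suc_1 Suc_le_lessD power_Suc2,
      metis (no_types, lifting) le_add_diff_inverse2 power2_eq_square power_add mult.assoc, simp add: numeral_2_eq_2)
  have qR: "R s ^ (l - 1) = q * R s" "R s ^ l = q * R s * R s" "R s ^ (l - 1 - 1) = q"
    unfolding q_def using l2 by (metis Suc_diff_Suc Suc_1 Suc_le_lessD power_Suc2,
      metis (no_types, lifting) le_add_diff_inverse2 power2_eq_square power_add mult.assoc, simp add: numeral_2_eq_2)
  define y' where "y' = V2 s * R s ^ (l - 1) + V1 s * (of_nat (l - 1) * (q * R'))"
  have dy: "((\<lambda>s. V1 s * R s ^ (l - 1)) has_field_derivative y') (at s)"
    using DERIV_mult[OF V1_deriv[OF sb] DERIV_power[OF R_deriv[OF sb], of "l - 1"]]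
    unfolding y'_def R'_def q_def by (rule DERIV_cong) (simp add: numeral_2_eq_2 mult_ac)
  \<comment> \<open>The equation of V in self-adjoint form, with V' R^(l-1) as the quantity
    differentiated.\<close>
  have y'R: "y' * R s = Lcoef * s ^ (k - 2) * V s"
  proof -
    have e: "ecoef = of_nat (l - 1) * (of_nat k / of_nat l)"
      unfolding ecoef_def using lpos by (simp add: of_nat_diff field_simps)
    have RE: "R' * (q * R s) = - (of_nat k / of_nat l * s ^ (k - 1))"
      unfolding R'_def qR(1)[symmetric] using R_nz[OF sb] by simp
    have "y' * R s = V2 s * R s ^ l + V1 s * of_nat (l - 1) * (R' * (q * R s))"
      unfolding y'_def qR by (simp add: algebra_simps)
    also have "\<dots> = (1 - s ^ k) * V2 s - ecoef * s ^ (k - 1) * V1 s"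
      unfolding RE R_power[OF sb] e by (simp add: algebra_simps)
    finally show ?thesis unfolding V_ode[OF sb] .
  qed
  obtain i where m: "m = Suc (Suc i)" using m_ge by (metis Suc_le_D numeral_2_eq_2 Suc_le_mono)
  have "((\<lambda>s. of_nat m * (V1 s * R s ^ (l - 1)) * inverse (V s) ^ (m - 1)) has_field_derivative
      M * y' * I ^ (m - 1) + M * y * (M1 * (j * - (V1 s * I\<^sup>2)))) (at s)"
    using DERIV_mult[OF DERIV_cmult[OF dy, of "of_nat m"] DERIV_power[OF DERIV_inverse_V[OF s], of "m - 1"]]
    by (rule DERIV_cong) (simp add: M_def M1_def y_def j_def I_def m mult_ac del: of_nat_Suc)
  from pderiv_chart[OF s pderiv_G this]
  have g2: "g2 * (Wr s * I\<^sup>2) = - (M * y' * (j * I)) + M * y * M1 * j * V1 s * I\<^sup>2"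
    unfolding g2_def I_def[symmetric] jm by (simp add: algebra_simps)
  have W: "Wr s * (q * R s) = 1" using Wr_R[OF s] unfolding qR(1) .
  have yW: "y = V1 s * (q * R s)" unfolding y_def qR(1) ..
  have "I\<^sup>2 * (M * (j * I * I) * g2 - M1 * (M * y * (j * I))\<^sup>2) =
     M * (j * I * I) * (g2 * (Wr s * I\<^sup>2)) * (q * R s) - M1 * (M * y * (j * I))\<^sup>2 * I\<^sup>2"
    using W by (simp add: algebra_simps)
  also have "\<dots> = - (M * M * j * j * I ^ 3 * q * (y' * R s))"
    unfolding g2 yW by (simp add: algebra_simps power2_eq_square power3_eq_cube)
  also have "\<dots> = - (M * M * j * j * I ^ 2 * q * (Lcoef * s ^ (k - 2)) * (V s * I))"
    unfolding y'R by (simp add: power2_eq_square power3_eq_cube)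
  also have "\<dots> = I\<^sup>2 * (- (M * M * j * j * q * Lcoef * s ^ (k - 2)))"
    unfolding I(2) by simp
  finally have "M * (j * I * I) * g2 - M1 * (M * y * (j * I))\<^sup>2 = - (M * M * j * j * q * Lcoef * s ^ (k - 2))"
    by (rule mult_left_cancel[THEN iffD1, rotated]) (use I in simp)
  \<comment> \<open>The constant of the Hessian relation is \<open>Lcoef\<close> = - (m - 1) /
    m0^2.\<close>
  hence "of_nat m0 ^ 2 * (M * (j * I * I) * g2 - M1 * (M * y * (j * I))\<^sup>2) = M1 * M\<^sup>2 * (j * j) * q * s ^ (k - 2)"
    using m0_ge by (simp add: Lcoef_eq M1_def power2_eq_square)
  also have "j * j = I ^ (m0 * (k - 2)) * I ^ (m1 * (l - 2))"
    unfolding j_def power_add[symmetric] expo_hess by (simp add: mult_2)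
  finally have fin: "of_nat m0 ^ 2 * (M * (j * I * I) * g2 - M1 * (M * y * (j * I))\<^sup>2) =
    M1 * M\<^sup>2 * (I ^ (m0 * (k - 2)) * I ^ (m1 * (l - 2))) * q * s ^ (k - 2)" .
  have pd: "poly (pderiv G) (Z s) = M * y * (j * I)"
    unfolding pderiv_G[OF s] M_def y_def I_def[symmetric] jm(1) ..
  have vG: "poly G (Z s) = j * I * I"
    unfolding chart_values(1)[OF s] I_def[symmetric] jm(2) ..
  show "poly (of_nat m0 ^ 2 * (of_nat m * G * pderiv (pderiv G) - of_nat (m - 1) * (pderiv G)\<^sup>2)) (Z s) =
      poly (of_nat (m - 1) * of_nat m ^ 2 * G0 ^ (k - 2) * G1 ^ (l - 2)) (Z s)"
    using fin by (simp add: pd chart_values(2,3)[OF s] vG I_def[symmetric] g2_def[symmetric]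
        M_def M1_def q_def power_mult_distrib power_mult[symmetric] mult_ac)
qed

lemma G0_nz: "G0 \<noteq> 0" and G1_nz: "G1 \<noteq> 0"
proof -
  obtain s where s: "s \<in> \<Omega>" "s \<noteq> 0"
    using eventually_happens'[OF at_neq_bot eventually_conj[OF eventually_Omega eventually_neq_at_within]] by blast
  have "V s \<noteq> 0" "s \<in> ball 0 1" using s by (auto simp: \<Omega>_def)
  thus "G0 \<noteq> 0" "G1 \<noteq> 0" using chart_values[OF s(1)] s(2) R_nz[of s] by auto
qed

lemma no_common_zero: "poly G z = 0 \<Longrightarrow> poly G0 z \<noteq> 0"
  using no_common_root[OF k2 l2 r2 m_ge N0 N1 Ninf msum _ _ _ G0_nz G1_nz G_monic(3) chart_syzygy chart_jac0 chart_jac1 chart_hess]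
    chart_G0 chart_G1 chart_G unfolding chart_def by blast

lemma syzygy: "P0 u v ^ k + P1 u v ^ l = Pinf u v ^ r"
proof (cases "v = 0")
  case False
  have "P0 u v ^ k + P1 u v ^ l = v ^ N * poly (G0 ^ k + G1 ^ l) (u / v)"
    using N0 N1 by (simp add: eval0[OF False] eval1[OF False] power_mult_distrib power_mult[symmetric] mult.commute algebra_simps)
  thus ?thesis unfolding chart_syzygy using Ninf
    by (simp add: eval[OF False] power_mult_distrib power_mult[symmetric] mult.commute)
next
  case True
  have "P0 u 0 = 0" "P1 u 0 = u ^ m1" "Pinf u 0 = u ^ m"
    using homogeneous_poly2_scale[OF hom0, of u 1 0] homogeneous_poly2_scale[OF hom1, of u 1 0]
      homogeneous_poly2_scale[OF hom, of u 1 0] P_at_0 by simp_all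
  thus ?thesis using True kpos N1 Ninf by (simp add: power_mult[symmetric] mult.commute power_0_left)
qed

lemma P0_on_axis: "P0 u 0 = 0"
  using homogeneous_poly2_scale[OF hom0, of u 1 0] P_at_0 by simp

lemma common_zero_trivial:
  assumes "Pinf u v = 0" "P0 u v = 0"
  shows "u = 0 \<and> v = 0"
proof (cases "v = 0")
  case True
  have "Pinf u 0 = u ^ m" using homogeneous_poly2_scale[OF hom, of u 1 0] P_at_0 by simp
  thus ?thesis using True assms m_ge by auto
next
  case False
  thus ?thesis using assms no_common_zero[of "u / v"] by (simp add: eval eval0)
qed

end

section \<open>Analytic continuation\<close>

text \<open>H stands for any expression that preserves holomorphy, in practice a polynomial in x and
  the two continued functions, or a quotient of such.\<close>

lemma continuation_compose:
  assumes f: "continuation_along \<gamma> f" and g: "continuation_along \<gamma> g"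
    and H: "\<And>f g S. open S \<Longrightarrow> f holomorphic_on S \<Longrightarrow> g holomorphic_on S \<Longrightarrow> (\<lambda>x. H x (f x) (g x)) holomorphic_on S"
  shows "continuation_along \<gamma> (\<lambda>t x. H x (f t x) (g t x))"
  unfolding continuation_along_def
proof
  fix t :: real assume t: "t \<in> {0..1}"
  obtain r1 d1 where 1: "r1 > 0" "d1 > 0" "f t holomorphic_on ball (\<gamma> t) r1"
    "\<And>s. s \<in> {0..1} \<Longrightarrow> \<bar>s - t\<bar> < d1 \<Longrightarrow> \<gamma> s \<in> ball (\<gamma> t) r1 \<and> (\<forall>\<^sub>F z in nhds (\<gamma> s). f s z = f t z)"
    using f t unfolding continuation_along_def by blast
  obtain r2 d2 where 2: "r2 > 0" "d2 > 0" "g t holomorphic_on ball (\<gamma> t) r2"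
    "\<And>s. s \<in> {0..1} \<Longrightarrow> \<bar>s - t\<bar> < d2 \<Longrightarrow> \<gamma> s \<in> ball (\<gamma> t) r2 \<and> (\<forall>\<^sub>F z in nhds (\<gamma> s). g s z = g t z)"
    using g t unfolding continuation_along_def by blast
  have hol: "f t holomorphic_on ball (\<gamma> t) (min r1 r2)" "g t holomorphic_on ball (\<gamma> t) (min r1 r2)"
    using 1(3) 2(3) by (auto elim!: holomorphic_on_subset)
  show "\<exists>r>0. \<exists>d>0. (\<lambda>x. H x (f t x) (g t x)) holomorphic_on ball (\<gamma> t) r \<and>
        (\<forall>s\<in>{0..1}. \<bar>s - t\<bar> < d \<longrightarrow> \<gamma> s \<in> ball (\<gamma> t) r \<and>
           (\<forall>\<^sub>F z in nhds (\<gamma> s). H z (f s z) (g s z) = H z (f t z) (g t z)))"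
  proof (rule exI[of _ "min r1 r2"], rule conjI[rotated], rule exI[of _ "min d1 d2"], intro conjI ballI impI)
    fix s :: real assume s: "s \<in> {0..1}" "\<bar>s - t\<bar> < min d1 d2"
    show "\<gamma> s \<in> ball (\<gamma> t) (min r1 r2)" using 1(4)[of s] 2(4)[of s] s by auto
    have "\<forall>\<^sub>F z in nhds (\<gamma> s). f s z = f t z" "\<forall>\<^sub>F z in nhds (\<gamma> s). g s z = g t z"
      using 1(4)[of s] 2(4)[of s] s by auto
    thus "\<forall>\<^sub>F z in nhds (\<gamma> s). H z (f s z) (g s z) = H z (f t z) (g t z)"
      by eventually_elim simp
  qed (use 1 2 hol H in auto)
qed

text \<open>Vanishing of the germ is a locally constant property of the time: germs at nearby times
  come from one function holomorphic on a ball, where the identity theorem applies.\<close>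

lemma continuation_zero:
  assumes f: "continuation_along \<gamma> f" and z: "\<forall>\<^sub>F z in nhds (\<gamma> 0). f 0 z = 0" and t: "t \<in> {0..1}"
  shows "f t (\<gamma> t) = 0"
proof -
  define A where "A = (\<lambda>t. \<forall>\<^sub>F z in nhds (\<gamma> t). f t z = 0)"
  have "A constant_on {0..1}"
  proof (rule locally_constant_imp_constant)
    fix t :: real assume t: "t \<in> {0..1}"
    obtain r d where rd: "r > 0" "d > 0" "f t holomorphic_on ball (\<gamma> t) r"
      "\<And>s. s \<in> {0..1} \<Longrightarrow> \<bar>s - t\<bar> < d \<Longrightarrow> \<gamma> s \<in> ball (\<gamma> t) r \<and> (\<forall>\<^sub>F z in nhds (\<gamma> s). f s z = f t z)"
      using f t unfolding continuation_along_def by blast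
    have "A s = A t" if s: "s \<in> {0..1}" "\<bar>s - t\<bar> < d" for s
    proof -
      have gs: "\<gamma> s \<in> ball (\<gamma> t) r" and eq: "\<forall>\<^sub>F z in nhds (\<gamma> s). f s z = f t z" using rd(4)[OF s] by auto
      have spread: "\<forall>\<^sub>F z in nhds y. f t z = 0"
        if "\<forall>\<^sub>F z in nhds x. f t z = 0" "x \<in> ball (\<gamma> t) r" "y \<in> ball (\<gamma> t) r" for x y
      proof -
        have "\<forall>\<^sub>F z in nhds y. z \<in> ball (\<gamma> t) r" using that(3) by (intro eventually_nhds_in_open) auto
        thus ?thesis
        proof eventually_elim
          case (elim z)
          show ?case by (rule holomorphic_zero_on_ball[OF rd(3) _ _ that(2,1) elim]) auto
        qed
      qed
      have "A s \<longleftrightarrow> (\<forall>\<^sub>F z in nhds (\<gamma> s). f t z = 0)"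
        unfolding A_def by (rule eventually_subst) (use eq in \<open>auto elim: eventually_mono\<close>)
      also have "\<dots> \<longleftrightarrow> A t"
      proof -
        have "\<gamma> t \<in> ball (\<gamma> t) r" using rd(1) by simp
        thus ?thesis unfolding A_def using spread gs by blast
      qed
      finally show ?thesis .
    qed
    moreover have "openin (top_of_set {0..1}) ({0..1} \<inter> ball t d)" by auto
    moreover have "\<forall>s\<in>{0..1} \<inter> ball t d. A s = A t"
      using calculation(1) by (auto simp: dist_real_def abs_minus_commute)
    moreover have "t \<in> {0..1} \<inter> ball t d" using t rd(2) by simp
    ultimately show "\<exists>T. openin (top_of_set {0..1}) T \<and> t \<in> T \<and> (\<forall>s\<in>T. A s = A t)"
      by meson
  qed simp
  hence "A t = A 0" using t unfolding constant_on_def by force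
  hence "A t" using z by (simp add: A_def)
  thus ?thesis unfolding A_def by (rule eventually_nhds_x_imp_x)
qed

text \<open>The same graph for arbitrary initial functions, so that the two solutions may be
  exchanged and rewritten on the slit disc.\<close>

definition asch_germ :: "(complex \<Rightarrow> complex) \<Rightarrow> (complex \<Rightarrow> complex) \<Rightarrow> (complex \<times> complex \<times> complex) set" where
  "asch_germ u v = {(x, p, q). \<exists>\<gamma> f g.
     path \<gamma> \<and> path_image \<gamma> \<subseteq> - {0, 1} \<and> pathstart \<gamma> \<in> slit_disc \<and> pathfinish \<gamma> = x \<and>
     continuation_along \<gamma> f \<and> (\<forall>\<^sub>F z in nhds (pathstart \<gamma>). f 0 z = u z) \<and>
     continuation_along \<gamma> g \<and> (\<forall>\<^sub>F z in nhds (pathstart \<gamma>). g 0 z = v z) \<and>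
     p = f 1 x \<and> q = g 1 x}"

lemma asch_eq_germ: "asch a b c = asch_germ (hyp_u a b c) (hyp_v a b c)"
  unfolding asch_def asch_germ_def ..

lemma asch_germ_swap: "(x, p, q) \<in> asch_germ u v \<longleftrightarrow> (x, q, p) \<in> asch_germ v u"
  unfolding asch_germ_def by auto

lemma open_slit_disc: "open slit_disc"
  unfolding slit_disc_def by (intro open_Diff) auto

text \<open>The source of every inclusion of the image in a curve and of every formula for x: an
  equation need only be checked on the slit disc.\<close>

lemma asch_germ_permanence:
  assumes xpq: "(x, p, q) \<in> asch_germ u v"
    and H: "\<And>f g S. open S \<Longrightarrow> f holomorphic_on S \<Longrightarrow> g holomorphic_on S \<Longrightarrow> (\<lambda>x. H x (f x) (g x)) holomorphic_on S"
    and init: "\<And>x. x \<in> slit_disc \<Longrightarrow> H x (u x) (v x) = 0"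
  shows "H x p q = 0"
proof -
  obtain \<gamma> f g where *: "pathstart \<gamma> \<in> slit_disc" "pathfinish \<gamma> = x"
    "continuation_along \<gamma> f" "\<forall>\<^sub>F z in nhds (pathstart \<gamma>). f 0 z = u z"
    "continuation_along \<gamma> g" "\<forall>\<^sub>F z in nhds (pathstart \<gamma>). g 0 z = v z" "p = f 1 x" "q = g 1 x"
    using xpq unfolding asch_germ_def by blast
  have "\<forall>\<^sub>F z in nhds (pathstart \<gamma>). z \<in> slit_disc"
    using *(1) open_slit_disc by (intro eventually_nhds_in_open) auto
  with *(4,6) have "\<forall>\<^sub>F z in nhds (\<gamma> 0). H z (f 0 z) (g 0 z) = 0"
    unfolding pathstart_def by eventually_elim (simp add: init)
  moreover have "continuation_along \<gamma> (\<lambda>t x. H x (f t x) (g t x))"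
    by (rule continuation_compose[OF *(3,5)]) (rule H)
  ultimately have "H (\<gamma> 1) (f 1 (\<gamma> 1)) (g 1 (\<gamma> 1)) = 0"
    using continuation_zero[of \<gamma> "\<lambda>t x. H x (f t x) (g t x)" 1] by simp
  thus ?thesis using * by (simp add: pathfinish_def)
qed

text \<open>No gluing is needed: the germ at time \<open>t\<close> is the local section at \<open>\<delta> t\<close>, and neighbouring germs agree
  because sections through a common point are unique. The function \<open>T\<close> leaves room for rescaling the sections.\<close>

lemma continuation_by_sections:
  fixes M :: "(complex \<times> complex) set" and \<Phi> :: "complex \<times> complex \<Rightarrow> complex"
  assumes sect: "\<And>y. y \<in> M \<Longrightarrow> \<exists>W r f g. open W \<and> y \<in> W \<and> 0 < (r::real) \<and>
        f holomorphic_on ball (\<Phi> y) r \<and> g holomorphic_on ball (\<Phi> y) r \<and>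
        (\<forall>x\<in>ball (\<Phi> y) r. (f x, g x) \<in> M \<inter> W \<and> \<Phi> (f x, g x) = x) \<and>
        (\<forall>y'\<in>M \<inter> W. \<Phi> y' \<in> ball (\<Phi> y) r \<longrightarrow> (f (\<Phi> y'), g (\<Phi> y')) = y')"
    and Phi: "continuous_on M \<Phi>" and \<delta>: "path \<delta>" "path_image \<delta> \<subseteq> M"
  obtains f g where
    "\<And>T. (\<And>f g S. open S \<Longrightarrow> f holomorphic_on S \<Longrightarrow> g holomorphic_on S \<Longrightarrow> (\<forall>x\<in>S. (f x, g x) \<in> M) \<Longrightarrow>
       (\<lambda>x. T (f x) (g x)) holomorphic_on S) \<Longrightarrow> continuation_along (\<Phi> \<circ> \<delta>) (\<lambda>t x. T (f t x) (g t x))"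
    "\<And>t. t \<in> {0..1} \<Longrightarrow> (f t (\<Phi> (\<delta> t)), g t (\<Phi> (\<delta> t))) = \<delta> t"
    "\<And>u v. isCont u (\<Phi> (\<delta> 0)) \<Longrightarrow> isCont v (\<Phi> (\<delta> 0)) \<Longrightarrow> (u (\<Phi> (\<delta> 0)), v (\<Phi> (\<delta> 0))) = \<delta> 0 \<Longrightarrow>
       (\<forall>\<^sub>F x in nhds (\<Phi> (\<delta> 0)). (u x, v x) \<in> M \<and> \<Phi> (u x, v x) = x) \<Longrightarrow>
       (\<forall>\<^sub>F x in nhds (\<Phi> (\<delta> 0)). f 0 x = u x \<and> g 0 x = v x)"
proof -
  obtain W r f g where S: "\<And>y. y \<in> M \<Longrightarrow> open (W y) \<and> y \<in> W y \<and> 0 < (r y :: real) \<and>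
        f y holomorphic_on ball (\<Phi> y) (r y) \<and> g y holomorphic_on ball (\<Phi> y) (r y) \<and>
        (\<forall>x\<in>ball (\<Phi> y) (r y). (f y x, g y x) \<in> M \<inter> W y \<and> \<Phi> (f y x, g y x) = x) \<and>
        (\<forall>y'\<in>M \<inter> W y. \<Phi> y' \<in> ball (\<Phi> y) (r y) \<longrightarrow> (f y (\<Phi> y'), g y (\<Phi> y')) = y')"
    using sect by metis
  have dM: "\<delta> t \<in> M" if "t \<in> {0..1}" for t using \<delta>(2) that by (auto simp: path_image_def)
  have sec: "(f y (\<Phi> y), g y (\<Phi> y)) = y" if "y \<in> M" for y using S[OF that] that by simp
  \<comment> \<open>A continuous pair (u, v) of points over x through y' stays in \<open>W y\<close>
    near y', and there the section is forced.\<close>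
  have agree: "\<forall>\<^sub>F x in nhds (\<Phi> y'). f y x = u x \<and> g y x = v x"
    if y: "y \<in> M" "y' \<in> W y" "\<Phi> y' \<in> ball (\<Phi> y) (r y)" and uv: "isCont u (\<Phi> y')" "isCont v (\<Phi> y')" "(u (\<Phi> y'), v (\<Phi> y')) = y'"
      and ev: "\<forall>\<^sub>F x in nhds (\<Phi> y'). (u x, v x) \<in> M \<and> \<Phi> (u x, v x) = x" for y y' u v
  proof -
    have "((\<lambda>x. (u x, v x)) \<longlongrightarrow> y') (nhds (\<Phi> y'))"
      using tendsto_Pair[OF isCont_imp_tendsto_nhds[OF uv(1)] isCont_imp_tendsto_nhds[OF uv(2)]] uv(3) by simp
    hence "\<forall>\<^sub>F x in nhds (\<Phi> y'). (u x, v x) \<in> W y" using S[OF y(1)] y(2) by (auto intro: topological_tendstoD)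
    moreover have "\<forall>\<^sub>F x in nhds (\<Phi> y'). x \<in> ball (\<Phi> y) (r y)" using y(3) by (intro eventually_nhds_in_open) auto
    ultimately show ?thesis using ev
    proof eventually_elim
      case (elim x)
      have "\<forall>y'\<in>M \<inter> W y. \<Phi> y' \<in> ball (\<Phi> y) (r y) \<longrightarrow> (f y (\<Phi> y'), g y (\<Phi> y')) = y'"
        using S[OF y(1)] by blast
      moreover have "(u x, v x) \<in> M \<inter> W y" "\<Phi> (u x, v x) \<in> ball (\<Phi> y) (r y)" using elim by auto
      ultimately have "(f y (\<Phi> (u x, v x)), g y (\<Phi> (u x, v x))) = (u x, v x)" by meson
      thus ?case using elim by simp
    qed
  qed
  have cont: "isCont (f y) (\<Phi> y)" "isCont (g y) (\<Phi> y)" if "y \<in> M" for y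
    using S[OF that] by (auto intro!: continuous_on_interior[of "ball (\<Phi> y) (r y)"] holomorphic_on_imp_continuous_on)
  have near: "\<forall>\<^sub>F x in nhds (\<Phi> y). (f y x, g y x) \<in> M \<and> \<Phi> (f y x, g y x) = x" if "y \<in> M" for y
  proof -
    have "\<forall>\<^sub>F x in nhds (\<Phi> y). x \<in> ball (\<Phi> y) (r y)" using S[OF that] by (intro eventually_nhds_in_open) auto
    thus ?thesis by eventually_elim (use S[OF that] in auto)
  qed
  show ?thesis
  proof (rule that[of "\<lambda>t. f (\<delta> t)" "\<lambda>t. g (\<delta> t)"])
    fix T :: "complex \<Rightarrow> complex \<Rightarrow> complex"
    assume T: "\<And>f g S. open S \<Longrightarrow> f holomorphic_on S \<Longrightarrow> g holomorphic_on S \<Longrightarrow> (\<forall>x\<in>S. (f x, g x) \<in> M) \<Longrightarrow>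
       (\<lambda>x. T (f x) (g x)) holomorphic_on S"
    show "continuation_along (\<Phi> \<circ> \<delta>) (\<lambda>t x. T (f (\<delta> t) x) (g (\<delta> t) x))"
      unfolding continuation_along_def
    proof
      fix t :: real assume t: "t \<in> {0..1}"
      note St = S[OF dM[OF t]]
      have "continuous_on {0..1} \<delta>" using \<delta>(1) by (simp add: path_def)
      moreover have "continuous_on {0..1} (\<Phi> \<circ> \<delta>)"
        using calculation Phi \<delta>(2) by (intro continuous_on_compose) (auto simp: path_image_def intro: continuous_on_subset)
      ultimately have "(\<delta> \<longlongrightarrow> \<delta> t) (at t within {0..1})" "((\<Phi> \<circ> \<delta>) \<longlongrightarrow> (\<Phi> \<circ> \<delta>) t) (at t within {0..1})"
        using t unfolding continuous_on_def by blast+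
      hence "\<forall>\<^sub>F s in at t within {0..1}. \<delta> s \<in> W (\<delta> t)" "\<forall>\<^sub>F s in at t within {0..1}. \<Phi> (\<delta> s) \<in> ball (\<Phi> (\<delta> t)) (r (\<delta> t))"
        using St by (auto elim!: topological_tendstoD[of \<delta>] dest!: topological_tendstoD[of "\<Phi> \<circ> \<delta>" _ _ "ball (\<Phi> (\<delta> t)) (r (\<delta> t))"])
      hence "\<forall>\<^sub>F s in at t within {0..1}. \<delta> s \<in> W (\<delta> t) \<and> \<Phi> (\<delta> s) \<in> ball (\<Phi> (\<delta> t)) (r (\<delta> t))"
        by (rule eventually_conj)
      then obtain d where d: "d > 0" "\<And>s. s \<in> {0..1} \<Longrightarrow> s \<noteq> t \<Longrightarrow> dist s t < d \<Longrightarrow>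
          \<delta> s \<in> W (\<delta> t) \<and> \<Phi> (\<delta> s) \<in> ball (\<Phi> (\<delta> t)) (r (\<delta> t))"
        unfolding eventually_at by blast
      have d': "\<delta> s \<in> W (\<delta> t) \<and> \<Phi> (\<delta> s) \<in> ball (\<Phi> (\<delta> t)) (r (\<delta> t))" if "s \<in> {0..1}" "\<bar>s - t\<bar> < d" for s
        using d(2)[of s] that St by (cases "s = t") (auto simp: dist_real_def)
      show "\<exists>r>0. \<exists>d>0. (\<lambda>x. T (f (\<delta> t) x) (g (\<delta> t) x)) holomorphic_on ball ((\<Phi> \<circ> \<delta>) t) r \<and>
        (\<forall>s\<in>{0..1}. \<bar>s - t\<bar> < d \<longrightarrow> (\<Phi> \<circ> \<delta>) s \<in> ball ((\<Phi> \<circ> \<delta>) t) r \<and>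
           (\<forall>\<^sub>F z in nhds ((\<Phi> \<circ> \<delta>) s). T (f (\<delta> s) z) (g (\<delta> s) z) = T (f (\<delta> t) z) (g (\<delta> t) z)))"
      proof (rule exI[of _ "r (\<delta> t)"], rule conjI[rotated], rule exI[of _ d], intro conjI ballI impI)
        fix s :: real assume s: "s \<in> {0..1}" "\<bar>s - t\<bar> < d"
        show "(\<Phi> \<circ> \<delta>) s \<in> ball ((\<Phi> \<circ> \<delta>) t) (r (\<delta> t))" using d'[OF s] by simp
        have "\<forall>\<^sub>F x in nhds (\<Phi> (\<delta> s)). f (\<delta> t) x = f (\<delta> s) x \<and> g (\<delta> t) x = g (\<delta> s) x"
          using d'[OF s] by (intro agree dM t s cont sec near) auto
        thus "\<forall>\<^sub>F z in nhds ((\<Phi> \<circ> \<delta>) s). T (f (\<delta> s) z) (g (\<delta> s) z) = T (f (\<delta> t) z) (g (\<delta> t) z)"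
          unfolding o_def by eventually_elim simp
      next
        show "(\<lambda>x. T (f (\<delta> t) x) (g (\<delta> t) x)) holomorphic_on ball ((\<Phi> \<circ> \<delta>) t) (r (\<delta> t))"
          unfolding o_def by (rule T) (use St in auto)
      qed (use St d in auto)
    qed
  next
    fix t :: real assume "t \<in> {0..1}"
    thus "(f (\<delta> t) (\<Phi> (\<delta> t)), g (\<delta> t) (\<Phi> (\<delta> t))) = \<delta> t" by (intro sec dM)
  next
    fix u v :: "complex \<Rightarrow> complex"
    assume "isCont u (\<Phi> (\<delta> 0))" "isCont v (\<Phi> (\<delta> 0))" "(u (\<Phi> (\<delta> 0)), v (\<Phi> (\<delta> 0))) = \<delta> 0"
       "\<forall>\<^sub>F x in nhds (\<Phi> (\<delta> 0)). (u x, v x) \<in> M \<and> \<Phi> (u x, v x) = x"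
    thus "\<forall>\<^sub>F x in nhds (\<Phi> (\<delta> 0)). f (\<delta> 0) x = u x \<and> g (\<delta> 0) x = v x"
      using S[OF dM[of 0]] dM[of 0] by (intro agree) auto
  qed
qed

section \<open>Monodromy and local sections on the curve\<close>

context normalised
begin

text \<open>The points over x = 0 and x = 1 are removed; on the rest x is a local
  coordinate.\<close>

definition curve :: "(complex \<times> complex) set" where
  "curve = {(p, q). Pinf p q = 1 \<and> P0 p q \<noteq> 0 \<and> P1 p q \<noteq> 0}"

definition inverse_map :: "complex \<times> complex \<Rightarrow> complex" where
  "inverse_map = (\<lambda>(p, q). P0 p q ^ k)"

text \<open>The curve in the coordinates z = p / q and w = q, an m-fold covering of the z-plane
  without the zeros of the three forms.\<close>

definition chart_curve :: "(complex \<times> complex) set" where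
  "chart_curve = {(z, w). w ^ m * poly G z = 1 \<and> poly G0 z \<noteq> 0 \<and> poly G1 z \<noteq> 0}"

text \<open>P0 vanishes on the line q = 0, so the chart sees the whole curve.\<close>

lemma curve_snd_nz: "(p, q) \<in> curve \<Longrightarrow> q \<noteq> 0"
  using P0_on_axis by (auto simp: curve_def)

lemma curve_chart: "q \<noteq> 0 \<Longrightarrow> (p, q) \<in> curve \<longleftrightarrow> (p / q, q) \<in> chart_curve"
  by (simp add: curve_def chart_curve_def eval eval0 eval1)

lemma curve_image: "curve = (\<lambda>(z, w). (w * z, w)) ` chart_curve"
proof (intro equalityI subsetI)
  fix y assume "y \<in> curve"
  moreover obtain p q where "y = (p, q)" by (cases y)
  ultimately have "y = (\<lambda>(z, w). (w * z, w)) (p / q, q)" "(p / q, q) \<in> chart_curve"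
    using curve_snd_nz curve_chart by auto
  thus "y \<in> (\<lambda>(z, w). (w * z, w)) ` chart_curve" by (rule image_eqI)
next
  fix y assume "y \<in> (\<lambda>(z, w). (w * z, w)) ` chart_curve"
  then obtain z w where y: "y = (w * z, w)" "(z, w) \<in> chart_curve" by auto
  hence "w \<noteq> 0" using m_ge by (auto simp: chart_curve_def power_0_left)
  thus "y \<in> curve" using y curve_chart[of w "w * z"] by simp
qed

section \<open>The covering of the z-plane and its connectedness\<close>

definition branch :: "complex set" where "branch = {z. poly (G * G0 * G1) z = 0}"

lemma branch_iff: "z \<in> branch \<longleftrightarrow> poly G z = 0 \<or> poly G0 z = 0 \<or> poly G1 z = 0"
  by (auto simp: branch_def)

lemma finite_branch: "finite branch"
  unfolding branch_def by (intro poly_roots_finite) (use G_monic G0_nz G1_nz in simp)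

lemma chart_curve_iff: "(z, w) \<in> chart_curve \<longleftrightarrow> z \<notin> branch \<and> w ^ m * poly G z = 1"
  by (auto simp: chart_curve_def branch_iff)

text \<open>A continuous logarithm of G along the path continues w = G(z)^(-1/m).\<close>

lemma lift_path_to_chart:
  assumes g: "path g" "path_image g \<subseteq> - branch" and w: "(pathstart g, w) \<in> chart_curve"
  obtains w' where "path_component chart_curve (pathstart g, w) (pathfinish g, w')"
proof -
  have cg: "continuous_on {0..1} g" using g by (simp add: path_def)
  have gt: "g t \<notin> branch" if "t \<in> {0..1}" for t using g(2) that unfolding path_image_def by blast
  have "continuous_on {0..1} (\<lambda>t. poly G (g t))" by (intro continuous_intros cg)
  then obtain L where L: "continuous_on {0..1} L" "\<And>t. t \<in> {0..1} \<Longrightarrow> poly G (g t) = exp (L t)"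
    by (rule continuous_logarithm_on_contractible)
       (use gt in \<open>auto simp: branch_iff convex_imp_contractible\<close>)
  define lm where "lm = (\<lambda>t. w * exp (- (L t - L 0) / of_nat m))"
  have "path (\<lambda>t. (g t, lm t))"
    unfolding path_def lm_def using m_ge by (intro continuous_intros cg L) auto
  moreover have "(g t, lm t) \<in> chart_curve" if t: "t \<in> {0..1}" for t
  proof -
    have "lm t ^ m = w ^ m * exp (- (L t - L 0))"
      unfolding lm_def power_mult_distrib exp_of_nat_mult[symmetric] using m_ge by simp
    hence "lm t ^ m * poly G (g t) = w ^ m * exp (L 0)"
      by (simp add: L(2)[OF t] mult.assoc flip: exp_add)
    also have "\<dots> = 1" using w L(2)[of 0] by (simp add: chart_curve_def pathstart_def)
    finally show ?thesis using gt[OF t] by (simp add: chart_curve_iff)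
  qed
  ultimately have "path_component chart_curve (pathstart (\<lambda>t. (g t, lm t))) (pathfinish (\<lambda>t. (g t, lm t)))"
    unfolding path_component_def by (intro exI[of _ "\<lambda>t. (g t, lm t)"]) (auto simp: path_image_def)
  moreover have "lm 0 = w" by (simp add: lm_def)
  ultimately show ?thesis by (intro that[of "lm 1"]) (simp add: pathstart_def pathfinish_def)
qed

text \<open>At a zero of G the form G0 does not vanish; the syzygy then keeps G1 away from 0, and
  the Jacobian relation does the same for G'.\<close>

lemma G_simple_root:
  assumes "poly G z = 0" shows "poly (pderiv G) z \<noteq> 0" "poly G0 z \<noteq> 0" "poly G1 z \<noteq> 0"
proof -
  show 0: "poly G0 z \<noteq> 0" by (rule no_common_zero[OF assms])
  have "poly G0 z ^ k + poly G1 z ^ l = poly G z ^ r"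
    using arg_cong[OF chart_syzygy, of "\<lambda>p. poly p z"] by simp
  thus 1: "poly G1 z \<noteq> 0" using 0 assms lpos rpos by (auto simp: power_0_left)
  have "of_nat m0 * poly (pderiv G) z * poly G0 z = of_nat m * poly G1 z ^ (l - 1)"
    using arg_cong[OF chart_jac0, of "\<lambda>p. poly p z"] assms by simp
  thus "poly (pderiv G) z \<noteq> 0" using 1 m_ge by auto
qed

text \<open>Around a simple zero of \<open>G\<close> the monodromy of \<open>G\<^sup>-\<^sup>1\<^sup>/\<^sup>m\<close> is multiplication by a primitive root of unity.\<close>

lemma loop_monodromy:
  obtains z0 where "z0 \<notin> branch"
    "\<And>w. (z0, w) \<in> chart_curve \<Longrightarrow> path_component chart_curve (z0, w) (z0, w * exp (2 * of_real pi * \<i> / of_nat m))"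
proof -
  have "\<exists>i\<in>{1..m}. coeff G i \<noteq> 0" using G_monic m_ge by (intro bexI[of _ m]) auto
  then obtain z where "(\<Sum>i\<le>m. coeff G i * z ^ i) = 0"
    using fundamental_theorem_of_algebra[of "coeff G" m] by blast
  hence z: "poly G z = 0" unfolding poly_altdef G_monic(1) .
  obtain H where H: "G = [:-z, 1:] * H" using z unfolding poly_eq_0_iff_dvd by blast
  have Hz: "poly H z \<noteq> 0"
    using G_simple_root(1)[OF z] unfolding H pderiv_mult by (simp add: pderiv_pCons del: mult_pCons_left)
  have G: "poly G x = (x - z) * poly H x" for x unfolding H by (simp add: algebra_simps)
  have "finite {x. poly (H * G0 * G1) x = 0}"
    by (intro poly_roots_finite) (use H G_monic G0_nz G1_nz in auto)
  from finite_set_avoid[OF this, of z] obtain d where d: "d > 0" "\<And>x. poly (H * G0 * G1) x = 0 \<Longrightarrow> x \<noteq> z \<Longrightarrow> d \<le> dist z x"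
    by blast
  define \<rho> where "\<rho> = d / 2"
  have rho: "\<rho> > 0" "\<rho> < d" using d(1) by (auto simp: \<rho>_def)
  have nz: "poly H x \<noteq> 0" "poly G0 x \<noteq> 0" "poly G1 x \<noteq> 0" if "x \<in> ball z d" for x
    using d(2)[of x] that Hz G_simple_root[OF z] by (cases "x = z"; force)+
  have "continuous_on (ball z d) (poly H)" by (intro continuous_intros)
  \<comment> \<open>The cofactor H has a logarithm on the whole disc and so contributes no
    winding.\<close>
  then obtain L where L: "continuous_on (ball z d) L" "\<And>x. x \<in> ball z d \<Longrightarrow> poly H x = exp (L x)"
    by (rule continuous_logarithm_on_contractible) (use nz in \<open>auto simp: convex_imp_contractible\<close>)
  \<comment> \<open>The circle is run clockwise: the factor x - z of G turns by - 2 pi, hence w =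
    G^(-1/m) turns by 2 pi / m.\<close>
  define g where "g = (\<lambda>t::real. z + of_real \<rho> * exp (- (2 * of_real pi * \<i> * of_real t)))"
  define z0 where "z0 = z + of_real \<rho>"
  have g01: "g 0 = z0" "g 1 = z0" by (simp_all add: g_def z0_def exp_minus)
  have gb: "g t \<in> ball z d" and gz: "g t \<noteq> z" for t
  proof -
    have "norm (of_real \<rho> * exp (- (2 * of_real pi * \<i> * of_real t))) = \<rho>"
      using rho by (simp add: norm_mult)
    thus "g t \<in> ball z d" "g t \<noteq> z" using rho by (auto simp: g_def dist_norm norm_minus_commute)
  qed
  have gbr: "g t \<notin> branch" for t using nz[OF gb] gz by (simp add: branch_iff G)
  have cg: "continuous_on {0..1} g" unfolding g_def by (intro continuous_intros)
  have cL: "continuous_on {0..1} (\<lambda>t. L (g t))"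
    by (rule continuous_on_compose2[OF L(1) cg]) (use gb in auto)
  show ?thesis
  proof (rule that[of z0])
    show "z0 \<notin> branch" using gbr[of 0] g01 by simp
    fix w assume w: "(z0, w) \<in> chart_curve"
    define lm where "lm = (\<lambda>t::real. w * exp ((2 * of_real pi * \<i> * of_real t - (L (g t) - L z0)) / of_nat m))"
    have "path (\<lambda>t. (g t, lm t))"
      unfolding path_def lm_def using m_ge by (intro continuous_intros cg cL) auto
    moreover have "(g t, lm t) \<in> chart_curve" for t
    proof -
      have "lm t ^ m = w ^ m * exp (2 * of_real pi * \<i> * of_real t - (L (g t) - L z0))"
        unfolding lm_def power_mult_distrib exp_of_nat_mult[symmetric] using m_ge by simp
      moreover have "poly G (g t) = of_real \<rho> * exp (- (2 * of_real pi * \<i> * of_real t)) * exp (L (g t))"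
        unfolding G L(2)[OF gb] by (simp add: g_def)
      ultimately have "lm t ^ m * poly G (g t) = w ^ m * of_real \<rho> *
          (exp (2 * of_real pi * \<i> * of_real t - (L (g t) - L z0)) * exp (- (2 * of_real pi * \<i> * of_real t)) * exp (L (g t)))"
        by (simp only: mult_ac)
      also have "\<dots> = w ^ m * (of_real \<rho> * exp (L z0))"
        by (simp add: mult.assoc flip: exp_add)
      also have "of_real \<rho> * exp (L z0) = poly G z0"
        unfolding G using L(2)[OF gb, of 0] by (simp add: g01) (simp add: z0_def)
      also have "w ^ m * poly G z0 = 1" using w by (simp add: chart_curve_def)
      finally show ?thesis using gbr by (simp add: chart_curve_iff)
    qed
    ultimately have "path_component chart_curve (pathstart (\<lambda>t. (g t, lm t))) (pathfinish (\<lambda>t. (g t, lm t)))"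
      unfolding path_component_def by (intro exI[of _ "\<lambda>t. (g t, lm t)"]) (auto simp: path_image_def)
    thus "path_component chart_curve (z0, w) (z0, w * exp (2 * of_real pi * \<i> / of_nat m))"
      by (simp add: pathstart_def pathfinish_def lm_def g01)
  qed
qed

text \<open>Lifted paths lead every point to the fibre over \<open>z0\<close>. The quotient of two
  points of this fibre is an m-th root of unity, a power of the root supplied by the loop.\<close>

lemma path_connected_chart_curve: "path_connected chart_curve"
proof -
  obtain z0 where z0: "z0 \<notin> branch" "\<And>w. (z0, w) \<in> chart_curve \<Longrightarrow>
      path_component chart_curve (z0, w) (z0, w * exp (2 * of_real pi * \<i> / of_nat m))"
    using loop_monodromy by blast
  have pc: "path_connected (- branch)"
    by (intro path_connected_complement_countable) (use finite_branch countable_finite in auto)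
  have to_z0: "\<exists>w'. path_component chart_curve (z, w) (z0, w')" if zw: "(z, w) \<in> chart_curve" for z w
  proof -
    have "z \<in> - branch" using zw by (simp add: chart_curve_iff)
    then obtain g where g: "path g" "path_image g \<subseteq> - branch" "pathstart g = z" "pathfinish g = z0"
      using pc z0(1) unfolding path_connected_def by blast
    obtain w' where "path_component chart_curve (pathstart g, w) (pathfinish g, w')"
      by (rule lift_path_to_chart[OF g(1,2)]) (use zw g in auto)
    thus ?thesis using g by auto
  qed
  have rot: "path_component chart_curve (z0, w) (z0, w * exp (2 * of_real pi * \<i> / of_nat m) ^ j)"
    if w: "(z0, w) \<in> chart_curve" for w j
  proof (induction j)
    case 0
    show ?case using w by (simp add: path_component_refl)
  next
    case (Suc j)
    have "(z0, w * exp (2 * of_real pi * \<i> / of_nat m) ^ j) \<in> chart_curve"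
      using path_component_mem(2)[OF Suc.IH] .
    from path_component_trans[OF Suc.IH z0(2)[OF this]] show ?case by (simp add: mult_ac)
  qed
  have over: "path_component chart_curve (z0, w) (z0, w')" if "(z0, w) \<in> chart_curve" "(z0, w') \<in> chart_curve" for w w'
  proof -
    have "w ^ m * poly G z0 = 1" "w' ^ m * poly G z0 = 1" using that by (auto simp: chart_curve_def)
    hence "w ^ m = w' ^ m" "w \<noteq> 0" using m_ge
      by (metis mult_cancel_right mult_zero_right zero_neq_one, metis mult_zero_left power_0_left zero_neq_one not_numeral_le_zero)
    hence "(w' / w) ^ m = 1" by (metis divide_self_if power_divide power_eq_0_iff)
    then obtain j where "w' / w = exp (2 * of_real pi * \<i> * of_nat j / of_nat m)"
      using complex_roots_unity[of m] m_ge by auto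
    also have "\<dots> = exp (2 * of_real pi * \<i> / of_nat m) ^ j"
      by (simp flip: exp_of_nat_mult add: mult_ac)
    finally have "w' = w * exp (2 * of_real pi * \<i> / of_nat m) ^ j" using \<open>w \<noteq> 0\<close> by (simp add: field_simps)
    thus ?thesis using rot[OF that(1)] by simp
  qed
  show ?thesis
    unfolding path_connected_component
  proof (intro ballI)
    fix y y' assume y: "y \<in> chart_curve" "y' \<in> chart_curve"
    obtain z w z' w' where zw: "y = (z, w)" "y' = (z', w')" by (cases y, cases y')
    obtain v v' where v: "path_component chart_curve y (z0, v)" "path_component chart_curve y' (z0, v')"
      using to_z0 y zw by metis
    have "path_component chart_curve (z0, v) (z0, v')"
      using over path_component_mem(2) v by blast
    thus "path_component chart_curve y y'"
      using v path_component_sym path_component_trans by metis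
  qed
qed

lemma path_connected_curve: "path_connected curve"
  unfolding curve_image
  by (rule path_connected_continuous_image[OF _ path_connected_chart_curve])
     (auto simp: case_prod_unfold intro!: continuous_intros)

section \<open>The function x on the curve and its local inverses\<close>

lemma continuous_inverse_map: "continuous_on S inverse_map"
  unfolding inverse_map_def case_prod_unfold
  by (intro continuous_intros homogeneous_poly2_continuous[OF hom0])

lemma inverse_map_range:
  assumes "y \<in> curve" shows "inverse_map y \<noteq> 0" "inverse_map y \<noteq> 1"
proof -
  obtain p q where y: "y = (p, q)" "P0 p q \<noteq> 0" "P1 p q \<noteq> 0" "Pinf p q = 1"
    using assms by (auto simp: curve_def)
  show "inverse_map y \<noteq> 0" "inverse_map y \<noteq> 1"
    using syzygy[of p q] y by (auto simp: inverse_map_def)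
qed

text \<open>In the chart x is the function \<phi> = G0^k / G^r of z alone, and its derivative is
  nonzero by the Jacobian relation. Inverting \<phi> recovers z, and the branch of G^(-1/m) with
  value q0 at z0 recovers q.\<close>

lemma local_section:
  assumes y: "y \<in> curve"
  shows "\<exists>W r f g. open W \<and> y \<in> W \<and> 0 < (r::real) \<and>
        f holomorphic_on ball (inverse_map y) r \<and> g holomorphic_on ball (inverse_map y) r \<and>
        (\<forall>x\<in>ball (inverse_map y) r. (f x, g x) \<in> curve \<inter> W \<and> inverse_map (f x, g x) = x) \<and>
        (\<forall>y'\<in>curve \<inter> W. inverse_map y' \<in> ball (inverse_map y) r \<longrightarrow> (f (inverse_map y'), g (inverse_map y')) = y')"
proof -
  obtain p0 q0 where y0: "y = (p0, q0)" by (cases y)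
  have q0: "q0 \<noteq> 0" using y curve_snd_nz y0 by blast
  define z0 where "z0 = p0 / q0"
  have "(z0, q0) \<in> chart_curve" using y q0 curve_chart y0 by (simp add: z0_def)
  hence z0: "z0 \<notin> branch" "q0 ^ m * poly G z0 = 1" by (auto simp: chart_curve_iff)
  have Gz0: "poly G z0 \<noteq> 0" using z0 by (simp add: branch_iff)
  define \<phi> where "\<phi> = (\<lambda>z. poly G0 z ^ k / poly G z ^ r)"
  define lm where "lm = (\<lambda>z. q0 * exp (- Ln (poly G z / poly G z0) / of_nat m))"
  define A where "A = - branch \<inter> (\<lambda>z. poly G z / poly G z0) -` (- \<real>\<^sub>\<le>\<^sub>0)"
  have openA: "open A"
    unfolding A_def using Gz0
    by (intro open_Int continuous_open_vimage continuous_intros) (auto simp: finite_branch finite_imp_closed)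
  have z0A: "z0 \<in> A" using z0 Gz0 by (simp add: A_def)
  have hol\<phi>: "\<phi> holomorphic_on A" unfolding \<phi>_def A_def by (intro holomorphic_intros) (auto simp: branch_iff)
  have hollm: "lm holomorphic_on A"
    unfolding lm_def A_def using m_ge Gz0 by (intro holomorphic_intros) auto
  have lam: "lm z ^ m * poly G z = 1" if "z \<in> A" for z
  proof -
    have nz: "poly G z \<noteq> 0" using that by (simp add: A_def branch_iff)
    have "lm z ^ m = q0 ^ m * exp (- Ln (poly G z / poly G z0))"
      unfolding lm_def power_mult_distrib exp_of_nat_mult[symmetric] using m_ge by simp
    also have "\<dots> = q0 ^ m * (poly G z0 / poly G z)" using nz Gz0 by (simp add: exp_minus)
    finally show ?thesis using nz z0(2) by simp
  qed
  have phi_inv: "inverse_map (w * z, w) = \<phi> z" if "w ^ m * poly G z = 1" for w z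
  proof -
    have w: "w \<noteq> 0" and nz: "poly G z \<noteq> 0" using that m_ge by (auto simp: power_0_left)
    have "inverse_map (w * z, w) = (w ^ m0 * poly G0 z) ^ k" using w by (simp add: inverse_map_def eval0)
    also have "\<dots> = (w ^ m) ^ r * poly G0 z ^ k"
      using N0 Ninf by (simp add: power_mult_distrib power_mult[symmetric] mult.commute)
    also have "w ^ m = 1 / poly G z" using that nz by (simp add: field_simps)
    finally show ?thesis by (simp add: \<phi>_def power_divide)
  qed
  have "deriv \<phi> z0 \<noteq> 0"
  proof -
    define a b a' b' where "a = poly G z0" and "b = poly G0 z0" and "a' = poly (pderiv G) z0" and "b' = poly (pderiv G0) z0"
    have "(\<phi> has_field_derivative ((of_nat k * (b' * b ^ (k - 1))) * a ^ r - b ^ k * (of_nat r * (a' * a ^ (r - 1)))) / (a ^ r * a ^ r)) (at z0)"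
      unfolding \<phi>_def a_def b_def a'_def b'_def
      using DERIV_divide[OF DERIV_power[OF poly_DERIV[of G0 z0], of k] DERIV_power[OF poly_DERIV[of G z0], of r]] Gz0
      by (simp add: mult_ac)
    moreover have "((of_nat k * (b' * b ^ (k - 1))) * a ^ r - b ^ k * (of_nat r * (a' * a ^ (r - 1)))) \<noteq> 0"
    proof
      assume 0: "(of_nat k * (b' * b ^ (k - 1))) * a ^ r - b ^ k * (of_nat r * (a' * a ^ (r - 1))) = 0"
      have bk: "b ^ k = b ^ (k - 1) * b" "a ^ r = a ^ (r - 1) * a"
        using kpos rpos by (simp_all flip: power_Suc2)
      have "b ^ (k - 1) * a ^ (r - 1) * (of_nat k * b' * a - of_nat r * a' * b) = 0"
        using 0 unfolding bk by (simp add: algebra_simps)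
      hence "of_nat k * b' * a - of_nat r * a' * b = 0" using z0(1) Gz0 by (simp add: a_def b_def branch_iff)
      \<comment> \<open>With k m0 = r m = N this multiple of the numerator is - N times the Jacobian
        of G and G0.\<close>
      hence "of_nat m * (of_nat m0 * (of_nat k * b' * a - of_nat r * a' * b)) = 0" by simp
      moreover have "of_nat m * (of_nat m0 * (of_nat k * b' * a - of_nat r * a' * b)) =
          (of_nat k * of_nat m0) * of_nat m * b' * a - (of_nat r * of_nat m) * of_nat m0 * a' * b"
        by (simp only: right_diff_distrib mult_ac)
      hence "of_nat m * (of_nat m0 * (of_nat k * b' * a - of_nat r * a' * b)) =
          - of_nat N * (of_nat m0 * a' * b - of_nat m * a * b')"
        unfolding of_nat_mult[symmetric] N0[symmetric] Ninf[symmetric] by (simp add: right_diff_distrib mult_ac)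
      moreover have "of_nat m0 * a' * b - of_nat m * a * b' = of_nat m * poly G1 z0 ^ (l - 1)"
        using arg_cong[OF chart_jac0, of "\<lambda>p. poly p z0"] by (simp add: a_def b_def a'_def b'_def)
      ultimately show False using Npos m_ge z0(1) by (simp add: branch_iff)
    qed
    ultimately show ?thesis using Gz0 by (simp add: DERIV_imp_deriv a_def)
  qed
  then obtain \<rho> where rho: "\<rho> > 0" "ball z0 \<rho> \<subseteq> A" "open (\<phi> ` ball z0 \<rho>)" "inj_on \<phi> (ball z0 \<rho>)"
    using has_complex_derivative_locally_invertible[OF hol\<phi> z0A openA] by blast
  obtain \<psi> where psi: "\<psi> holomorphic_on \<phi> ` ball z0 \<rho>" "\<And>z. z \<in> ball z0 \<rho> \<Longrightarrow> \<psi> (\<phi> z) = z"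
    using holomorphic_has_inverse[OF holomorphic_on_subset[OF hol\<phi> rho(2)] open_ball rho(4)] by metis
  have iy: "inverse_map y = \<phi> z0"
    using phi_inv[of q0 z0] z0(2) q0 by (simp add: y0 z0_def)
  have "\<phi> z0 \<in> \<phi> ` ball z0 \<rho>" using rho(1) by simp
  then obtain r where r: "r > 0" "ball (\<phi> z0) r \<subseteq> \<phi> ` ball z0 \<rho>" using rho(3) openE by blast
  have psi_in: "\<psi> x \<in> ball z0 \<rho>" "\<phi> (\<psi> x) = x" if "x \<in> ball (\<phi> z0) r" for x
    using r(2) that psi(2) by auto
  \<comment> \<open>The neighbourhood \<open>W\<close> keeps q / lm(p / q) within e of 1; this
    quotient is an m-th root of unity, so it equals 1.\<close>
  obtain e :: real where e: "e > 0" "\<And>w::complex. w ^ m = 1 \<Longrightarrow> dist 1 w < e \<Longrightarrow> w = 1"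
    using unity_roots_isolated[of m] m_ge by auto
  have lnz: "lm z \<noteq> 0" for z using q0 by (simp add: lm_def)
  define W0 where "W0 = {y :: complex \<times> complex. snd y \<noteq> 0} \<inter> (\<lambda>y. fst y / snd y) -` ball z0 \<rho>"
  define W where "W = W0 \<inter> (\<lambda>y. snd y / lm (fst y / snd y)) -` ball 1 e"
  have oW0: "open W0"
    unfolding W0_def
  proof (rule continuous_open_preimage)
    show "open {y :: complex \<times> complex. snd y \<noteq> 0}" by (intro open_Collect_neq continuous_intros)
  qed (auto intro!: continuous_intros)
  have oW: "open W"
    unfolding W_def
  proof (rule continuous_open_preimage[OF _ oW0])
    have "continuous_on (ball z0 \<rho>) lm"
      by (rule holomorphic_on_imp_continuous_on[OF holomorphic_on_subset[OF hollm rho(2)]])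
    moreover have "continuous_on W0 (\<lambda>y. fst y / snd y)" by (intro continuous_intros) (auto simp: W0_def)
    ultimately have "continuous_on W0 (\<lambda>y. lm (fst y / snd y))"
      by (rule continuous_on_compose2) (auto simp: W0_def)
    thus "continuous_on W0 (\<lambda>y. snd y / lm (fst y / snd y))"
      by (intro continuous_intros) (use lnz in auto)
  qed auto
  define f g where "f = (\<lambda>x. lm (\<psi> x) * \<psi> x)" and "g = (\<lambda>x. lm (\<psi> x))"
  have hpsi: "\<psi> holomorphic_on ball (\<phi> z0) r" by (rule holomorphic_on_subset[OF psi(1) r(2)])
  have hg: "g holomorphic_on ball (\<phi> z0) r"
    unfolding g_def using holomorphic_on_compose_gen[OF hpsi holomorphic_on_subset[OF hollm rho(2)]] psi_in(1)
    by (simp add: o_def image_subset_iff)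
  have hf: "f holomorphic_on ball (\<phi> z0) r"
    using holomorphic_on_mult[OF hg hpsi] by (simp add: f_def g_def)
  have "lm z0 = q0" using Gz0 by (simp add: lm_def)
  hence yW: "y \<in> W" using q0 rho(1) e(1) by (simp add: W_def W0_def y0 z0_def[symmetric])
  have sec: "(f x, g x) \<in> curve \<inter> W \<and> inverse_map (f x, g x) = x" if x: "x \<in> ball (\<phi> z0) r" for x
  proof (intro conjI IntI)
    have A: "\<psi> x \<in> A" using psi_in(1)[OF x] rho(2) by blast
    have fg: "f x = g x * \<psi> x" "f x / g x = \<psi> x" "g x \<noteq> 0" using lnz by (auto simp: f_def g_def)
    have gm: "g x ^ m * poly G (\<psi> x) = 1" unfolding g_def by (rule lam[OF A])
    show "(f x, g x) \<in> curve"
      using A gm by (subst curve_chart[OF fg(3)]) (simp add: fg(2) chart_curve_iff A_def)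
    show "inverse_map (f x, g x) = x" unfolding fg(1) phi_inv[OF gm] by (rule psi_in(2)[OF x])
    show "(f x, g x) \<in> W"
      using psi_in(1)[OF x] fg(3) e(1) lnz by (simp add: W_def W0_def fg(2)) (simp add: g_def)
  qed
  have inv: "(f (inverse_map y'), g (inverse_map y')) = y'" if y': "y' \<in> curve \<inter> W" for y'
  proof -
    obtain p q where pq: "y' = (p, q)" by (cases y')
    have q: "q \<noteq> 0" and zb: "p / q \<in> ball z0 \<rho>" and near: "dist 1 (q / lm (p / q)) < e"
      using y' by (auto simp: pq W_def W0_def)
    have D: "(p / q, q) \<in> chart_curve" using y' pq curve_chart[OF q] by auto
    have qm: "q ^ m * poly G (p / q) = 1" using D by (simp add: chart_curve_def)
    have ii: "inverse_map y' = \<phi> (p / q)" using phi_inv[OF qm] q by (simp add: pq)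
    have "lm (p / q) ^ m * poly G (p / q) = 1" using lam zb rho(2) by blast
    hence "q ^ m = lm (p / q) ^ m" using qm by (metis mult_cancel_right mult_zero_right zero_neq_one)
    hence "(q / lm (p / q)) ^ m = 1" using lnz by (simp add: power_divide)
    hence "q / lm (p / q) = 1" using e(2) near by blast
    hence "lm (p / q) = q" using lnz by simp
    thus ?thesis using q unfolding pq ii[unfolded pq] f_def g_def psi(2)[OF zb] by simp
  qed
  show ?thesis
    by (rule exI[of _ W], rule exI[of _ r], rule exI[of _ f], rule exI[of _ g])
       (use oW yW r(1) hf hg sec inv iy in auto)
qed

end

section \<open>Image curves\<close>

lemma eventually_at_not_in_finite:
  fixes a :: "'a::metric_space"
  assumes "finite S" shows "\<forall>\<^sub>F t in at a. t \<notin> S"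
proof -
  obtain d where "d > 0" "\<forall>x\<in>S. x \<noteq> a \<longrightarrow> d \<le> dist a x" using finite_set_avoid[OF assms] by blast
  thus ?thesis unfolding eventually_at by (intro exI[of _ d]) (auto simp: dist_commute)
qed

text \<open>For \<xi>^g = \<omega> one has \<xi>^m = \<omega>^(m/g) = 1, and n x = m y + g makes
  \<xi>^x the required root. It repairs a wrong choice of scaling factor in the twisted
  patterns.\<close>

lemma common_power_root:
  fixes \<omega> :: complex
  assumes "m > 0" "n > 0" "\<omega> ^ (m div gcd m n) = 1"
  obtains \<eta> where "\<eta> ^ m = 1" "\<eta> ^ n = \<omega>"
proof -
  define g where "g = gcd m n"
  have g: "g > 0" "m = g * (m div g)" using assms by (auto simp: g_def)
  have "m div g > 0" using assms g by (auto intro!: Nat.gr0I)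
  hence \<omega>: "\<omega> \<noteq> 0" using assms(3) by (auto simp: g_def power_0_left)
  define \<xi> where "\<xi> = exp (Ln \<omega> / of_nat g)"
  have \<xi>: "\<xi> ^ g = \<omega>" using \<omega> g by (simp add: \<xi>_def flip: exp_of_nat_mult)
  have \<xi>m: "\<xi> ^ m = 1" using assms(3) unfolding g_def[symmetric] by (metis g(2) power_mult \<xi>)
  obtain x y where xy: "n * x = m * y + g"
    using bezout_nat[of n m] assms(2) by (auto simp: g_def gcd.commute)
  have "(\<xi> ^ x) ^ n = \<xi> ^ (m * y + g)" unfolding xy[symmetric] by (simp add: power_mult[symmetric] mult.commute)
  also have "\<dots> = \<omega>" by (simp add: power_add power_mult \<xi>m \<xi>)
  finally have "(\<xi> ^ x) ^ n = \<omega>" .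
  moreover have "(\<xi> ^ x) ^ m = 1" by (metis \<xi>m power_commutes power_mult mult.commute power_one)
  ultimately show ?thesis using that by blast
qed

context normalised
begin

text \<open>The principal root s = x^(1/k) lies in the disc of the local identities, and U(s), V(s)
  are the two solutions at x.\<close>

lemma slit_disc_values:
  assumes x: "x \<in> slit_disc"
  shows "P0 (hyp_u a b c x) (hyp_v a b c x) = x powr (1 / of_nat k)"
    "P1 (hyp_u a b c x) (hyp_v a b c x) = (1 - x) powr (1 / of_nat l)"
    "Pinf (hyp_u a b c x) (hyp_v a b c x) = 1"
proof -
  define s where "s = x powr (1 / of_nat k)"
  have x': "x \<noteq> 0" "norm x < 1" using x by (auto simp: slit_disc_def)
  have sk: "s ^ k = x" using x' kpos by (simp add: s_def powr_power)
  have "norm s ^ k < 1" using x' by (simp flip: norm_power add: sk)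
  hence s: "s \<in> ball 0 1" using power_less_one_iff[of "norm s" k] kpos by simp
  have "complex_of_real (1 - c) = 1 / of_nat k" unfolding exp0 by simp
  hence "hyp_u a b c x = U s" "hyp_v a b c x = V s"
    by (simp_all add: hyp_u_def hyp_v_def U_def V_def sk s_def[symmetric])
  thus "P0 (hyp_u a b c x) (hyp_v a b c x) = x powr (1 / of_nat k)"
    "P1 (hyp_u a b c x) (hyp_v a b c x) = (1 - x) powr (1 / of_nat l)"
    "Pinf (hyp_u a b c x) (hyp_v a b c x) = 1"
    using id0[OF s] id1[OF s] id[OF s] by (simp_all add: s_def[symmetric] R_def sk)
qed

lemma slit_disc_powers:
  assumes x: "x \<in> slit_disc"
  shows "P0 (hyp_u a b c x) (hyp_v a b c x) ^ k = x" "P1 (hyp_u a b c x) (hyp_v a b c x) ^ l = 1 - x"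
    "x \<noteq> 0" "x \<noteq> 1"
proof -
  show x': "x \<noteq> 0" "x \<noteq> 1" using x by (auto simp: slit_disc_def)
  show "P0 (hyp_u a b c x) (hyp_v a b c x) ^ k = x" "P1 (hyp_u a b c x) (hyp_v a b c x) ^ l = 1 - x"
    using x' kpos lpos by (simp_all add: slit_disc_values[OF x] powr_power)
qed

lemma slit_disc_curve:
  assumes x: "x \<in> slit_disc"
  shows "(hyp_u a b c x, hyp_v a b c x) \<in> curve" "inverse_map (hyp_u a b c x, hyp_v a b c x) = x"
  using slit_disc_powers[OF x] slit_disc_values(3)[OF x] kpos lpos
  by (auto simp: curve_def inverse_map_def power_0_left)

lemma hyp_uv_isCont:
  assumes x: "x \<in> slit_disc"
  shows "isCont (hyp_u a b c) x" "isCont (hyp_v a b c) x"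
proof -
  have xb: "x \<in> ball 0 1" "x \<notin> \<real>\<^sub>\<le>\<^sub>0" using x by (auto simp: slit_disc_def)
  have 1: "isCont (hyp_F a b c) x"
    using holomorphic_on_imp_continuous_on[OF hyp_F_holomorphic[OF regular_c]] xb(1)
    by (intro continuous_on_interior[of "ball 0 1"]) auto
  have 2: "isCont (hyp_F (a - c + 1) (b - c + 1) (2 - c)) x"
    using holomorphic_on_imp_continuous_on[OF hyp_F_holomorphic[OF regular_2c]] xb(1)
    by (intro continuous_on_interior[of "ball 0 1"]) auto
  show "isCont (hyp_u a b c) x" using 1 by (simp add: hyp_u_def[abs_def])
  have "(\<lambda>x. x powr of_real (1 - c)) holomorphic_on slit_disc"
    by (intro holomorphic_intros) (auto simp: slit_disc_def)
  hence "isCont (\<lambda>x. x powr of_real (1 - c)) x"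
    using x open_slit_disc by (metis holomorphic_on_imp_continuous_on continuous_on_eq_continuous_at)
  thus "isCont (hyp_v a b c) x"
    unfolding hyp_v_def[abs_def] by (intro continuous_mult 2)
qed

text \<open>A path in the curve from a value over the slit disc to the given point projects to a
  path in the x-plane, and the local sections along it form the continuation. \<open>Ta\<close> and
  \<open>Tb\<close> rescale the pair in the twisted patterns.\<close>

lemma curve_in_asch_germ:
  assumes pq: "(p, q) \<in> curve"
    and Ta: "\<And>f g S. open S \<Longrightarrow> f holomorphic_on S \<Longrightarrow> g holomorphic_on S \<Longrightarrow> (\<forall>x\<in>S. (f x, g x) \<in> curve) \<Longrightarrow>
       (\<lambda>x. Ta (f x) (g x)) holomorphic_on S"
    and Tb: "\<And>f g S. open S \<Longrightarrow> f holomorphic_on S \<Longrightarrow> g holomorphic_on S \<Longrightarrow> (\<forall>x\<in>S. (f x, g x) \<in> curve) \<Longrightarrow>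
       (\<lambda>x. Tb (f x) (g x)) holomorphic_on S"
    and u: "\<And>x. x \<in> slit_disc \<Longrightarrow> u x = Ta (hyp_u a b c x) (hyp_v a b c x)"
    and v: "\<And>x. x \<in> slit_disc \<Longrightarrow> v x = Tb (hyp_u a b c x) (hyp_v a b c x)"
  shows "(inverse_map (p, q), Ta p q, Tb p q) \<in> asch_germ u v"
proof -
  define x0 :: complex where "x0 = 1 / 2"
  have x0: "x0 \<in> slit_disc" by (simp add: slit_disc_def x0_def complex_nonpos_Reals_iff)
  obtain \<delta> where d: "path \<delta>" "path_image \<delta> \<subseteq> curve" "pathstart \<delta> = (hyp_u a b c x0, hyp_v a b c x0)"
    "pathfinish \<delta> = (p, q)"
    using path_connected_curve slit_disc_curve(1)[OF x0] pq unfolding path_connected_def by meson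
  have start: "\<delta> 0 = (hyp_u a b c x0, hyp_v a b c x0)" "inverse_map (\<delta> 0) = x0"
    using d(3) slit_disc_curve(2)[OF x0] by (simp_all add: pathstart_def)
  obtain f g where fg:
    "\<And>T. (\<And>f g S. open S \<Longrightarrow> f holomorphic_on S \<Longrightarrow> g holomorphic_on S \<Longrightarrow> (\<forall>x\<in>S. (f x, g x) \<in> curve) \<Longrightarrow>
       (\<lambda>x. T (f x) (g x)) holomorphic_on S) \<Longrightarrow> continuation_along (inverse_map \<circ> \<delta>) (\<lambda>t x. T (f t x) (g t x))"
    "\<And>t. t \<in> {0..1} \<Longrightarrow> (f t (inverse_map (\<delta> t)), g t (inverse_map (\<delta> t))) = \<delta> t"
    "\<And>u v. isCont u (inverse_map (\<delta> 0)) \<Longrightarrow> isCont v (inverse_map (\<delta> 0)) \<Longrightarrow>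
       (u (inverse_map (\<delta> 0)), v (inverse_map (\<delta> 0))) = \<delta> 0 \<Longrightarrow>
       (\<forall>\<^sub>F x in nhds (inverse_map (\<delta> 0)). (u x, v x) \<in> curve \<and> inverse_map (u x, v x) = x) \<Longrightarrow>
       (\<forall>\<^sub>F x in nhds (inverse_map (\<delta> 0)). f 0 x = u x \<and> g 0 x = v x)"
    apply (rule continuation_by_sections[OF _ continuous_inverse_map d(1,2)])
     apply (erule local_section)
    subgoal premises prems for f g by (rule prems(1)) (fact prems(2-))+
    done
  have near: "\<forall>\<^sub>F x in nhds x0. x \<in> slit_disc" using x0 open_slit_disc by (intro eventually_nhds_in_open)
  have germ: "\<forall>\<^sub>F x in nhds x0. f 0 x = hyp_u a b c x \<and> g 0 x = hyp_v a b c x"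
  proof -
    have "\<forall>\<^sub>F x in nhds x0. (hyp_u a b c x, hyp_v a b c x) \<in> curve \<and> inverse_map (hyp_u a b c x, hyp_v a b c x) = x"
      using near by eventually_elim (simp add: slit_disc_curve)
    from fg(3)[of "hyp_u a b c" "hyp_v a b c", unfolded start(2), OF hyp_uv_isCont[OF x0] start(1)[symmetric] this]
    show ?thesis .
  qed
  have fin: "(f 1 (inverse_map (p, q)), g 1 (inverse_map (p, q))) = (p, q)"
    using fg(2)[of 1] d(4) by (simp add: pathfinish_def)
  show ?thesis
    unfolding asch_germ_def
  proof (intro CollectI case_prodI exI conjI)
    show "path (inverse_map \<circ> \<delta>)" by (intro path_continuous_image d(1) continuous_inverse_map)
    show "path_image (inverse_map \<circ> \<delta>) \<subseteq> - {0, 1}"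
      unfolding path_image_compose
    proof (rule image_subsetI)
      fix y assume "y \<in> path_image \<delta>"
      hence "y \<in> curve" using d(2) by blast
      thus "inverse_map y \<in> - {0, 1}" using inverse_map_range[of y] by simp
    qed
    show "pathstart (inverse_map \<circ> \<delta>) \<in> slit_disc"
      using start x0 by (simp add: pathstart_def)
    show "pathfinish (inverse_map \<circ> \<delta>) = inverse_map (p, q)"
      using d(4) by (simp add: pathfinish_def)
    show "continuation_along (inverse_map \<circ> \<delta>) (\<lambda>t x. Ta (f t x) (g t x))" by (rule fg(1)) (rule Ta)
    show "continuation_along (inverse_map \<circ> \<delta>) (\<lambda>t x. Tb (f t x) (g t x))" by (rule fg(1)) (rule Tb)
    have st: "pathstart (inverse_map \<circ> \<delta>) = x0" using start by (simp add: pathstart_def)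
    show "\<forall>\<^sub>F z in nhds (pathstart (inverse_map \<circ> \<delta>)). Ta (f 0 z) (g 0 z) = u z"
      unfolding st using germ near by eventually_elim (simp add: u)
    show "\<forall>\<^sub>F z in nhds (pathstart (inverse_map \<circ> \<delta>)). Tb (f 0 z) (g 0 z) = v z"
      unfolding st using germ near by eventually_elim (simp add: v)
    show "Ta p q = Ta (f 1 (inverse_map (p, q))) (g 1 (inverse_map (p, q)))" using fin by simp
    show "Tb p q = Tb (f 1 (inverse_map (p, q))) (g 1 (inverse_map (p, q)))" using fin by simp
  qed
qed

text \<open>A point with P0 P1 = 0 is moved along one coordinate until both are nonzero, and scaling
  by Pinf^(-1/m) returns it to Pinf = 1.\<close>

lemma curve_dense:
  assumes "Pinf p q = 1"
  obtains P Q :: "complex \<Rightarrow> complex" where "(P \<longlongrightarrow> p) (at 0)" "(Q \<longlongrightarrow> q) (at 0)" "\<forall>\<^sub>F t in at 0. (P t, Q t) \<in> curve"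
proof -
  obtain f g where fg: "(f \<longlongrightarrow> p) (at (0::complex))" "(g \<longlongrightarrow> q) (at (0::complex))"
    "\<forall>\<^sub>F t in at 0. P0 (f t) (g t) \<noteq> 0 \<and> P1 (f t) (g t) \<noteq> 0"
  proof (cases "q = 0")
    case False
    have "\<forall>\<^sub>F t in at 0. t \<notin> (\<lambda>z. z * q - p) ` branch"
      by (intro eventually_at_not_in_finite finite_imageI finite_branch)
    hence "\<forall>\<^sub>F t in at 0. P0 (p + t) q \<noteq> 0 \<and> P1 (p + t) q \<noteq> 0"
    proof eventually_elim
      case (elim t)
      have "(p + t) / q \<notin> branch"
      proof
        assume "(p + t) / q \<in> branch"
        moreover have "t = (p + t) / q * q - p" using False by simp
        ultimately show False using elim by blast
      qed
      thus ?case using False by (simp add: eval0 eval1 branch_iff)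
    qed
    moreover have "((\<lambda>t. p + t) \<longlongrightarrow> p) (at 0)" by (rule tendsto_eq_intros refl)+ simp
    ultimately show ?thesis using that[of "\<lambda>t. p + t" "\<lambda>_. q"] by simp
  next
    case True
    \<comment> \<open>For q = 0 the second coordinate has to move, since P0 vanishes on the whole
      line q = 0.\<close>
    have p: "p \<noteq> 0" using assms True homogeneous_poly2_scale[OF hom, of 0 0 0] m_ge by (auto simp: power_0_left)
    have "\<forall>\<^sub>F t in at 0. t \<notin> (\<lambda>z. p / z) ` branch"
      by (intro eventually_at_not_in_finite finite_imageI finite_branch)
    moreover have "\<forall>\<^sub>F t in at (0::complex). t \<noteq> 0" by (rule eventually_neq_at_within)
    ultimately have "\<forall>\<^sub>F t in at 0. P0 p t \<noteq> 0 \<and> P1 p t \<noteq> 0"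
    proof eventually_elim
      case (elim t)
      have "p / t \<notin> branch"
      proof
        assume "p / t \<in> branch"
        moreover have "t = p / (p / t)" using p elim by simp
        ultimately show False using elim by blast
      qed
      thus ?case using elim by (simp add: eval0 eval1 branch_iff)
    qed
    thus ?thesis using that[of "\<lambda>_. p" "\<lambda>t. t"] True by simp
  qed
  define \<sigma> where "\<sigma> = (\<lambda>t. exp (- Ln (Pinf (f t) (g t)) / of_nat m))"
  have P: "((\<lambda>t. Pinf (f t) (g t)) \<longlongrightarrow> 1) (at 0)"
    using homogeneous_poly2_tendsto[OF hom fg(1,2)] assms by simp
  have "(\<sigma> \<longlongrightarrow> exp (- Ln 1 / of_nat m)) (at 0)"
    unfolding \<sigma>_def using m_ge by (intro tendsto_intros P) auto
  hence \<sigma>: "(\<sigma> \<longlongrightarrow> 1) (at 0)" by simp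
  have "\<forall>\<^sub>F t in at 0. Pinf (f t) (g t) \<noteq> 0" by (rule tendsto_imp_eventually_ne[OF P]) simp
  with fg(3) have "\<forall>\<^sub>F t in at 0. (\<sigma> t * f t, \<sigma> t * g t) \<in> curve"
  proof eventually_elim
    case (elim t)
    have "\<sigma> t ^ m = exp (- Ln (Pinf (f t) (g t)))"
      unfolding \<sigma>_def exp_of_nat_mult[symmetric] using m_ge by simp
    hence "\<sigma> t ^ m = inverse (Pinf (f t) (g t))" using elim by (simp add: exp_minus)
    moreover have "\<sigma> t \<noteq> 0" by (simp add: \<sigma>_def)
    ultimately show ?case
      using elim by (simp add: curve_def homogeneous_poly2_scale[OF hom] homogeneous_poly2_scale[OF hom0]
        homogeneous_poly2_scale[OF hom1])
  qed
  moreover have "((\<lambda>t. \<sigma> t * f t) \<longlongrightarrow> p) (at 0)" "((\<lambda>t. \<sigma> t * g t) \<longlongrightarrow> q) (at 0)"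
    using tendsto_mult[OF \<sigma> fg(1)] tendsto_mult[OF \<sigma> fg(2)] by simp_all
  ultimately show ?thesis using that by blast
qed

lemma closed_polynomial_curve:
  assumes "continuous_on UNIV (\<lambda>y. f (fst y) (snd y) :: complex)"
  shows "closed {(p, q). f p q = 0}"
proof -
  have "closed {y. f (fst y) (snd y) = 0}"
    by (rule closed_Collect_eq) (use assms in \<open>auto intro!: continuous_intros\<close>)
  thus ?thesis by (simp add: case_prod_unfold)
qed

text \<open>Permanence puts the image inside the curve Pinf = 1; conversely every point of the dense
  part \<open>curve\<close> is a value.\<close>

theorem asch_curve_positive:
  shows "closure {(p, q). \<exists>x. (x, p, q) \<in> asch_germ (hyp_u a b c) (hyp_v a b c)} = {(p, q). Pinf p q - 1 = 0}"
    (is "closure ?A = ?K")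
  and "\<And>x p q. (x, p, q) \<in> asch_germ (hyp_u a b c) (hyp_v a b c) \<Longrightarrow> x = P0 p q ^ k"
proof -
  show "x = P0 p q ^ k" if "(x, p, q) \<in> asch_germ (hyp_u a b c) (hyp_v a b c)" for x p q
  proof -
    have "x - P0 p q ^ k = 0"
      by (rule asch_germ_permanence[OF that, of "\<lambda>x p q. x - P0 p q ^ k"])
         (auto intro!: holomorphic_intros homogeneous_poly2_holomorphic[OF hom0] simp: slit_disc_powers)
    thus ?thesis by simp
  qed
  show "closure ?A = ?K"
  proof (rule antisym)
    have "closed ?K"
      by (rule closed_polynomial_curve) (intro continuous_intros homogeneous_poly2_continuous[OF hom])
    moreover have "?A \<subseteq> ?K"
    proof safe
      fix p q x assume "(x, p, q) \<in> asch_germ (hyp_u a b c) (hyp_v a b c)"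
      thus "Pinf p q - 1 = 0"
        by (rule asch_germ_permanence[of _ _ _ _ _ "\<lambda>x p q. Pinf p q - 1"])
           (auto intro!: holomorphic_intros homogeneous_poly2_holomorphic[OF hom] simp: slit_disc_values)
    qed
    ultimately show "closure ?A \<subseteq> ?K" by (rule closure_minimal[rotated])
    show "?K \<subseteq> closure ?A"
    proof safe
      fix p q assume "Pinf p q - 1 = 0"
      hence one: "Pinf p q = 1" by simp
      obtain P Q :: "complex \<Rightarrow> complex" where PQ: "(P \<longlongrightarrow> p) (at 0)" "(Q \<longlongrightarrow> q) (at 0)" "\<forall>\<^sub>F t in at 0. (P t, Q t) \<in> curve"
        using curve_dense[OF one] by blast
      have "\<forall>\<^sub>F t in at 0. (P t, Q t) \<in> closure ?A"
        using PQ(3)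
      proof eventually_elim
        case (elim t)
        have "(inverse_map (P t, Q t), P t, Q t) \<in> asch_germ (hyp_u a b c) (hyp_v a b c)"
          by (rule curve_in_asch_germ[OF elim, of "\<lambda>p q. p" "\<lambda>p q. q"]) auto
        thus ?case using closure_subset[of ?A] by blast
      qed
      from Lim_in_closed_set[OF closed_closure this at_neq_bot tendsto_Pair[OF PQ(1,2)]]
      show "(p, q) \<in> closure ?A" .
    qed
  qed
qed

text \<open>In the other sign patterns the affine Schwarz map is \<open>(u / M, v / M)\<close> with \<open>M(u, v)\<close> one of \<open>P\<^sub>0\<close>, \<open>P\<^sub>1\<close>, \<open>P\<^sub>0 P\<^sub>1\<close>,
  since these forms take the values \<open>x powr (1/k)\<close>, \<open>(1 - x) powr (1/l)\<close> and their product on the curve \<open>P\<^sub>\<infinity> = 1\<close>. Dividing by \<open>M\<close>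
  maps that curve onto the new one, except for the origin, which belongs to the closure.\<close>

theorem asch_curve_twisted:
  fixes M :: "complex \<Rightarrow> complex \<Rightarrow> complex" and W :: "complex \<Rightarrow> complex" and d n :: nat
  assumes scale: "\<And>t u v. M (t * u) (t * v) = t ^ d * M u v" and d: "d \<ge> 2"
    and hol: "\<And>f g S. f holomorphic_on S \<Longrightarrow> g holomorphic_on S \<Longrightarrow> (\<lambda>x. M (f x) (g x)) holomorphic_on S"
    and cont: "continuous_on UNIV (\<lambda>y. M (fst y) (snd y))"
    and nz: "\<And>p q. P0 p q \<noteq> 0 \<Longrightarrow> P1 p q \<noteq> 0 \<Longrightarrow> M p q \<noteq> 0"
    and common: "\<And>p q. M p q = 0 \<Longrightarrow> Pinf p q = 0 \<Longrightarrow> p = 0 \<and> q = 0"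
    and W: "W holomorphic_on UNIV" "\<And>x. x \<in> slit_disc \<Longrightarrow> M (hyp_u a b c x) (hyp_v a b c x) ^ n = W x" "n > 0"
    and u: "\<And>x. x \<in> slit_disc \<Longrightarrow> u x = hyp_u a b c x / M (hyp_u a b c x) (hyp_v a b c x)"
    and v: "\<And>x. x \<in> slit_disc \<Longrightarrow> v x = hyp_v a b c x / M (hyp_u a b c x) (hyp_v a b c x)"
  defines "g \<equiv> gcd m (d - 1)"
  shows "closure {(p, q). \<exists>x. (x, p, q) \<in> asch_germ u v} =
      {(p, q). M p q ^ (m div g) - Pinf p q ^ ((d - 1) div g) = 0}" (is "closure ?A = ?K")
    and "\<And>x p q. (x, p, q) \<in> asch_germ u v \<Longrightarrow> x = P0 p q ^ k * Pinf p q powi (- int r)"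
proof -
  define A B where "A = m div g" and "B = (d - 1) div g"
  have g: "g > 0" "g dvd m" "g dvd d - 1" using m_ge by (auto simp: g_def)
  have AB: "A > 0" "B > 0"
    using g m_ge d unfolding A_def B_def by (auto intro!: Nat.gr0I elim!: dvdE)
  have ABd: "A * (d - 1) = m * B"
    using g unfolding A_def B_def by (auto elim!: dvdE)
  have M0: "M 0 0 = 0" using scale[of 0 0 0] d by (simp add: power_0_left)
  have Minv: "M (u / w) (v / w) = M u v / w ^ d" if "w \<noteq> 0" for u v w
    using scale[of "inverse w" u v] by (simp add: divide_inverse power_inverse mult.commute)
  have scaled: "P (u / w) (v / w) = P u v / w ^ e" if "homogeneous_poly2 e P" for P e u v w
    using homogeneous_poly2_scale[OF that, of "inverse w" u v] by (simp add: divide_inverse power_inverse mult.commute)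
  have Mhyp: "M (hyp_u a b c x) (hyp_v a b c x) \<noteq> 0" if "x \<in> slit_disc" for x
    using slit_disc_curve(1)[OF that] nz by (auto simp: curve_def)
  have Pd: "w ^ d = w ^ (d - 1) * w" for w :: complex using d by (metis Suc_1 Suc_le_lessD less_imp_le less_le_trans power_minus_mult zero_less_numeral gr0I not_numeral_le_zero)
  \<comment> \<open>Homogeneity of degree d gives M(u / M, v / M) = M / M^d. Everything becomes a
    power of the one function M, times x in the last line.\<close>
  have start: "M (u x) (v x) = 1 / M (hyp_u a b c x) (hyp_v a b c x) ^ (d - 1)"
      "Pinf (u x) (v x) = 1 / M (hyp_u a b c x) (hyp_v a b c x) ^ m"
      "P0 (u x) (v x) ^ k = x / M (hyp_u a b c x) (hyp_v a b c x) ^ N" if x: "x \<in> slit_disc" for x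
  proof -
    show "M (u x) (v x) = 1 / M (hyp_u a b c x) (hyp_v a b c x) ^ (d - 1)"
      unfolding u[OF x] v[OF x] Minv[OF Mhyp[OF x]] Pd using Mhyp[OF x] by simp
    show "Pinf (u x) (v x) = 1 / M (hyp_u a b c x) (hyp_v a b c x) ^ m"
      unfolding u[OF x] v[OF x] scaled[OF hom] slit_disc_values(3)[OF x] ..
    show "P0 (u x) (v x) ^ k = x / M (hyp_u a b c x) (hyp_v a b c x) ^ N"
      unfolding u[OF x] v[OF x] scaled[OF hom0] power_divide slit_disc_powers(1)[OF x] N0
      by (simp add: power_mult[symmetric] mult.commute)
  qed
  note ph = homogeneous_poly2_holomorphic[OF hom] homogeneous_poly2_holomorphic[OF hom0] hol
  have rel: "M p q ^ A - Pinf p q ^ B = 0" "x * Pinf p q ^ r - P0 p q ^ k = 0"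
    "M p q ^ n * W x ^ (d - 1) - 1 = 0" if xpq: "(x, p, q) \<in> asch_germ u v" for x p q
  proof -
    show "M p q ^ A - Pinf p q ^ B = 0"
    proof (rule asch_germ_permanence[OF xpq, of "\<lambda>x p q. M p q ^ A - Pinf p q ^ B"])
      fix x assume x: "x \<in> slit_disc"
      show "M (u x) (v x) ^ A - Pinf (u x) (v x) ^ B = 0"
        unfolding start[OF x] using ABd by (simp add: power_divide power_mult[symmetric] mult.commute)
    qed (intro holomorphic_intros ph)
    show "x * Pinf p q ^ r - P0 p q ^ k = 0"
    proof (rule asch_germ_permanence[OF xpq, of "\<lambda>x p q. x * Pinf p q ^ r - P0 p q ^ k"])
      fix x assume x: "x \<in> slit_disc"
      show "x * Pinf (u x) (v x) ^ r - P0 (u x) (v x) ^ k = 0"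
        unfolding start[OF x] using Ninf by (simp add: power_divide power_mult[symmetric] mult.commute)
    qed (intro holomorphic_intros ph)
    \<comment> \<open>M is multivalued in x, but its n-th power is the single-valued
      \<open>W\<close>. The resulting relation keeps the image away from the origin, where Pinf = P0
      = 0 leaves x undetermined.\<close>
    show "M p q ^ n * W x ^ (d - 1) - 1 = 0"
    proof (rule asch_germ_permanence[OF xpq, of "\<lambda>x p q. M p q ^ n * W x ^ (d - 1) - 1"])
      fix x assume x: "x \<in> slit_disc"
      show "M (u x) (v x) ^ n * W x ^ (d - 1) - 1 = 0"
        unfolding start[OF x] W(2)[OF x, symmetric] using Mhyp[OF x]
        by (simp add: power_divide power_mult[symmetric] mult.commute)
    qed (intro holomorphic_intros ph holomorphic_on_subset[OF W(1)]; simp)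
  qed
  show "x = P0 p q ^ k * Pinf p q powi (- int r)" if xpq: "(x, p, q) \<in> asch_germ u v" for x p q
  proof -
    have "Pinf p q \<noteq> 0"
    proof
      assume 0: "Pinf p q = 0"
      hence "P0 p q = 0" using rel(2)[OF xpq] rpos kpos by (simp add: power_0_left)
      with 0 have "p = 0 \<and> q = 0" by (rule common_zero_trivial)
      thus False using rel(3)[OF xpq] M0 W(3) by (simp add: power_0_left)
    qed
    thus ?thesis using rel(2)[OF xpq] by (simp add: power_int_minus field_simps)
  qed
  have germs: "(p / M p q, q / M p q) \<in> ?A" if pq: "(p, q) \<in> curve" for p q
  proof -
    have "(inverse_map (p, q), p / M p q, q / M p q) \<in> asch_germ u v"
    proof (rule curve_in_asch_germ[OF pq, of "\<lambda>p q. p / M p q" "\<lambda>p q. q / M p q"])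
      fix f g :: "complex \<Rightarrow> complex" and S
      assume fg: "f holomorphic_on S" "g holomorphic_on S" "\<forall>x\<in>S. (f x, g x) \<in> curve"
      have "M (f x) (g x) \<noteq> 0" if "x \<in> S" for x using fg(3) that nz by (auto simp: curve_def)
      thus "(\<lambda>x. f x / M (f x) (g x)) holomorphic_on S" "(\<lambda>x. g x / M (f x) (g x)) holomorphic_on S"
        by (intro holomorphic_intros fg hol; simp)+
    qed (simp_all add: u v)
    thus ?thesis by blast
  qed
  have tM: "((\<lambda>t. M (f t) (g t)) \<longlongrightarrow> M p q) F" if "(f \<longlongrightarrow> p) F" "(g \<longlongrightarrow> q) F" for f g p q and F :: "complex filter"
  proof -
    have "isCont (\<lambda>y. M (fst y) (snd y)) (p, q)" using cont by (simp add: continuous_on_eq_continuous_at)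
    from isCont_tendsto_compose[OF this tendsto_Pair[OF that]] show ?thesis by simp
  qed
  show "closure ?A = ?K"
    unfolding A_def[symmetric] B_def[symmetric]
  proof (rule antisym)
    have "closed {(p, q). M p q ^ A - Pinf p q ^ B = 0}"
      by (rule closed_polynomial_curve) (intro continuous_intros homogeneous_poly2_continuous[OF hom] cont)
    moreover have "?A \<subseteq> {(p, q). M p q ^ A - Pinf p q ^ B = 0}" using rel(1) by auto
    ultimately show "closure ?A \<subseteq> {(p, q). M p q ^ A - Pinf p q ^ B = 0}" by (rule closure_minimal[rotated])
    show "{(p, q). M p q ^ A - Pinf p q ^ B = 0} \<subseteq> closure ?A"
    proof safe
      fix p q assume K: "M p q ^ A - Pinf p q ^ B = 0"
      show "(p, q) \<in> closure ?A"
      proof (cases "Pinf p q = 0")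
        case False
        \<comment> \<open>Wanted is \<tau> with \<tau>^m = Pinf(p, q) and \<tau>^(d-1) = M(p, q).
          The root \<sigma> meets the first demand, \<omega> measures its failure in the second, and
          a root of unity \<eta> corrects it.\<close>
        define \<sigma> where "\<sigma> = exp (Ln (Pinf p q) / of_nat m)"
        have s: "\<sigma> ^ m = Pinf p q" "\<sigma> \<noteq> 0"
          unfolding \<sigma>_def using False m_ge by (simp_all flip: exp_of_nat_mult)
        define \<omega> where "\<omega> = M p q / \<sigma> ^ (d - 1)"
        have "\<omega> ^ A = Pinf p q ^ B / \<sigma> ^ ((d - 1) * A)"
          using K by (simp add: \<omega>_def power_divide power_mult)
        also have "(d - 1) * A = m * B" using ABd by (simp add: mult.commute)
        also have "Pinf p q ^ B / \<sigma> ^ (m * B) = 1" using False by (simp add: power_mult s)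
        finally have "\<omega> ^ (m div gcd m (d - 1)) = 1" by (simp add: A_def g_def)
        then obtain \<eta> where e: "\<eta> ^ m = 1" "\<eta> ^ (d - 1) = \<omega>"
          by (rule common_power_root[rotated 2]) (use m_ge d in auto)
        define \<tau> where "\<tau> = \<sigma> * \<eta>"
        have \<eta>: "\<eta> \<noteq> 0" using e(1) m_ge by (auto simp: power_0_left)
        have t: "\<tau> ^ m = Pinf p q" "\<tau> \<noteq> 0" "M p q = \<tau> ^ (d - 1)"
          using e s \<eta> by (simp_all add: \<tau>_def power_mult_distrib \<omega>_def)
        define p' q' where "p' = p / \<tau>" and "q' = q / \<tau>"
        have one: "Pinf p' q' = 1" unfolding p'_def q'_def scaled[OF hom] using t False by simp
        obtain P Q :: "complex \<Rightarrow> complex" where PQ: "(P \<longlongrightarrow> p') (at 0)" "(Q \<longlongrightarrow> q') (at 0)" "\<forall>\<^sub>F t in at 0. (P t, Q t) \<in> curve"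
          using curve_dense[OF one] by blast
        \<comment> \<open>Dividing (p', q') by M(p', q') = 1 / \<tau> leads back to (p, q).\<close>
        have M': "M p' q' = 1 / \<tau>" unfolding p'_def q'_def Minv[OF t(2)] Pd t(3) using t(2) by simp
        hence M'nz: "M p' q' \<noteq> 0" using t(2) by simp
        have "\<forall>\<^sub>F t in at 0. (P t / M (P t) (Q t), Q t / M (P t) (Q t)) \<in> closure ?A"
          using PQ(3) by eventually_elim (use germs closure_subset in blast)
        hence "(p' / M p' q', q' / M p' q') \<in> closure ?A"
          by (rule Lim_in_closed_set[OF closed_closure _ at_neq_bot, rotated, OF
            tendsto_Pair[OF tendsto_divide[OF PQ(1) tM[OF PQ(1,2)] M'nz] tendsto_divide[OF PQ(2) tM[OF PQ(1,2)] M'nz]]])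
        moreover have "p' / M p' q' = p" "q' / M p' q' = q"
          unfolding M' using t(2) by (simp_all add: p'_def q'_def)
        ultimately show ?thesis by simp
      next
        case True
        hence "M p q = 0" using K AB by (simp add: power_0_left)
        hence pq: "p = 0" "q = 0" using common[of p q] True by simp_all
        \<comment> \<open>The origin is a limit of values as z tends to a zero of G: the curve point
          (z, 1) / \<sigma> escapes to infinity, but division by M leaves the factor \<sigma>^(d-1),
          which tends to 0.\<close>
        have "\<exists>i\<in>{1..m}. coeff G i \<noteq> 0" using G_monic m_ge by (intro bexI[of _ m]) auto
        then obtain z where "(\<Sum>i\<le>m. coeff G i * z ^ i) = 0"
          using fundamental_theorem_of_algebra[of "coeff G" m] by blast
        hence z: "poly G z = 0" unfolding poly_altdef G_monic(1) .
        have z1: "poly G0 z \<noteq> 0" "poly G1 z \<noteq> 0" using G_simple_root[OF z] by auto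
        have e1: "P0 x 1 = poly G0 x" "P1 x 1 = poly G1 x" "Pinf x 1 = poly G x" for x
          by (simp_all add: eval0 eval1 eval)
        have Mz: "M z 1 \<noteq> 0" using nz[of z 1] z1 by (simp add: e1)
        define \<sigma> where "\<sigma> = (\<lambda>x. exp (Ln (poly G x) / of_nat m))"
        have "((\<lambda>x. root m (norm (poly G x))) \<longlongrightarrow> root m (norm (poly G z))) (at z)"
          using m_ge by (intro tendsto_real_root tendsto_norm poly_isCont[unfolded isCont_def])
        hence rt: "((\<lambda>x. root m (norm (poly G x))) \<longlongrightarrow> 0) (at z)" using z by simp
        have br: "\<forall>\<^sub>F x in at z. x \<notin> branch" by (intro eventually_at_not_in_finite finite_branch)
        have s: "\<sigma> x ^ m = poly G x" "\<sigma> x \<noteq> 0" if "x \<notin> branch" for x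
          unfolding \<sigma>_def using that m_ge by (simp_all add: branch_iff flip: exp_of_nat_mult)
        have "\<forall>\<^sub>F x in at z. root m (norm (poly G x)) = norm (\<sigma> x)"
          using br
        proof eventually_elim
          case (elim x)
          show ?case using s(1)[OF elim] m_ge by (simp add: norm_power real_root_power_cancel flip: s(1)[OF elim])
        qed
        hence "((\<lambda>x. norm (\<sigma> x)) \<longlongrightarrow> 0) (at z)" using rt by (rule Lim_transform_eventually[rotated])
        hence s0: "(\<sigma> \<longlongrightarrow> 0) (at z)" by (simp add: tendsto_norm_zero_iff)
        have s0d: "((\<lambda>x. \<sigma> x ^ (d - 1)) \<longlongrightarrow> 0) (at z)"
          using tendsto_power[OF s0, of "d - 1"] d by (simp add: power_0_left)
        have lim: "((\<lambda>x. (\<sigma> x ^ (d - 1) * x / M x 1, \<sigma> x ^ (d - 1) * 1 / M x 1)) \<longlongrightarrow> (0 * z / M z 1, 0 * 1 / M z 1)) (at z)"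
          by (intro tendsto_Pair tendsto_divide tendsto_mult s0d tM Mz tendsto_const tendsto_ident_at)
        have "\<forall>\<^sub>F x in at z. (\<sigma> x ^ (d - 1) * x / M x 1, \<sigma> x ^ (d - 1) * 1 / M x 1) \<in> closure ?A"
          using br
        proof eventually_elim
          case (elim x)
          have nzx: "poly G x \<noteq> 0" "poly G0 x \<noteq> 0" "poly G1 x \<noteq> 0" using elim by (auto simp: branch_iff)
          have "(x / \<sigma> x, 1 / \<sigma> x) \<in> curve"
            unfolding curve_def using nzx s[OF elim]
            by (simp add: scaled[OF hom] scaled[OF hom0] scaled[OF hom1] e1)
          moreover have "y / \<sigma> x / (M x 1 / \<sigma> x ^ d) = \<sigma> x ^ (d - 1) * y / M x 1" for y
            unfolding Pd using s(2)[OF elim] by simp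
          ultimately have "(\<sigma> x ^ (d - 1) * x / M x 1, \<sigma> x ^ (d - 1) * 1 / M x 1) \<in> ?A"
            using germs[of "x / \<sigma> x" "1 / \<sigma> x"] unfolding Minv[OF s(2)[OF elim]] by (simp only:)
          thus ?case by (rule subsetD[OF closure_subset])
        qed
        from Lim_in_closed_set[OF closed_closure this at_neq_bot lim] show ?thesis by (simp add: pq)
      qed
    qed
  qed
qed

end

section \<open>The forms of the paper\<close>

lemma polyhedral_exponents:
  assumes "valid_polyhedral T"
  shows "k0 T \<ge> 2" "k1 T \<ge> 2" "kinf T \<ge> 2"
    "polyhedral_order T = k0 T * (polyhedral_order T div k0 T)"
    "polyhedral_order T = k1 T * (polyhedral_order T div k1 T)"
    "polyhedral_order T = kinf T * (polyhedral_order T div kinf T)"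
    "polyhedral_order T div k0 T + polyhedral_order T div k1 T + polyhedral_order T div kinf T = polyhedral_order T + 2"
  using assms by (cases T; simp)+

lemma schwarz_setupI:
  assumes "valid_polyhedral T" "1 - c = 1 / real (k0 T)" "c - a - b = 1 / real (k1 T)" "a - b = 1 / real (kinf T)"
  shows "schwarz_setup a b c (k0 T) (k1 T) (kinf T) (polyhedral_order T) (polyhedral_order T div k0 T)
    (polyhedral_order T div k1 T) (polyhedral_order T div kinf T)"
  by unfold_locales (use polyhedral_exponents[OF assms(1)] assms(2-4) in simp_all)

lemma (in schwarz_params) hyp_uv_UV:
  assumes "x \<noteq> 0"
  shows "hyp_u a b c x = U (x powr (1 / of_nat k))" "hyp_v a b c x = V (x powr (1 / of_nat k))"
    "R (x powr (1 / of_nat k)) = (1 - x) powr (1 / of_nat l)"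
proof -
  have "(x powr (1 / of_nat k)) ^ k = x" using assms kpos by (simp add: powr_power)
  moreover have "complex_of_real (1 - c) = 1 / of_nat k" unfolding exp0 by simp
  ultimately show "hyp_u a b c x = U (x powr (1 / of_nat k))" "hyp_v a b c x = V (x powr (1 / of_nat k))"
    "R (x powr (1 / of_nat k)) = (1 - x) powr (1 / of_nat l)"
    by (simp_all add: hyp_u_def hyp_v_def U_def V_def R_def)
qed

lemma normalised_polysI:
  fixes T :: polyhedral and P0 P1 Pinf :: "complex \<Rightarrow> complex \<Rightarrow> complex"
  defines "m0 \<equiv> polyhedral_order T div k0 T" and "m1 \<equiv> polyhedral_order T div k1 T"
    and "m \<equiv> polyhedral_order T div kinf T"
  assumes T: "valid_polyhedral T"
    and hom: "homogeneous_poly2 m0 P0" "homogeneous_poly2 m1 P1" "homogeneous_poly2 m Pinf"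
    and d0: "\<And>z. (P0 1 has_field_derivative f0' z) (at z)"
    and d1: "\<And>z. (P1 1 has_field_derivative f1' z) (at z)"
    and d: "\<And>z. (Pinf 1 has_field_derivative f' z) (at z)"
    and dd: "\<And>z. (f' has_field_derivative f'' z) (at z)"
    and init: "P0 1 0 = 0" "P1 1 0 = 1" "Pinf 1 0 = 1" "f' 0 = 0"
    and jac0: "\<And>z. of_nat m * Pinf 1 z * f0' z - of_nat m0 * f' z * P0 1 z = of_nat m * P1 1 z ^ (k1 T - 1)"
    and jac1: "\<And>z. of_nat m * Pinf 1 z * f1' z - of_nat m1 * f' z * P1 1 z =
      - (of_nat m * of_nat (k0 T) / of_nat (k1 T)) * P0 1 z ^ (k0 T - 1)"
    and hess: "\<And>z. of_nat m * Pinf 1 z * f'' z - of_nat (m - 1) * f' z ^ 2 =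
      of_nat (m - 1) * (of_nat m / of_nat m0)\<^sup>2 * P0 1 z ^ (k0 T - 2) * P1 1 z ^ (k1 T - 2)"
  shows "normalised_polys T P0 P1 Pinf"
  unfolding normalised_polys_def m0_def[symmetric] m1_def[symmetric] m_def[symmetric]
proof (intro conjI allI impI hom)
  fix a b c :: real
  assume abc: "1 - c = 1 / real (k0 T) \<and> c - a - b = 1 / real (k1 T) \<and> a - b = 1 / real (kinf T)"
  interpret schwarz_setup a b c "k0 T" "k1 T" "kinf T" "polyhedral_order T" m0 m1 m
    unfolding m0_def m1_def m_def using abc by (intro schwarz_setupI T) auto
  have "\<forall>\<^sub>F x in at 0 within - \<real>\<^sub>\<le>\<^sub>0. x \<in> ball (0::complex) 1"
    unfolding eventually_at_filter
    by (rule eventually_mono[OF eventually_nhds_in_open[of "ball 0 1"]]) auto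
  moreover have "\<forall>\<^sub>F x in at 0 within - \<real>\<^sub>\<le>\<^sub>0. x \<noteq> (0::complex)" by (rule eventually_neq_at_within)
  ultimately show "\<forall>\<^sub>F x in at 0 within - \<real>\<^sub>\<le>\<^sub>0.
      P0 (hyp_u a b c x) (hyp_v a b c x) = x powr (1 / of_nat (k0 T)) \<and>
      P1 (hyp_u a b c x) (hyp_v a b c x) = (1 - x) powr (1 / of_nat (k1 T)) \<and>
      Pinf (hyp_u a b c x) (hyp_v a b c x) = 1"
  proof eventually_elim
    case (elim x)
    define s where "s = x powr (1 / of_nat (k0 T))"
    have "norm s ^ k0 T < 1" using elim kpos by (simp add: s_def powr_power flip: norm_power)
    hence s: "s \<in> ball 0 1" using power_less_one_iff[of "norm s" "k0 T"] kpos by simp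
    show ?case
      using germ_identities[OF hom d0 d1 d dd init jac0 jac1 hess s] hyp_uv_UV[OF elim(2)]
      by (simp add: s_def)
  qed
qed

text \<open>For small real s > 0 the principal root of s^k is s itself, so the identities in x hold
  there in the variable s. These points accumulate at 0, and the identity theorem extends the
  identities to the disc.\<close>

lemma normalised_locale:
  assumes T: "valid_polyhedral T" and P: "normalised_polys T P0 P1 Pinf"
    and abc: "1 - c = 1 / real (k0 T)" "c - a - b = 1 / real (k1 T)" "a - b = 1 / real (kinf T)"
  shows "normalised a b c (k0 T) (k1 T) (kinf T) (polyhedral_order T) (polyhedral_order T div k0 T)
    (polyhedral_order T div k1 T) (polyhedral_order T div kinf T) P0 P1 Pinf"
proof -
  interpret schwarz_setup a b c "k0 T" "k1 T" "kinf T" "polyhedral_order T" "polyhedral_order T div k0 T"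
    "polyhedral_order T div k1 T" "polyhedral_order T div kinf T"
    using abc by (intro schwarz_setupI T)
  have hom: "homogeneous_poly2 (polyhedral_order T div k0 T) P0" "homogeneous_poly2 (polyhedral_order T div k1 T) P1"
      "homogeneous_poly2 (polyhedral_order T div kinf T) Pinf"
    and ev: "\<forall>\<^sub>F x in at 0 within - \<real>\<^sub>\<le>\<^sub>0.
      P0 (hyp_u a b c x) (hyp_v a b c x) = x powr (1 / of_nat (k0 T)) \<and>
      P1 (hyp_u a b c x) (hyp_v a b c x) = (1 - x) powr (1 / of_nat (k1 T)) \<and>
      Pinf (hyp_u a b c x) (hyp_v a b c x) = 1"
    using P abc unfolding normalised_polys_def by blast+
  obtain e where e: "e > 0" "\<And>x. x \<notin> \<real>\<^sub>\<le>\<^sub>0 \<Longrightarrow> x \<noteq> 0 \<Longrightarrow> norm x < e \<Longrightarrow>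
      P0 (hyp_u a b c x) (hyp_v a b c x) = x powr (1 / of_nat (k0 T)) \<and>
      P1 (hyp_u a b c x) (hyp_v a b c x) = (1 - x) powr (1 / of_nat (k1 T)) \<and>
      Pinf (hyp_u a b c x) (hyp_v a b c x) = 1"
    using ev unfolding eventually_at by (auto simp: dist_norm)
  define A where "A = complex_of_real ` {0<..<min e 1}"
  have id: "P0 (U s) (V s) = s" "P1 (U s) (V s) = R s" "Pinf (U s) (V s) = 1" if s: "s \<in> A" for s
  proof -
    obtain t where t: "s = of_real t" "0 < t" "t < e" "t < 1" using s by (auto simp: A_def)
    define x where "x = complex_of_real (t ^ k0 T)"
    have tk: "0 < t ^ k0 T" using t by simp
    have "t ^ k0 T \<le> t ^ 1" using t kpos by (intro power_decreasing) auto
    hence xe: "norm x < e" using t tk by (simp add: x_def norm_power)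
    have "Re x > 0" unfolding x_def Re_complex_of_real by (rule tk)
    hence xn: "x \<noteq> 0" "x \<notin> \<real>\<^sub>\<le>\<^sub>0" by (auto simp: complex_nonpos_Reals_iff)
    have "x powr (1 / of_nat (k0 T)) = of_real ((t ^ k0 T) powr (1 / real (k0 T)))"
      unfolding x_def using tk powr_of_real[of "t ^ k0 T" "1 / real (k0 T)"] by simp
    also have "(t ^ k0 T) powr (1 / real (k0 T)) = t"
      using t kpos by (simp add: powr_powr flip: powr_realpow)
    finally have xs: "x powr (1 / of_nat (k0 T)) = s" by (simp add: t)
    show "P0 (U s) (V s) = s" "P1 (U s) (V s) = R s" "Pinf (U s) (V s) = 1"
      using e(2)[OF xn(2,1) xe] hyp_uv_UV[OF xn(1)] unfolding xs by auto
  qed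
  have lim: "0 islimpt A"
    unfolding islimpt_approachable
  proof (intro allI impI)
    fix d :: real assume d: "d > 0"
    define t where "t = min (min e 1) d / 2"
    have t: "0 < t" "t < min e 1" "t < d" using d e(1) by (auto simp: t_def min_def)
    thus "\<exists>x'\<in>A. x' \<noteq> 0 \<and> dist x' 0 < d"
      by (intro bexI[of _ "of_real t"]) (auto simp: A_def)
  qed
  have A: "A \<subseteq> ball 0 1" by (auto simp: A_def)
  have ext: "f s = 0" if "f holomorphic_on ball 0 1" "\<And>s. s \<in> A \<Longrightarrow> f s = 0" "s \<in> ball 0 1" for f s
    by (rule analytic_continuation[OF that(1) _ _ A _ lim that(2,3)]) auto
  note ph = homogeneous_poly2_holomorphic[OF hom(1)] homogeneous_poly2_holomorphic[OF hom(2)]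
    homogeneous_poly2_holomorphic[OF hom(3)]
  show ?thesis
  proof unfold_locales
    fix s :: complex assume s: "s \<in> ball 0 1"
    have "P0 (U s) (V s) - s = 0"
      by (rule ext[OF _ _ s]) (intro holomorphic_intros ph U_holo V_holo, simp add: id)
    thus "P0 (U s) (V s) = s" by simp
    have "P1 (U s) (V s) - R s = 0"
      by (rule ext[OF _ _ s]) (intro holomorphic_intros ph U_holo V_holo R_holo, simp add: id)
    thus "P1 (U s) (V s) = R s" by simp
    have "Pinf (U s) (V s) - 1 = 0"
      by (rule ext[OF _ _ s]) (intro holomorphic_intros ph U_holo V_holo, simp add: id)
    thus "Pinf (U s) (V s) = 1" by simp
  qed (rule hom)+
qed

section \<open>Forms given by lists of coefficients\<close>

lemma homogeneous_poly2_0: "homogeneous_poly2 d (\<lambda>u v. 0)"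
  unfolding homogeneous_poly2_def by (intro exI[of _ "\<lambda>_. 0"]) simp

lemma homogeneous_poly2_monom:
  assumes "i + j = d" shows "homogeneous_poly2 d (\<lambda>u v. c * u ^ i * v ^ j)"
  unfolding homogeneous_poly2_def
proof (intro exI[of _ "\<lambda>n. if n = j then c else 0"] allI)
  fix u v :: complex
  have "(\<Sum>n\<le>d. (if n = j then c else 0) * u ^ (d - n) * v ^ n) = (\<Sum>n\<le>d. if n = j then c * u ^ i * v ^ j else 0)"
    by (intro sum.cong) (use assms in auto)
  also have "\<dots> = c * u ^ i * v ^ j" using assms by simp
  finally show "c * u ^ i * v ^ j = (\<Sum>n\<le>d. (if n = j then c else 0) * u ^ (d - n) * v ^ n)" ..
qed

lemma homogeneous_poly2_add:
  assumes "homogeneous_poly2 d P" "homogeneous_poly2 d Q"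
  shows "homogeneous_poly2 d (\<lambda>u v. P u v + Q u v)"
proof -
  obtain h g where "\<And>u v. P u v = (\<Sum>j\<le>d. h j * u ^ (d - j) * v ^ j)" "\<And>u v. Q u v = (\<Sum>j\<le>d. g j * u ^ (d - j) * v ^ j)"
    using assms unfolding homogeneous_poly2_def by blast
  thus ?thesis unfolding homogeneous_poly2_def
    by (intro exI[of _ "\<lambda>j. h j + g j"]) (simp add: sum.distrib algebra_simps)
qed

lemma homogeneous_poly2_cmult:
  assumes "homogeneous_poly2 d P"
  shows "homogeneous_poly2 d (\<lambda>u v. c * P u v)"
proof -
  obtain h where "\<And>u v. P u v = (\<Sum>j\<le>d. h j * u ^ (d - j) * v ^ j)"
    using assms unfolding homogeneous_poly2_def by blast
  thus ?thesis unfolding homogeneous_poly2_def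
    by (intro exI[of _ "\<lambda>j. c * h j"]) (simp add: sum_distrib_left mult_ac)
qed

lemma homogeneous_poly2_sum:
  assumes "\<And>i. i \<in> A \<Longrightarrow> homogeneous_poly2 d (P i)"
  shows "homogeneous_poly2 d (\<lambda>u v. \<Sum>i\<in>A. P i u v)"
  using assms
  by (induction A rule: infinite_finite_induct) (auto intro: homogeneous_poly2_0 homogeneous_poly2_add)

text \<open>A pair (j, c) stands for the monomial c u^(d-j) v^j. On an explicit list,
  differentiation on the line u = 1 becomes a computation with \<open>dlist\<close>.\<close>

definition form :: "nat \<Rightarrow> (nat \<times> complex) list \<Rightarrow> complex \<Rightarrow> complex \<Rightarrow> complex" where
  "form d xs u v = (\<Sum>(j, c)\<leftarrow>xs. c * u ^ (d - j) * v ^ j)"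

definition dehom :: "(nat \<times> complex) list \<Rightarrow> complex \<Rightarrow> complex" where
  "dehom xs z = (\<Sum>(j, c)\<leftarrow>xs. c * z ^ j)"

text \<open>A constant term (0, c) yields the pair (0, 0), so the truncated subtraction does no
  harm.\<close>

definition dlist :: "(nat \<times> complex) list \<Rightarrow> (nat \<times> complex) list" where
  "dlist xs = map (\<lambda>(j, c). (j - 1, c * of_nat j)) xs"

lemma form_homogeneous: "\<forall>(j, c)\<in>set xs. j \<le> d \<Longrightarrow> homogeneous_poly2 d (form d xs)"
proof (induction xs)
  case Nil
  thus ?case using homogeneous_poly2_0 by (simp add: form_def[abs_def])
next
  case (Cons x xs)
  obtain j c where x: "x = (j, c)" by (cases x)
  have "form d (x # xs) = (\<lambda>u v. c * u ^ (d - j) * v ^ j + form d xs u v)"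
    by (intro ext) (simp add: form_def x)
  moreover have "homogeneous_poly2 d (\<lambda>u v. c * u ^ (d - j) * v ^ j)" using Cons x by (intro homogeneous_poly2_monom) auto
  ultimately show ?case using Cons by (simp add: homogeneous_poly2_add)
qed

lemma form_dehom: "form d xs 1 = dehom xs"
  by (intro ext) (simp add: form_def dehom_def)

lemma dehom_deriv: "(dehom xs has_field_derivative dehom (dlist xs) z) (at z)"
proof (induction xs)
  case Nil
  thus ?case by (simp add: dehom_def[abs_def] dlist_def)
next
  case (Cons x xs)
  obtain j c where x: "x = (j, c)" by (cases x)
  have "dehom (x # xs) = (\<lambda>z. c * z ^ j + dehom xs z)" "dehom (dlist (x # xs)) z = c * (of_nat j * z ^ (j - 1)) + dehom (dlist xs) z"
    by (auto simp: dehom_def dlist_def x)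
  thus ?case using DERIV_add[OF DERIV_cmult[OF DERIV_power_complex] Cons] by simp
qed

text \<open>An opaque equality: the simplifier evaluates its two sides without cancelling common factors.\<close>

definition holds_eq :: "complex \<Rightarrow> complex \<Rightarrow> bool" where
  "holds_eq x y \<longleftrightarrow> x = y"

lemma holds_eqI: "x = y \<Longrightarrow> holds_eq x y"
  by (simp add: holds_eq_def)

text \<open>For explicit coefficient lists the Jacobian and Hessian relations are polynomial
  identities in z with rational coefficients, open to direct computation.\<close>

lemma form_normalised:
  fixes T :: polyhedral
  defines "m0 \<equiv> polyhedral_order T div k0 T" and "m1 \<equiv> polyhedral_order T div k1 T"
    and "m \<equiv> polyhedral_order T div kinf T"
  assumes "valid_polyhedral T"
    and "P0 = form m0 xs0" "P1 = form m1 xs1" "Pinf = form m xs"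
    and "\<forall>(j, c)\<in>set xs0. j \<le> m0" "\<forall>(j, c)\<in>set xs1. j \<le> m1" "\<forall>(j, c)\<in>set xs. j \<le> m"
    and "dehom xs0 0 = 0" "dehom xs1 0 = 1" "dehom xs 0 = 1" "dehom (dlist xs) 0 = 0"
    and "\<And>z. holds_eq (of_nat m * dehom xs z * dehom (dlist xs0) z - of_nat m0 * dehom (dlist xs) z * dehom xs0 z)
      (of_nat m * dehom xs1 z ^ (k1 T - 1))"
    and "\<And>z. holds_eq (of_nat m * dehom xs z * dehom (dlist xs1) z - of_nat m1 * dehom (dlist xs) z * dehom xs1 z)
      (- (of_nat m * of_nat (k0 T) / of_nat (k1 T)) * dehom xs0 z ^ (k0 T - 1))"
    and "\<And>z. holds_eq (of_nat m * dehom xs z * dehom (dlist (dlist xs)) z - of_nat (m - 1) * dehom (dlist xs) z ^ 2)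
      (of_nat (m - 1) * (of_nat m / of_nat m0)\<^sup>2 * dehom xs0 z ^ (k0 T - 2) * dehom xs1 z ^ (k1 T - 2))"
  shows "normalised_polys T P0 P1 Pinf"
  unfolding assms(5-7)
  by (rule normalised_polysI[OF assms(4), folded m0_def m1_def m_def, where f0' = "dehom (dlist xs0)"
      and f1' = "dehom (dlist xs1)" and f' = "dehom (dlist xs)" and f'' = "dehom (dlist (dlist xs))", unfolded form_dehom])
     (rule form_homogeneous dehom_deriv assms assms(15-)[unfolded holds_eq_def] | (unfold form_dehom, rule dehom_deriv assms))+

lemma sum_even_odd: "(\<Sum>i = 0..M. F (2 * i) + F (2 * i + 1)) = (\<Sum>j\<le>2 * M + 1. F j)"
  for F :: "nat \<Rightarrow> 'a::comm_monoid_add"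
  by (induction M) (simp_all add: add_ac)

text \<open>The even and odd parts of (u + w)^n in w. They express the sums in the dihedral forms by
  the powers (u + w)^n and (u - w)^n, which are easily differentiated.\<close>

lemma binomial_even_odd:
  fixes u w :: complex and n :: nat
  defines "Ev \<equiv> (\<Sum>i = 0..n div 2. of_nat (n choose (2 * i)) * u ^ (n - 2 * i) * w ^ (2 * i))"
    and "Od \<equiv> (\<Sum>i = 0..n div 2. of_nat (n choose (2 * i + 1)) * u ^ (n - 2 * i - 1) * w ^ (2 * i + 1))"
  shows "Ev = ((u + w) ^ n + (u - w) ^ n) / 2" "Od = ((u + w) ^ n - (u - w) ^ n) / 2"
proof -
  have expand: "(u + x) ^ n = (\<Sum>i = 0..n div 2. of_nat (n choose (2 * i)) * u ^ (n - 2 * i) * x ^ (2 * i) +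
      of_nat (n choose (2 * i + 1)) * u ^ (n - (2 * i + 1)) * x ^ (2 * i + 1))" for x
  proof -
    define F where "F = (\<lambda>j. of_nat (n choose j) * u ^ (n - j) * x ^ j)"
    have "(u + x) ^ n = (\<Sum>j\<le>n. F j)"
      unfolding add.commute[of u x] binomial_ring by (intro sum.cong) (simp_all add: F_def mult_ac)
    \<comment> \<open>For even n the new upper bound is n + 1, where the binomial coefficient
      vanishes.\<close>
    also have "\<dots> = (\<Sum>j\<le>2 * (n div 2) + 1. F j)"
      by (intro sum.mono_neutral_left) (auto simp: F_def binomial_eq_0)
    also have "\<dots> = (\<Sum>i = 0..n div 2. F (2 * i) + F (2 * i + 1))" by (rule sum_even_odd[symmetric])
    finally show ?thesis unfolding F_def .
  qed
  have "(u + w) ^ n = Ev + Od" unfolding expand Ev_def Od_def by (simp add: sum.distrib)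
  moreover have "(u - w) ^ n = Ev - Od"
    using expand[of "- w"] unfolding Ev_def Od_def by (simp add: sum.distrib sum_negf sum_subtractf)
  ultimately show "Ev = ((u + w) ^ n + (u - w) ^ n) / 2" "Od = ((u + w) ^ n - (u - w) ^ n) / 2" by simp_all
qed

lemma binomial_even_homogeneous:
  "homogeneous_poly2 n (\<lambda>u v. \<Sum>i = 0..n div 2. of_nat (n choose (2 * i)) * u ^ (n - 2 * i) * (v / e) ^ (2 * i))"
proof (rule homogeneous_poly2_sum)
  fix i assume "i \<in> {0..n div 2}"
  hence "homogeneous_poly2 n (\<lambda>u v. of_nat (n choose (2 * i)) / e ^ (2 * i) * u ^ (n - 2 * i) * v ^ (2 * i))"
    by (intro homogeneous_poly2_monom) auto
  thus "homogeneous_poly2 n (\<lambda>u v. of_nat (n choose (2 * i)) * u ^ (n - 2 * i) * (v / e) ^ (2 * i))"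
    by (simp add: power_divide)
qed

lemma binomial_odd_homogeneous:
  "homogeneous_poly2 n (\<lambda>u v. \<Sum>i = 0..n div 2. of_nat (n choose (2 * i + 1)) * u ^ (n - 2 * i - 1) * (v / e) ^ (2 * i + 1))"
proof (rule homogeneous_poly2_sum)
  fix i assume i: "i \<in> {0..n div 2}"
  show "homogeneous_poly2 n (\<lambda>u v. of_nat (n choose (2 * i + 1)) * u ^ (n - 2 * i - 1) * (v / e) ^ (2 * i + 1))"
  proof (cases "2 * i + 1 \<le> n")
    case True
    hence "homogeneous_poly2 n (\<lambda>u v. of_nat (n choose (2 * i + 1)) / e ^ (2 * i + 1) * u ^ (n - 2 * i - 1) * v ^ (2 * i + 1))"
      by (intro homogeneous_poly2_monom) auto
    thus ?thesis by (simp add: power_divide)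
  qed (simp add: binomial_eq_0 homogeneous_poly2_0)
qed

section \<open>The dihedral forms\<close>

lemma homogeneous_quadratic: "homogeneous_poly2 2 (\<lambda>u v. u ^ 2 + c * v ^ 2)"
  using homogeneous_poly2_add[OF homogeneous_poly2_monom[of 2 0 2 1] homogeneous_poly2_monom[of 0 2 2 c]] by simp

lemma DERIV_linear_power:
  fixes z :: complex
  assumes "e \<noteq> 0"
  shows "((\<lambda>z. (1 + z / e) ^ n) has_field_derivative of_nat n / e * (1 + z / e) ^ (n - 1)) (at z)"
    "((\<lambda>z. (1 - z / e) ^ n) has_field_derivative - (of_nat n / e * (1 - z / e) ^ (n - 1))) (at z)"
proof -
  have "((\<lambda>z. 1 + z / e) has_field_derivative 1 / e) (at z)" "((\<lambda>z. 1 - z / e) has_field_derivative - (1 / e)) (at z)"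
    using assms by (auto intro!: derivative_eq_intros)
  from DERIV_power[OF this(1), of n] DERIV_power[OF this(2), of n]
  show "((\<lambda>z. (1 + z / e) ^ n) has_field_derivative of_nat n / e * (1 + z / e) ^ (n - 1)) (at z)"
    "((\<lambda>z. (1 - z / e) ^ n) has_field_derivative - (of_nat n / e * (1 - z / e) ^ (n - 1))) (at z)" by simp_all
qed

text \<open>In y = z / (i n) the form Pinf(1, z) is (1 + y) (1 - y), and the other two are
  combinations of (1 + y)^n and (1 - y)^n; this makes the relations identities between these
  powers.\<close>

lemma D1_normalised:
  assumes n: "n \<ge> 2" and P: "polyhedral_polys (D1 n) P0 P1 Pinf"
  shows "normalised_polys (D1 n) P0 P1 Pinf"
proof -
  define N :: complex where "N = of_nat n"
  define e where "e = \<i> * N"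
  have N: "N \<noteq> 0" using n by (simp add: N_def)
  hence e: "e \<noteq> 0" by (simp add: e_def)
  have P0: "P0 = (\<lambda>u v. \<i> * (((u + v / e) ^ n - (u - v / e) ^ n) / 2))"
    and P1: "P1 = (\<lambda>u v. ((u + v / e) ^ n + (u - v / e) ^ n) / 2)"
    and Pinf: "Pinf = (\<lambda>u v. u ^ 2 + 1 / N\<^sup>2 * v ^ 2)"
    using P by (simp_all add: binomial_even_odd[symmetric] e_def N_def)
  define f0' f1' f' f'' where "f0' = (\<lambda>z. ((1 + z / e) ^ (n - 1) + (1 - z / e) ^ (n - 1)) / 2)"
    and "f1' = (\<lambda>z. ((1 + z / e) ^ (n - 1) - (1 - z / e) ^ (n - 1)) / (2 * \<i>))"
    and "f' = (\<lambda>z. 2 * z / N\<^sup>2)" and "f'' = (\<lambda>z::complex. 2 / N\<^sup>2)"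
  have ord: "k0 (D1 n) = 2" "k1 (D1 n) = 2" "kinf (D1 n) = n"
    "polyhedral_order (D1 n) div 2 = n" "polyhedral_order (D1 n) div n = 2" using n by simp_all
  have hom: "homogeneous_poly2 n P0"
    using P homogeneous_poly2_cmult[OF binomial_odd_homogeneous, of n "\<i>" e] by (simp add: e_def N_def)
  have hom1: "homogeneous_poly2 n P1" using P binomial_even_homogeneous by simp
  have hom2: "homogeneous_poly2 2 Pinf" unfolding Pinf by (rule homogeneous_quadratic)
  have d0: "(P0 1 has_field_derivative f0' z) (at z)" for z
    using DERIV_cmult[OF DERIV_cdivide[OF DERIV_diff[OF DERIV_linear_power[OF e, of n z]], of 2], of "\<i>"]
    unfolding P0 f0'_def N_def[symmetric] by (rule DERIV_cong) (use N in \<open>simp add: e_def field_simps\<close>)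
  have d1: "(P1 1 has_field_derivative f1' z) (at z)" for z
    using DERIV_cdivide[OF DERIV_add[OF DERIV_linear_power[OF e, of n z]], of 2]
    unfolding P1 f1'_def N_def[symmetric] by (rule DERIV_cong) (use N in \<open>simp add: e_def field_simps\<close>)
  have d: "(Pinf 1 has_field_derivative f' z) (at z)" for z
    using DERIV_add[OF DERIV_const[of "1 ^ 2"] DERIV_cmult[OF DERIV_power_complex[of 2 z], of "1 / N\<^sup>2"]]
    unfolding Pinf f'_def by simp
  have dd: "(f' has_field_derivative f'' z) (at z)" for z
    using DERIV_cmult[OF DERIV_ident, of "2 / N\<^sup>2"] unfolding f'_def f''_def by simp
  have rep: "z / e = y \<Longrightarrow> z = \<i> * N * y" for z y using e by (auto simp: e_def)
  have Pw: "y ^ n = y * y ^ (n - 1)" for y :: complex using n by (metis power_eq_if not_numeral_le_zero)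
  have jac0: "of_nat 2 * Pinf 1 z * f0' z - of_nat n * f' z * P0 1 z = of_nat 2 * P1 1 z ^ (2 - 1)" for z
  proof -
    define y A B where "y = z / e" and "A = (1 + y) ^ (n - 1)" and "B = (1 - y) ^ (n - 1)"
    show ?thesis
      unfolding Pinf P0 P1 f0'_def f'_def Pw y_def[symmetric] A_def[symmetric] B_def[symmetric] N_def[symmetric]
      unfolding rep[OF y_def[symmetric]] using N by (simp add: field_simps power2_eq_square)
  qed
  have jac1: "of_nat 2 * Pinf 1 z * f1' z - of_nat n * f' z * P1 1 z = - (of_nat 2 * of_nat 2 / of_nat 2) * P0 1 z ^ (2 - 1)" for z
  proof -
    define y A B where "y = z / e" and "A = (1 + y) ^ (n - 1)" and "B = (1 - y) ^ (n - 1)"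
    show ?thesis
      unfolding Pinf P0 P1 f1'_def f'_def Pw y_def[symmetric] A_def[symmetric] B_def[symmetric] N_def[symmetric]
      unfolding rep[OF y_def[symmetric]] using N by (simp add: field_simps power2_eq_square)
  qed
  have hess: "of_nat 2 * Pinf 1 z * f'' z - of_nat (2 - 1) * f' z ^ 2 =
      of_nat (2 - 1) * (of_nat 2 / of_nat n)\<^sup>2 * P0 1 z ^ (2 - 2) * P1 1 z ^ (2 - 2)" for z
    unfolding Pinf f'_def f''_def N_def[symmetric] using N by (simp add: field_simps power2_eq_square)
  have init: "P0 1 0 = 0" "P1 1 0 = 1" "Pinf 1 0 = 1" "f' 0 = 0" by (simp_all add: P0 P1 Pinf f'_def)
  show ?thesis
    by (rule normalised_polysI[of "D1 n" P0 P1 Pinf f0' f1' f' f'', unfolded ord])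
       (rule hom hom1 hom2 d0 d1 d dd init jac0 jac1 hess | simp add: n)+
qed

text \<open>Here y = z / n, the product (1 + y) (1 - y) is P1(1, z), and P0, Pinf are half the
  difference and half the sum of (1 + y)^n and (1 - y)^n.\<close>

lemma D2_normalised:
  assumes n: "n \<ge> 2" and P: "polyhedral_polys (D2 n) P0 P1 Pinf"
  shows "normalised_polys (D2 n) P0 P1 Pinf"
proof -
  define e where "e = complex_of_nat n"
  have e: "e \<noteq> 0" using n by (auto simp: e_def)
  obtain i where i: "n = Suc (Suc i)" using n by (metis Suc_le_D numeral_2_eq_2 Suc_le_mono)
  have P0: "P0 = (\<lambda>u v. ((u + v / e) ^ n - (u - v / e) ^ n) / 2)"
    and Pinf: "Pinf = (\<lambda>u v. ((u + v / e) ^ n + (u - v / e) ^ n) / 2)"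
    and P1: "P1 = (\<lambda>u v. u ^ 2 + - (1 / e\<^sup>2) * v ^ 2)"
    using P by (simp_all add: binomial_even_odd[symmetric] e_def)
  define f0' f1' f' f'' where "f0' = (\<lambda>z. ((1 + z / e) ^ (n - 1) + (1 - z / e) ^ (n - 1)) / 2)"
    and "f1' = (\<lambda>z. - 2 * z / e\<^sup>2)" and "f' = (\<lambda>z. ((1 + z / e) ^ (n - 1) - (1 - z / e) ^ (n - 1)) / 2)"
    and "f'' = (\<lambda>z. (e - 1) / e * ((1 + z / e) ^ (n - 2) + (1 - z / e) ^ (n - 2)) / 2)"
  have ord: "k0 (D2 n) = 2" "k1 (D2 n) = n" "kinf (D2 n) = 2"
    "polyhedral_order (D2 n) div 2 = n" "polyhedral_order (D2 n) div n = 2" using n by simp_all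
  have e1: "complex_of_nat (n - 1) = e - 1" using n by (simp add: e_def of_nat_diff)
  have hom: "homogeneous_poly2 n P0" "homogeneous_poly2 n Pinf"
    using P binomial_odd_homogeneous binomial_even_homogeneous by simp_all
  have hom1: "homogeneous_poly2 2 P1" unfolding P1 by (rule homogeneous_quadratic)
  have d0: "(P0 1 has_field_derivative f0' z) (at z)" for z
    using DERIV_cdivide[OF DERIV_diff[OF DERIV_linear_power[OF e, of n z]], of 2]
    unfolding P0 f0'_def e_def[symmetric] by (rule DERIV_cong) (use e in \<open>simp add: field_simps\<close>)
  have d: "(Pinf 1 has_field_derivative f' z) (at z)" for z
    using DERIV_cdivide[OF DERIV_add[OF DERIV_linear_power[OF e, of n z]], of 2]
    unfolding Pinf f'_def e_def[symmetric] by (rule DERIV_cong) (use e in \<open>simp add: field_simps\<close>)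
  have d1: "(P1 1 has_field_derivative f1' z) (at z)" for z
    using DERIV_add[OF DERIV_const[of "1 ^ 2"] DERIV_cmult[OF DERIV_power_complex[of 2 z], of "- (1 / e\<^sup>2)"]]
    unfolding P1 f1'_def by simp
  have dd: "(f' has_field_derivative f'' z) (at z)" for z
    using DERIV_cdivide[OF DERIV_diff[OF DERIV_linear_power[OF e, of "n - 1" z]], of 2]
    unfolding f'_def f''_def e1 by (rule DERIV_cong) (use e in \<open>simp add: field_simps numeral_2_eq_2\<close>)
  have rep: "z / e = y \<Longrightarrow> z = y * e" for z y using e by auto
  have pw: "w ^ n = w * w * w ^ i" "w ^ (n - 1) = w * w ^ i" "w ^ (n - 2) = w ^ i" for w :: complex by (simp_all add: i)
  have P1': "P1 1 z = (1 + z / e) * (1 - z / e)" for z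
    unfolding P1 using e by (simp add: field_simps power2_eq_square)
  have jac0: "of_nat n * Pinf 1 z * f0' z - of_nat n * f' z * P0 1 z = of_nat n * P1 1 z ^ (n - 1)" for z
  proof -
    define y A B where "y = z / e" and "A = (1 + y) ^ i" and "B = (1 - y) ^ i"
    show ?thesis
      unfolding Pinf P0 P1' f0'_def f'_def power_mult_distrib pw y_def[symmetric] A_def[symmetric] B_def[symmetric] e_def[symmetric]
      by (simp add: field_simps)
  qed
  have jac1: "of_nat n * Pinf 1 z * f1' z - of_nat 2 * f' z * P1 1 z = - (of_nat n * of_nat 2 / of_nat n) * P0 1 z ^ (2 - 1)" for z
  proof -
    define y A B where "y = z / e" and "A = (1 + y) ^ i" and "B = (1 - y) ^ i"
    show ?thesis
      unfolding Pinf P0 P1' f1'_def f'_def pw y_def[symmetric] A_def[symmetric] B_def[symmetric] e_def[symmetric]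
      unfolding rep[OF y_def[symmetric]] using e by (simp add: field_simps power2_eq_square)
  qed
  have hess: "of_nat n * Pinf 1 z * f'' z - of_nat (n - 1) * f' z ^ 2 =
      of_nat (n - 1) * (of_nat n / of_nat n)\<^sup>2 * P0 1 z ^ (2 - 2) * P1 1 z ^ (n - 2)" for z
  proof -
    define y A B where "y = z / e" and "A = (1 + y) ^ i" and "B = (1 - y) ^ i"
    show ?thesis
      unfolding Pinf P1' f'_def f''_def power_mult_distrib pw y_def[symmetric] A_def[symmetric] B_def[symmetric] e1 e_def[symmetric]
      using e by (simp add: field_simps power2_eq_square)
  qed
  have init: "P0 1 0 = 0" "P1 1 0 = 1" "Pinf 1 0 = 1" "f' 0 = 0" by (simp_all add: P0 P1 Pinf f'_def)
  show ?thesis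
    by (rule normalised_polysI[of "D2 n" P0 P1 Pinf f0' f1' f' f'', unfolded ord])
       (rule hom hom1 d0 d1 d dd init jac0 jac1 hess | simp add: n)+
qed

lemma D3_normalised:
  assumes n: "n \<ge> 2" and P: "polyhedral_polys (D3 n) P0 P1 Pinf"
  shows "normalised_polys (D3 n) P0 P1 Pinf"
proof -
  obtain i where i: "n = Suc (Suc i)" using n by (metis Suc_le_D numeral_2_eq_2 Suc_le_mono)
  define e where "e = complex_of_nat n"
  have e: "e \<noteq> 0" using n by (auto simp: e_def)
  have P0: "P0 = (\<lambda>u v. 1 * u ^ 1 * v ^ 1)" and P1: "P1 = (\<lambda>u v. 1 * u ^ n * v ^ 0 + (- 1 / 4) * u ^ 0 * v ^ n)"
    and Pinf: "Pinf = (\<lambda>u v. 1 * u ^ n * v ^ 0 + (1 / 4) * u ^ 0 * v ^ n)"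
    using P by simp_all
  define f0' f1' f' f'' :: "complex \<Rightarrow> complex" where "f0' = (\<lambda>z. 1)" and "f1' = (\<lambda>z. - e / 4 * z ^ (n - 1))"
    and "f' = (\<lambda>z. e / 4 * z ^ (n - 1))" and "f'' = (\<lambda>z. e * (e - 1) / 4 * z ^ (n - 2))"
  have ord: "k0 (D3 n) = n" "k1 (D3 n) = 2" "kinf (D3 n) = 2"
    "polyhedral_order (D3 n) div 2 = n" "polyhedral_order (D3 n) div n = 2" using n by simp_all
  have e1: "complex_of_nat (n - 1) = e - 1" using n by (simp add: e_def of_nat_diff)
  have hom: "homogeneous_poly2 2 P0" unfolding P0 by (rule homogeneous_poly2_monom) simp
  have hom1: "homogeneous_poly2 n P1" "homogeneous_poly2 n Pinf" unfolding P1 Pinf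
    by (intro homogeneous_poly2_add homogeneous_poly2_monom; simp)+
  have P01: "P0 1 z = z" "P1 1 z = 1 - z ^ n / 4" "Pinf 1 z = 1 + z ^ n / 4" for z by (simp_all add: P0 P1 Pinf)
  have d0: "(P0 1 has_field_derivative f0' z) (at z)" for z unfolding P0 f0'_def by simp
  have d1: "(P1 1 has_field_derivative f1' z) (at z)" for z
    using DERIV_add[OF DERIV_const[of 1] DERIV_cmult[OF DERIV_power_complex[of n z], of "- 1 / 4"]] by (simp add: P1 f1'_def e_def)
  have d: "(Pinf 1 has_field_derivative f' z) (at z)" for z
    using DERIV_add[OF DERIV_const[of 1] DERIV_cmult[OF DERIV_power_complex[of n z], of "1 / 4"]] by (simp add: Pinf f'_def e_def)
  have dd: "(f' has_field_derivative f'' z) (at z)" for z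
    using DERIV_cmult[OF DERIV_power_complex[of "n - 1" z], of "e / 4"] unfolding e1 f'_def f''_def
    by (rule DERIV_cong) (simp add: numeral_2_eq_2)
  have pw: "z ^ n = z * z * z ^ i" "z ^ (n - 1) = z * z ^ i" "z ^ (n - 2) = z ^ i" for z :: complex by (simp_all add: i)
  have jac0: "of_nat n * Pinf 1 z * f0' z - of_nat 2 * f' z * P0 1 z = of_nat n * P1 1 z ^ (2 - 1)" for z
    unfolding P01 f0'_def f'_def pw e_def[symmetric] by (simp add: field_simps)
  have jac1: "of_nat n * Pinf 1 z * f1' z - of_nat n * f' z * P1 1 z = - (of_nat n * of_nat n / of_nat 2) * P0 1 z ^ (n - 1)" for z
    unfolding P01 f1'_def f'_def pw e_def[symmetric] by (simp add: field_simps)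
  have hess: "of_nat n * Pinf 1 z * f'' z - of_nat (n - 1) * f' z ^ 2 =
      of_nat (n - 1) * (of_nat n / of_nat 2)\<^sup>2 * P0 1 z ^ (n - 2) * P1 1 z ^ (2 - 2)" for z
    unfolding P01 f'_def f''_def pw e1 e_def[symmetric] by (simp add: field_simps power2_eq_square)
  have init: "P0 1 0 = 0" "P1 1 0 = 1" "Pinf 1 0 = 1" "f' 0 = 0"
    using n by (simp_all add: P01 f'_def power_0_left)
  show ?thesis
    by (rule normalised_polysI[of "D3 n" P0 P1 Pinf f0' f1' f' f'', unfolded ord])
       (rule hom hom1 d0 d1 d dd init jac0 jac1 hess | simp add: n)+
qed

section \<open>The explicit tetrahedral, octahedral and icosahedral forms\<close>

lemma T1_normalised:
  assumes "polyhedral_polys T1 P0 P1 Pinf"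
  shows "normalised_polys T1 P0 P1 Pinf"
\<comment> \<open>The lists record the powers of v and their coefficients; the three relations are
  then checked as ring identities in z.\<close>
proof (rule form_normalised[where
      ?xs0.0 = "[(1, 1), (5, 1/432)]" and
      ?xs1.0 = "[(0, 1), (2, - 1/6), (4, - 1/432)]" and
      xs = "[(0, 1), (2, 1/6), (4, - 1/432)]"])
qed (use assms in \<open>simp add: form_def fun_eq_iff; fail\<close> | (simp add: dehom_def dlist_def; fail) |
    (simp add: dehom_def dlist_def del: times_divide_eq_left times_divide_eq_right, rule holds_eqI, algebra))+

lemma T2_normalised:
  assumes "polyhedral_polys T2 P0 P1 Pinf"
  shows "normalised_polys T2 P0 P1 Pinf"
proof (rule form_normalised[where
      ?xs0.0 = "[(1, 1), (4, - 1/64)]" and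
      ?xs1.0 = "[(0, 1), (3, - 5/16), (6, - 1/512)]" and
      xs = "[(0, 1), (3, 1/8)]"])
qed (use assms in \<open>simp add: form_def fun_eq_iff; fail\<close> | (simp add: dehom_def dlist_def; fail) |
    (simp add: dehom_def dlist_def del: times_divide_eq_left times_divide_eq_right, rule holds_eqI, algebra))+

lemma T3_normalised:
  assumes "polyhedral_polys T3 P0 P1 Pinf"
  shows "normalised_polys T3 P0 P1 Pinf"
proof (rule form_normalised[where
      ?xs0.0 = "[(1, 1), (4, 1/64)]" and
      ?xs1.0 = "[(0, 1), (3, - 1/8)]" and
      xs = "[(0, 1), (3, 5/16), (6, - 1/512)]"])
qed (use assms in \<open>simp add: form_def fun_eq_iff; fail\<close> | (simp add: dehom_def dlist_def; fail) |
    (simp add: dehom_def dlist_def del: times_divide_eq_left times_divide_eq_right, rule holds_eqI, algebra))+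

lemma O1_normalised:
  assumes "polyhedral_polys O1 P0 P1 Pinf"
  shows "normalised_polys O1 P0 P1 Pinf"
proof (rule form_normalised[where
      ?xs0.0 = "[(1, 1), (3, - 11/432), (5, 11/3456), (7, 11/165888), (9, - 11/47775744), (11, 1/254803968)]" and
      ?xs1.0 = "[(0, 1), (2, - 7/36), (4, - 7/3456), (6, - 7/82944), (8, 1/5308416)]" and
      xs = "[(0, 1), (2, 5/48), (4, - 5/2304), (6, - 1/110592)]"])
qed (use assms in \<open>simp add: form_def fun_eq_iff; fail\<close> | (simp add: dehom_def dlist_def; fail) |
    (simp add: dehom_def dlist_def del: times_divide_eq_left times_divide_eq_right, rule holds_eqI, algebra))+

lemma O2_normalised:
  assumes "polyhedral_polys O2 P0 P1 Pinf"
  shows "normalised_polys O2 P0 P1 Pinf"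
proof (rule form_normalised[where
      ?xs0.0 = "[(1, 1), (3, 11/432), (5, 11/3456), (7, - 11/165888), (9, - 11/47775744), (11, - 1/254803968)]" and
      ?xs1.0 = "[(0, 1), (2, - 5/48), (4, - 5/2304), (6, 1/110592)]" and
      xs = "[(0, 1), (2, 7/36), (4, - 7/3456), (6, 7/82944), (8, 1/5308416)]"])
qed (use assms in \<open>simp add: form_def fun_eq_iff; fail\<close> | (simp add: dehom_def dlist_def; fail) |
    (simp add: dehom_def dlist_def del: times_divide_eq_left times_divide_eq_right, rule holds_eqI, algebra))+

lemma O3_normalised:
  assumes "polyhedral_polys O3 P0 P1 Pinf"
  shows "normalised_polys O3 P0 P1 Pinf"
proof (rule form_normalised[where
      ?xs0.0 = "[(1, 1), (4, - 7/256), (7, - 1/8192)]" and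
      ?xs1.0 = "[(0, 1), (3, - 11/32), (9, - 11/262144), (12, - 1/67108864)]" and
      xs = "[(0, 1), (3, 5/64), (6, - 1/8192)]"])
qed (use assms in \<open>simp add: form_def fun_eq_iff; fail\<close> | (simp add: dehom_def dlist_def; fail) |
    (simp add: dehom_def dlist_def del: times_divide_eq_left times_divide_eq_right, rule holds_eqI, algebra))+

lemma O4_normalised:
  assumes "polyhedral_polys O4 P0 P1 Pinf"
  shows "normalised_polys O4 P0 P1 Pinf"
proof (rule form_normalised[where
      ?xs0.0 = "[(1, 1), (4, 7/256), (7, - 1/8192)]" and
      ?xs1.0 = "[(0, 1), (3, - 5/64), (6, - 1/8192)]" and
      xs = "[(0, 1), (3, 11/32), (9, 11/262144), (12, - 1/67108864)]"])
qed (use assms in \<open>simp add: form_def fun_eq_iff; fail\<close> | (simp add: dehom_def dlist_def; fail) |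
    (simp add: dehom_def dlist_def del: times_divide_eq_left times_divide_eq_right, rule holds_eqI, algebra))+

lemma O5_normalised:
  assumes "polyhedral_polys O5 P0 P1 Pinf"
  shows "normalised_polys O5 P0 P1 Pinf"
proof (rule form_normalised[where
      ?xs0.0 = "[(1, 1), (5, - 1/108)]" and
      ?xs1.0 = "[(0, 1), (4, - 11/36), (8, - 11/3888), (12, 1/1259712)]" and
      xs = "[(0, 1), (4, 7/54), (8, 1/11664)]"])
qed (use assms in \<open>simp add: form_def fun_eq_iff; fail\<close> | (simp add: dehom_def dlist_def; fail) |
    (simp add: dehom_def dlist_def del: times_divide_eq_left times_divide_eq_right, rule holds_eqI, algebra))+

lemma O6_normalised:
  assumes "polyhedral_polys O6 P0 P1 Pinf"
  shows "normalised_polys O6 P0 P1 Pinf"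
proof (rule form_normalised[where
      ?xs0.0 = "[(1, 1), (5, 1/108)]" and
      ?xs1.0 = "[(0, 1), (4, - 7/54), (8, 1/11664)]" and
      xs = "[(0, 1), (4, 11/36), (8, - 11/3888), (12, - 1/1259712)]"])
qed (use assms in \<open>simp add: form_def fun_eq_iff; fail\<close> | (simp add: dehom_def dlist_def; fail) |
    (simp add: dehom_def dlist_def del: times_divide_eq_left times_divide_eq_right, rule holds_eqI, algebra))+

lemma I1_normalised:
  assumes "polyhedral_polys I1 P0 P1 Pinf"
  shows "normalised_polys I1 P0 P1 Pinf"
proof (rule form_normalised[where
      ?xs0.0 = "[(1, 1), (3, - 29/675), (5, 1769/450000), (7, 29/337500), (9, 667/540000000),
      (11, - 667/72900000000), (13, 12673/29160000000000), (17, - 12673/524880000000000000),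
      (19, 667/23619600000000000000), (21, - 667/3149280000000000000000),
      (23, - 29/35429400000000000000000), (25, - 1769/850305600000000000000000000),
      (27, 29/22958251200000000000000000000), (29, - 1/612220032000000000000000000000)]" and
      ?xs1.0 = "[(0, 1), (2, - 19/90), (4, - 19/18000), (6, - 19/135000), (8, - 247/162000000),
      (10, 247/14580000000), (12, - 247/2916000000000), (14, - 19/43740000000000),
      (16, - 19/104976000000000000), (18, - 19/9447840000000000000), (20, 1/1889568000000000000000)]" and
      xs = "[(0, 1), (2, 11/150), (4, - 11/6000), (6, - 11/1350000), (8, - 11/108000000),
      (10, 11/48600000000), (12, 1/5832000000000)]"])
qed (use assms in \<open>simp add: form_def fun_eq_iff; fail\<close> | (simp add: dehom_def dlist_def; fail) |
    (simp add: dehom_def dlist_def del: times_divide_eq_left times_divide_eq_right, rule holds_eqI, algebra))+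

lemma I6_normalised:
  assumes "polyhedral_polys I6 P0 P1 Pinf"
  shows "normalised_polys I6 P0 P1 Pinf"
proof (rule form_normalised[where
      ?xs0.0 = "[(1, 1), (6, 11/1728), (11, - 1/2985984)]" and
      ?xs1.0 = "[(0, 1), (5, - 19/144), (10, 247/1492992), (15, 19/429981696), (20, 1/8916100448256)]" and
      xs = "[(0, 1), (5, 29/96), (10, - 3335/995328), (20, - 3335/2972033482752),
      (25, - 29/855945643032576), (30, 1/26623333280885243904)]"])
qed (use assms in \<open>simp add: form_def fun_eq_iff; fail\<close> | (simp add: dehom_def dlist_def; fail) |
    (simp add: dehom_def dlist_def del: times_divide_eq_left times_divide_eq_right, rule holds_eqI, algebra))+

section \<open>The four sign patterns\<close>

lemma polyhedral_polys_normalised: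
  assumes "valid_polyhedral T" "polyhedral_polys T P0 P1 Pinf"
  shows "normalised_polys T P0 P1 Pinf"
proof (cases T)
  case (D1 n)
  show ?thesis using D1_normalised[of n P0 P1 Pinf] assms unfolding D1 by simp
next
  case (D2 n)
  show ?thesis using D2_normalised[of n P0 P1 Pinf] assms unfolding D2 by simp
next
  case (D3 n)
  show ?thesis using D3_normalised[of n P0 P1 Pinf] assms unfolding D3 by simp
next
  case T1
  show ?thesis using assms(2) T1_normalised unfolding T1 by blast
next
  case T2
  show ?thesis using assms(2) T2_normalised unfolding T2 by blast
next
  case T3
  show ?thesis using assms(2) T3_normalised unfolding T3 by blast
next
  case O1
  show ?thesis using assms(2) O1_normalised unfolding O1 by blast
next
  case O2
  show ?thesis using assms(2) O2_normalised unfolding O2 by blast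
next
  case O3
  show ?thesis using assms(2) O3_normalised unfolding O3 by blast
next
  case O4
  show ?thesis using assms(2) O4_normalised unfolding O4 by blast
next
  case O5
  show ?thesis using assms(2) O5_normalised unfolding O5 by blast
next
  case O6
  show ?thesis using assms(2) O6_normalised unfolding O6 by blast
next
  case I1
  show ?thesis using assms(2) I1_normalised unfolding I1 by blast
next
  case I6
  show ?thesis using assms(2) I6_normalised unfolding I6 by blast
qed (use assms in simp_all)

lemma closure_swap:
  fixes S :: "('a::metric_space \<times> 'b::metric_space) set"
  shows "closure {(p, q). (q, p) \<in> S} = {(p, q). (q, p) \<in> closure S}"
proof -
  have "(p, q) \<in> closure {(p, q). (q, p) \<in> S} \<longleftrightarrow> (q, p) \<in> closure S" for p q
    unfolding closure_approachable by (simp add: Bex_def split_paired_Ex dist_Pair_Pair add.commute) blast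
  thus ?thesis by auto
qed

text \<open>The second description serves the patterns with negative \<open>1 - c\<close>, in which
  the forms are evaluated at (v, u).\<close>

lemma asch_image_curve_germ:
  "asch_image_curve a b c = closure {(p, q). \<exists>x. (x, p, q) \<in> asch_germ (hyp_u a b c) (hyp_v a b c)}"
  "asch_image_curve a b c = {(p, q). (q, p) \<in> closure {(p, q). \<exists>x. (x, p, q) \<in> asch_germ (hyp_v a b c) (hyp_u a b c)}}"
proof -
  show "asch_image_curve a b c = closure {(p, q). \<exists>x. (x, p, q) \<in> asch_germ (hyp_u a b c) (hyp_v a b c)}"
    by (simp add: asch_image_curve_def asch_eq_germ)
  also have "\<dots> = closure {(p, q). (q, p) \<in> {(p, q). \<exists>x. (x, p, q) \<in> asch_germ (hyp_v a b c) (hyp_u a b c)}}"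
    using asch_germ_swap by (intro arg_cong[where f = closure]) blast
  finally show "asch_image_curve a b c =
      {(p, q). (q, p) \<in> closure {(p, q). \<exists>x. (x, p, q) \<in> asch_germ (hyp_v a b c) (hyp_u a b c)}}"
    unfolding closure_swap .
qed

section \<open>Euler's transformation and the exchange of the two solutions\<close>

lemma slit_disc_ball: "x \<in> slit_disc \<Longrightarrow> x \<in> ball 0 1"
  by (simp add: slit_disc_def)

lemma regular_params:
  assumes "\<bar>1 - c\<bar> = 1 / real k" "k \<ge> 2"
  shows "regular_param c" "regular_param (2 - c)"
proof -
  have "1 / real k < 1" using assms(2) by simp
  hence "c > 0" "2 - c > 0" using assms(1) by linarith+
  thus "regular_param c" "regular_param (2 - c)"
    by (auto simp: regular_param_def add_pos_nonneg intro!: less_imp_neq[symmetric])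
qed

text \<open>Passing to (c - a, c - b, c) reverses the signs of c - a - b and a - b and keeps 1 - c;
  both solutions acquire the same factor.\<close>

lemma hyp_uv_euler:
  assumes "regular_param c" "regular_param (2 - c)" "x \<in> slit_disc"
  shows "hyp_u a b c x = (1 - x) powr of_real (c - a - b) * hyp_u (c - a) (c - b) c x"
    and "hyp_v a b c x = (1 - x) powr of_real (c - a - b) * hyp_v (c - a) (c - b) c x"
proof -
  show "hyp_u a b c x = (1 - x) powr of_real (c - a - b) * hyp_u (c - a) (c - b) c x"
    unfolding hyp_u_def by (rule hyp_F_euler[OF assms(1) slit_disc_ball[OF assms(3)]])
  have "2 - c - (a - c + 1) - (b - c + 1) = c - a - b" "2 - c - (a - c + 1) = c - a - c + 1"
    "2 - c - (b - c + 1) = c - b - c + 1" by simp_all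
  thus "hyp_v a b c x = (1 - x) powr of_real (c - a - b) * hyp_v (c - a) (c - b) c x"
    unfolding hyp_v_def
    using hyp_F_euler[OF assms(2) slit_disc_ball[OF assms(3)], of "a - c + 1" "b - c + 1"] by (simp only: mult.left_commute)
qed

text \<open>Passing to (b - c + 1, a - c + 1, 2 - c) reverses the signs of 1 - c and a - b and keeps
  c - a - b; the two solutions change places up to a power of x.\<close>

lemma hyp_uv_swap:
  assumes "x \<noteq> 0"
  shows "hyp_v a b c x = x powr of_real (1 - c) * hyp_u (b - c + 1) (a - c + 1) (2 - c) x"
    and "hyp_u a b c x = x powr of_real (1 - c) * hyp_v (b - c + 1) (a - c + 1) (2 - c) x"
proof -
  show "hyp_v a b c x = x powr of_real (1 - c) * hyp_u (b - c + 1) (a - c + 1) (2 - c) x"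
    by (simp add: hyp_v_def hyp_u_def hyp_F_commute)
  have "b - c + 1 - (2 - c) + 1 = b" "a - c + 1 - (2 - c) + 1 = a" "2 - (2 - c) = c" by simp_all
  hence v: "hyp_v (b - c + 1) (a - c + 1) (2 - c) x = x powr of_real (1 - (2 - c)) * hyp_F b a c x"
    unfolding hyp_v_def by (simp only:)
  have "complex_of_real (1 - c) + complex_of_real (1 - (2 - c)) = 0" by simp
  hence "x powr of_real (1 - c) * x powr of_real (1 - (2 - c)) = 1"
    using assms by (simp only: powr_add[symmetric]) simp
  thus "hyp_u a b c x = x powr of_real (1 - c) * hyp_v (b - c + 1) (a - c + 1) (2 - c) x"
    unfolding v by (simp add: hyp_u_def hyp_F_commute mult.assoc[symmetric])
qed

lemma powr_minus_reciprocal: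
  fixes z :: complex
  assumes "z \<noteq> 0" "y = - (1 / real n)"
  shows "z powr of_real y = 1 / z powr (1 / of_nat n)"
proof -
  have "complex_of_real y = - (1 / of_nat n)" using assms(2) by simp
  thus ?thesis by (simp only: powr_minus) (simp add: divide_inverse)
qed

text \<open>Raising the reduced equation to the gcd gives the unreduced one; for the irreducible
  triples the exponents are coprime and the two equations coincide.\<close>

lemma common_divisor_equation:
  fixes f g :: "complex \<Rightarrow> complex \<Rightarrow> complex"
  assumes T: "valid_polyhedral T" and D: "D = polyhedral_order T div kinf T"
    and B: "B = polyhedral_order T div k0 T - 1 \<or> B = polyhedral_order T div k1 T - 1"
    and K: "K = {(p, q). f p q ^ (D div gcd D B) - g p q ^ (B div gcd D B) = 0}"
  shows "if reducible_equation T then K \<subseteq> {(p, q). f p q ^ D - g p q ^ B = 0} \<and> K = {(p, q). f p q ^ (D div gcd D B) - g p q ^ (B div gcd D B) = 0}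
    else K = {(p, q). f p q ^ D - g p q ^ B = 0}"
proof (cases "reducible_equation T")
  case True
  have "f p q ^ D = g p q ^ B" if "f p q ^ (D div gcd D B) = g p q ^ (B div gcd D B)" for p q
  proof -
    have "f p q ^ D = (f p q ^ (D div gcd D B)) ^ gcd D B" by (simp flip: power_mult)
    also have "\<dots> = g p q ^ B" unfolding that by (simp flip: power_mult)
    finally show ?thesis .
  qed
  thus ?thesis using True K by auto
next
  case False
  hence "coprime D B" using reducible_equation_iff[OF T] B unfolding D by auto
  thus ?thesis using False K by (simp add: coprime_iff_gcd_eq_1)
qed

section \<open>Assembly of the four sign patterns\<close>

theorem corollary2p2:
  fixes T :: polyhedral and N :: nat and a b c \<mu>0 \<mu>1 \<mu>inf :: real
    and P0 P1 Pinf :: "complex \<Rightarrow> complex \<Rightarrow> complex"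
  assumes "valid_polyhedral T"
    and "polyhedral_polys T P0 P1 Pinf"
    and "N = polyhedral_order T"
    and "\<mu>0 = 1 - c" and "\<mu>1 = c - a - b" and "\<mu>inf = a - b"
    and "\<bar>\<mu>0\<bar> = 1 / real (k0 T)" and "\<bar>\<mu>1\<bar> = 1 / real (k1 T)" and "\<bar>\<mu>inf\<bar> = 1 / real (kinf T)"
  shows
    "(\<mu>0 > 0 \<and> \<mu>1 > 0 \<and> \<mu>inf > 0 \<longrightarrow>
        asch_image_curve a b c = {(p, q). Pinf p q - 1 = 0} \<and>
        (\<forall>(x, p, q) \<in> asch a b c. x = P0 p q ^ k0 T))
   \<and> (\<mu>0 > 0 \<and> \<mu>1 < 0 \<and> \<mu>inf < 0 \<longrightarrow>
        (let A = N div kinf T; B = N div k1 T - 1; g = gcd A B;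
             E = {(p, q). P1 p q ^ A - Pinf p q ^ B = 0} in
           if reducible_equation T
           then asch_image_curve a b c \<subseteq> E \<and>
                asch_image_curve a b c = {(p, q). P1 p q ^ (A div g) - Pinf p q ^ (B div g) = 0}
           else asch_image_curve a b c = E) \<and>
        (\<forall>(x, p, q) \<in> asch a b c. x = P0 p q ^ k0 T * Pinf p q powi (- int (kinf T))))
   \<and> (\<mu>0 < 0 \<and> \<mu>1 > 0 \<and> \<mu>inf < 0 \<longrightarrow>
        (let A = N div kinf T; B = N div k0 T - 1; g = gcd A B;
             E = {(p, q). P0 q p ^ A - Pinf q p ^ B = 0} in
           if reducible_equation T
           then asch_image_curve a b c \<subseteq> E \<and>
                asch_image_curve a b c = {(p, q). P0 q p ^ (A div g) - Pinf q p ^ (B div g) = 0}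
           else asch_image_curve a b c = E) \<and>
        (\<forall>(x, p, q) \<in> asch a b c. x = P0 q p ^ k0 T * Pinf q p powi (- int (kinf T))))
   \<and> (\<mu>0 < 0 \<and> \<mu>1 < 0 \<and> \<mu>inf > 0 \<longrightarrow>
        asch_image_curve a b c =
          {(p, q). (P0 q p * P1 q p) ^ (N div kinf T) -
                   Pinf q p ^ (N div k0 T + N div k1 T - 1) = 0} \<and>
        (\<forall>(x, p, q) \<in> asch a b c. x = P0 q p ^ k0 T * Pinf q p powi (- int (kinf T))))"
proof -
  note T = assms(1) and N = assms(3)
  have normalised: "normalised_polys T P0 P1 Pinf" by (rule polyhedral_polys_normalised[OF assms(1,2)])
  have reg: "regular_param c" "regular_param (2 - c)"
    using regular_params[of c "k0 T"] assms(4,7) polyhedral_exponents(1)[OF T] by auto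
  have nz: "x \<noteq> 0" "1 - x \<noteq> 0" if "x \<in> slit_disc" for x using that by (auto simp: slit_disc_def)
  have i: "asch_image_curve a b c = {(p, q). Pinf p q - 1 = 0} \<and> (\<forall>(x, p, q) \<in> asch a b c. x = P0 p q ^ k0 T)"
    if "\<mu>0 > 0" "\<mu>1 > 0" "\<mu>inf > 0"
  proof -
    interpret normalised a b c "k0 T" "k1 T" "kinf T" "polyhedral_order T" "polyhedral_order T div k0 T"
      "polyhedral_order T div k1 T" "polyhedral_order T div kinf T" P0 P1 Pinf
      by (rule normalised_locale[OF T normalised]) (use that assms(4-) in auto)
    show ?thesis
      using asch_curve_positive(1) asch_curve_positive(2) unfolding asch_image_curve_germ(1) asch_eq_germ by blast
  qed
  have ii: "(let A = N div kinf T; B = N div k1 T - 1; g = gcd A B;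
             E = {(p, q). P1 p q ^ A - Pinf p q ^ B = 0} in
           if reducible_equation T
           then asch_image_curve a b c \<subseteq> E \<and>
                asch_image_curve a b c = {(p, q). P1 p q ^ (A div g) - Pinf p q ^ (B div g) = 0}
           else asch_image_curve a b c = E) \<and>
        (\<forall>(x, p, q) \<in> asch a b c. x = P0 p q ^ k0 T * Pinf p q powi (- int (kinf T)))"
    if s: "\<mu>0 > 0" "\<mu>1 < 0" "\<mu>inf < 0"
  proof -
    \<comment> \<open>Euler's transformation makes all three exponent differences positive; its
      factor (1 - x)^(-1/l) is 1 / P1, so M = P1.\<close>
    interpret L: normalised "c - a" "c - b" c "k0 T" "k1 T" "kinf T" "polyhedral_order T" "polyhedral_order T div k0 T"
      "polyhedral_order T div k1 T" "polyhedral_order T div kinf T" P0 P1 Pinf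
      by (rule normalised_locale[OF T normalised]) (use s assms(4-) in auto)
    have e: "c - a - b = - (1 / real (k1 T))" using s assms(5,8) by simp
    have uv: "hyp_u a b c x = hyp_u (c - a) (c - b) c x / P1 (hyp_u (c - a) (c - b) c x) (hyp_v (c - a) (c - b) c x)"
      "hyp_v a b c x = hyp_v (c - a) (c - b) c x / P1 (hyp_u (c - a) (c - b) c x) (hyp_v (c - a) (c - b) c x)"
      if x: "x \<in> slit_disc" for x
      unfolding L.slit_disc_values(2)[OF x] hyp_uv_euler[OF reg x, of a b] powr_minus_reciprocal[OF nz(2)[OF x] e]
      by simp_all
    have cz: "p = 0 \<and> q = 0" if "P1 p q = 0" "Pinf p q = 0" for p q
      using L.syzygy[of p q] that L.kpos L.lpos L.rpos
      by (intro L.common_zero_trivial) (auto simp: power_0_left)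
    have cont: "continuous_on UNIV (\<lambda>y. P1 (fst y) (snd y))"
      by (intro homogeneous_poly2_continuous[OF L.hom1] continuous_intros)
    have W: "(\<lambda>x. 1 - x) holomorphic_on (UNIV :: complex set)" by (intro holomorphic_intros)
    note facts = homogeneous_poly2_scale[OF L.hom1] L.m1_ge homogeneous_poly2_holomorphic[OF L.hom1] cont cz W
      L.slit_disc_powers(2) L.lpos uv
    have "closure {(p, q). \<exists>x. (x, p, q) \<in> asch_germ (hyp_u a b c) (hyp_v a b c)} =
        {(p, q). P1 p q ^ (N div kinf T div gcd (N div kinf T) (N div k1 T - 1)) -
        Pinf p q ^ ((N div k1 T - 1) div gcd (N div kinf T) (N div k1 T - 1)) = 0}"
      unfolding N by (rule L.asch_curve_twisted(1)[where W = "\<lambda>x. 1 - x" and n = "k1 T"]) (assumption | rule facts)+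
    hence "asch_image_curve a b c = {(p, q). P1 p q ^ (N div kinf T div gcd (N div kinf T) (N div k1 T - 1)) -
        Pinf p q ^ ((N div k1 T - 1) div gcd (N div kinf T) (N div k1 T - 1)) = 0}"
      unfolding asch_image_curve_germ(1) .
    moreover have "x = P0 p q ^ k0 T * Pinf p q powi (- int (kinf T))" if xpq: "(x, p, q) \<in> asch a b c" for x p q
      by (rule L.asch_curve_twisted(2)[where M = P1 and W = "\<lambda>x. 1 - x" and n = "k1 T" and
        u = "hyp_u a b c" and v = "hyp_v a b c"]) (assumption | rule facts xpq[unfolded asch_eq_germ])+
    ultimately show ?thesis
      using common_divisor_equation[OF T, of "N div kinf T" "N div k1 T - 1" "asch_image_curve a b c" P1 Pinf]
      unfolding Let_def N by blast
  qed
  have iii: "(let A = N div kinf T; B = N div k0 T - 1; g = gcd A B;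
             E = {(p, q). P0 q p ^ A - Pinf q p ^ B = 0} in
           if reducible_equation T
           then asch_image_curve a b c \<subseteq> E \<and>
                asch_image_curve a b c = {(p, q). P0 q p ^ (A div g) - Pinf q p ^ (B div g) = 0}
           else asch_image_curve a b c = E) \<and>
        (\<forall>(x, p, q) \<in> asch a b c. x = P0 q p ^ k0 T * Pinf q p powi (- int (kinf T)))"
    if s: "\<mu>0 < 0" "\<mu>1 > 0" "\<mu>inf < 0"
  proof -
    \<comment> \<open>Exchanging the solutions makes all three exponent differences positive; its
      factor x^(-1/k) is 1 / P0, so M = P0.\<close>
    interpret L: normalised "b - c + 1" "a - c + 1" "2 - c" "k0 T" "k1 T" "kinf T" "polyhedral_order T" "polyhedral_order T div k0 T"
      "polyhedral_order T div k1 T" "polyhedral_order T div kinf T" P0 P1 Pinf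
      by (rule normalised_locale[OF T normalised]) (use s assms(4-) in auto)
    have e: "1 - c = - (1 / real (k0 T))" using s assms(4,7) by simp
    let ?u = "hyp_u (b - c + 1) (a - c + 1) (2 - c)" and ?v = "hyp_v (b - c + 1) (a - c + 1) (2 - c)"
    have uv: "hyp_v a b c x = ?u x / P0 (?u x) (?v x)" "hyp_u a b c x = ?v x / P0 (?u x) (?v x)"
      if x: "x \<in> slit_disc" for x
      unfolding L.slit_disc_values(1)[OF x] hyp_uv_swap[OF nz(1)[OF x], of a b c] powr_minus_reciprocal[OF nz(1)[OF x] e]
      by simp_all
    have cont: "continuous_on UNIV (\<lambda>y. P0 (fst y) (snd y))"
      by (intro homogeneous_poly2_continuous[OF L.hom0] continuous_intros)
    have W: "(\<lambda>x. x) holomorphic_on (UNIV :: complex set)" by (intro holomorphic_intros)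
    have cz: "p = 0 \<and> q = 0" if "P0 p q = 0" "Pinf p q = 0" for p q
      using that by (intro L.common_zero_trivial)
    note facts = homogeneous_poly2_scale[OF L.hom0] L.m0_ge homogeneous_poly2_holomorphic[OF L.hom0] cont cz W
      L.slit_disc_powers(1) L.kpos uv
    have "closure {(p, q). \<exists>x. (x, p, q) \<in> asch_germ (hyp_v a b c) (hyp_u a b c)} =
        {(p, q). P0 p q ^ (N div kinf T div gcd (N div kinf T) (N div k0 T - 1)) -
        Pinf p q ^ ((N div k0 T - 1) div gcd (N div kinf T) (N div k0 T - 1)) = 0}"
      unfolding N by (rule L.asch_curve_twisted(1)[where W = "\<lambda>x. x" and n = "k0 T"]) (assumption | rule facts)+
    hence "asch_image_curve a b c = {(p, q). P0 q p ^ (N div kinf T div gcd (N div kinf T) (N div k0 T - 1)) -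
        Pinf q p ^ ((N div k0 T - 1) div gcd (N div kinf T) (N div k0 T - 1)) = 0}"
      unfolding asch_image_curve_germ(2) by simp
    moreover have "x = P0 q p ^ k0 T * Pinf q p powi (- int (kinf T))" if xpq: "(x, p, q) \<in> asch a b c" for x p q
      by (rule L.asch_curve_twisted(2)[where M = P0 and W = "\<lambda>x. x" and n = "k0 T" and
        u = "hyp_v a b c" and v = "hyp_u a b c"])
        (assumption | rule facts xpq[unfolded asch_eq_germ, THEN asch_germ_swap[THEN iffD1]])+
    ultimately show ?thesis
      using common_divisor_equation[OF T, of "N div kinf T" "N div k0 T - 1" "asch_image_curve a b c" "\<lambda>p q. P0 q p" "\<lambda>p q. Pinf q p"]
      unfolding Let_def N by blast
  qed
  have iv: "asch_image_curve a b c =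
          {(p, q). (P0 q p * P1 q p) ^ (N div kinf T) - Pinf q p ^ (N div k0 T + N div k1 T - 1) = 0} \<and>
        (\<forall>(x, p, q) \<in> asch a b c. x = P0 q p ^ k0 T * Pinf q p powi (- int (kinf T)))"
    if s: "\<mu>0 < 0" "\<mu>1 < 0" "\<mu>inf > 0"
  proof -
    \<comment> \<open>Both transformations together reverse the signs of 1 - c and c - a - b and
      keep a - b; the combined factor is 1 / (P0 P1).\<close>
    interpret L: normalised "1 - b" "1 - a" "2 - c" "k0 T" "k1 T" "kinf T" "polyhedral_order T" "polyhedral_order T div k0 T"
      "polyhedral_order T div k1 T" "polyhedral_order T div kinf T" P0 P1 Pinf
      by (rule normalised_locale[OF T normalised]) (use s assms(4-) in auto)
    have e0: "1 - c = - (1 / real (k0 T))" and e1: "c - a - b = - (1 / real (k1 T))" using s assms(4,5,7,8) by simp_all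
    let ?u = "hyp_u (1 - b) (1 - a) (2 - c)" and ?v = "hyp_v (1 - b) (1 - a) (2 - c)"
    have sh: "2 - c - (b - c + 1) = 1 - b" "2 - c - (a - c + 1) = 1 - a" "1 - b - (a - c + 1) = c - a - b"
      by simp_all
    have uv: "hyp_v a b c x = ?u x / (P0 (?u x) (?v x) * P1 (?u x) (?v x))" "hyp_u a b c x = ?v x / (P0 (?u x) (?v x) * P1 (?u x) (?v x))"
      if x: "x \<in> slit_disc" for x
    proof -
      have r: "regular_param (2 - c)" "regular_param (2 - (2 - c))" using reg by simp_all
      note eu = hyp_uv_euler[OF r x, of "b - c + 1" "a - c + 1", unfolded sh]
      show "hyp_v a b c x = ?u x / (P0 (?u x) (?v x) * P1 (?u x) (?v x))" "hyp_u a b c x = ?v x / (P0 (?u x) (?v x) * P1 (?u x) (?v x))"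
        unfolding L.slit_disc_values(1,2)[OF x] hyp_uv_swap[OF nz(1)[OF x], of a b c] eu
          powr_minus_reciprocal[OF nz(1)[OF x] e0] powr_minus_reciprocal[OF nz(2)[OF x] e1]
        by simp_all
    qed
    define d where "d = polyhedral_order T div k0 T + polyhedral_order T div k1 T"
    have d: "d \<ge> 2" using L.m0_ge by (simp add: d_def)
    have scale: "P0 (t * u) (t * v) * P1 (t * u) (t * v) = t ^ d * (P0 u v * P1 u v)" for t u v
      unfolding homogeneous_poly2_scale[OF L.hom0] homogeneous_poly2_scale[OF L.hom1] d_def power_add by simp
    have hol: "(\<lambda>x. P0 (f x) (g x) * P1 (f x) (g x)) holomorphic_on S"
      if "f holomorphic_on S" "g holomorphic_on S" for f g S
      by (intro holomorphic_intros homogeneous_poly2_holomorphic[OF L.hom0] homogeneous_poly2_holomorphic[OF L.hom1] that)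
    have cont: "continuous_on UNIV (\<lambda>y. P0 (fst y) (snd y) * P1 (fst y) (snd y))"
      by (intro continuous_intros homogeneous_poly2_continuous[OF L.hom0] homogeneous_poly2_continuous[OF L.hom1])
    have cz: "p = 0 \<and> q = 0" if "P0 p q * P1 p q = 0" "Pinf p q = 0" for p q
      using L.syzygy[of p q] that L.kpos L.lpos L.rpos
      by (intro L.common_zero_trivial) (auto simp: power_0_left)
    \<comment> \<open>From P0^k = x and P1^l = 1 - x, the product P0 P1 has the polynomial x^l (1 -
      x)^k as its k l-th power.\<close>
    have W: "(\<lambda>x. x ^ k1 T * (1 - x) ^ k0 T) holomorphic_on (UNIV :: complex set)" by (intro holomorphic_intros)
    have W2: "(P0 (?u x) (?v x) * P1 (?u x) (?v x)) ^ (k0 T * k1 T) = x ^ k1 T * (1 - x) ^ k0 T"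
      if x: "x \<in> slit_disc" for x
    proof -
      have "(P0 (?u x) (?v x) * P1 (?u x) (?v x)) ^ (k0 T * k1 T) = (P0 (?u x) (?v x) ^ k0 T) ^ k1 T * (P1 (?u x) (?v x) ^ k1 T) ^ k0 T"
        by (simp add: power_mult_distrib mult.commute flip: power_mult)
      thus ?thesis unfolding L.slit_disc_powers(1,2)[OF x] .
    qed
    have kl: "k0 T * k1 T > 0" using L.kpos L.lpos by simp
    have nzM: "P0 p q * P1 p q \<noteq> 0" if "P0 p q \<noteq> 0" "P1 p q \<noteq> 0" for p q using that by simp
    note facts = scale d hol cont nzM cz W W2 kl uv
    \<comment> \<open>The degree sum gives (d - 1) + m = N + 1 = r m + 1, so m and d - 1 are coprime
      for every triple and the exponents stay as they are.\<close>
    have g: "gcd (polyhedral_order T div kinf T) (d - 1) = 1"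
    proof -
      define m where "m = polyhedral_order T div kinf T"
      define h where "h = gcd m (d - 1)"
      have "h dvd m" "h dvd d - 1" by (simp_all add: h_def)
      moreover have "d - 1 + m = kinf T * m + 1"
        using L.msum L.Ninf L.m0_ge unfolding d_def m_def by linarith
      ultimately have "h dvd 1"
        by (metis dvd_add dvd_add_right_iff dvd_mult)
      thus ?thesis by (simp add: h_def m_def)
    qed
    have "closure {(p, q). \<exists>x. (x, p, q) \<in> asch_germ (hyp_v a b c) (hyp_u a b c)} =
        {(p, q). (P0 p q * P1 p q) ^ (N div kinf T) - Pinf p q ^ (N div k0 T + N div k1 T - 1) = 0}"
    proof -
      have "closure {(p, q). \<exists>x. (x, p, q) \<in> asch_germ (hyp_v a b c) (hyp_u a b c)} =
        {(p, q). (P0 p q * P1 p q) ^ (polyhedral_order T div kinf T div gcd (polyhedral_order T div kinf T) (d - 1)) -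
        Pinf p q ^ ((d - 1) div gcd (polyhedral_order T div kinf T) (d - 1)) = 0}"
        by (rule L.asch_curve_twisted(1)[where M = "\<lambda>p q. P0 p q * P1 p q" and W = "\<lambda>x. x ^ k1 T * (1 - x) ^ k0 T"
          and n = "k0 T * k1 T"]) (assumption | rule facts)+
      thus ?thesis unfolding g N d_def[symmetric] by simp
    qed
    hence "asch_image_curve a b c =
        {(p, q). (P0 q p * P1 q p) ^ (N div kinf T) - Pinf q p ^ (N div k0 T + N div k1 T - 1) = 0}"
      unfolding asch_image_curve_germ(2) by simp
    moreover have "x = P0 q p ^ k0 T * Pinf q p powi (- int (kinf T))" if xpq: "(x, p, q) \<in> asch a b c" for x p q
      by (rule L.asch_curve_twisted(2)[where M = "\<lambda>p q. P0 p q * P1 p q" and W = "\<lambda>x. x ^ k1 T * (1 - x) ^ k0 T" and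
        n = "k0 T * k1 T" and u = "hyp_v a b c" and v = "hyp_u a b c"])
        (assumption | rule facts xpq[unfolded asch_eq_germ, THEN asch_germ_swap[THEN iffD1]])+
    ultimately show ?thesis by blast
  qed
  show ?thesis
    by (rule conjI[OF impI conjI[OF impI conjI[OF impI impI]]]; elim conjE; (rule i ii iii iv; assumption))
qed

end
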